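(* Let $\mathcal{A}$, $G_z$ and $J_\mathcal{A}$ be as in the context, and let $T$ be a regular unimodular triangulation of the Newton polytope $\Delta_G=\operatorname{Conv}\{\mathrm{a}_1,\ldots,\mathrm{a}_N\}$, whose simplices are identified with index sets $\sigma\subset\{1,\ldots,N\}$, $|\sigma|=n+1$, $|\det\mathcal{A}_\sigma|=1$; write $\bar\sigma=\{1,\ldots,N\}\setminus\sigma$. Then for generic ${\underline{\nu}}\in\mathbb{C}^{n+1}$ (i.e. such that $J_\mathcal{A}$ has no pole at ${\underline{\nu}}$ and none of the series below vanishes identically) there is a nonempty open set of $z$ with $\operatorname{Re}z_j>0$ on which all the series below converge absolutely and $$J_\mathcal{A}({\underline{\nu}},z)=\sum_{\sigma\in T}z_\sigma^{-\mathcal{A}_\sigma^{-1}{\underline{\nu}}}\sum_{\lambda\in\mathbb{N}_0^{N-n-1}}\frac{\Gamma\!\left(\mathcal{A}_\sigma^{-1}{\underline{\nu}}+\mathcal{A}_\sigma^{-1}\mathcal{A}_{\bar\sigma}\lambda\right)}{\lambda!}\,\frac{z_{\bar\sigma}^{\lambda}}{(-z_\sigma)^{\mathcal{A}_\sigma^{-1}\mathcal{A}_{\bar\sigma}\lambda}}.$$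
   Context: Fix integers $n\ge1$, $N\ge n+1$ and pairwise distinct column vectors $\mathrm{a}_1,\ldots,\mathrm{a}_N\in\mathbb{Z}_{\geq0}^n$; write $\mathcal{A}\in\mathbb{Z}_{\ge0}^{(n+1)\times N}$ for the matrix whose $j$-th column is $(1,\mathrm{a}_j)$ (first row all ones). For $z\in\mathbb{C}^N$ put $G_z(x)=\sum_{j=1}^N z_j x^{\mathrm{a}_j}$. The generalized Feynman integral is (the meromorphic continuation in ${\underline{\nu}}=(\nu_0,\nu)\in\mathbb{C}\times\mathbb{C}^n$ of) $J_\mathcal{A}({\underline{\nu}},z)=\Gamma(\nu_0)\int_{\mathbb{R}^n_{>0}}x^{\nu-1}G_z(x)^{-\nu_0}\,dx$. Multi-index notation: $\Gamma(v)=\prod_i\Gamma(v_i)$, $\lambda!=\prod_i\lambda_i!$, $w^u=\prod_iw_i^{u_i}$ (principal branches); $\mathcal{A}_\sigma$ is the submatrix of columns indexed by $\sigma$, $z_\sigma=(z_i)_{i\in\sigma}$. A triangulation of a polytope $\operatorname{Conv}(\mathrm{A})$ is a set of full-dimensional simplices spanned by points of $\mathrm{A}$ whose union is the polytope and any two of which intersect in a common face (possibly empty). It is regular if there is $\omega\in\mathbb{R}^N$ such that for each simplex $\sigma$ there is $r_\sigma\in\mathbb{R}^{n+1}$ with $r_\sigma\cdot(1,\mathrm{a}_j)=\omega_j$ for $j\in\sigma$ and $r_\sigma\cdot(1,\mathrm{a}_j)<\omega_j$ for $j\notin\sigma$. It is unimodular if every simplex has $|\det\mathcal{A}_\sigma|=1$.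 *)

theory Defs
  imports "HOL-Analysis.Analysis"
begin

(* Conventions.
   - 'n :: finite indexes the coordinates of R^n  (n = CARD('n)).
   - 'j :: finite indexes the columns 1..N       (N = CARD('j)).
   - a j :: nat^'n is the exponent vector a_j.
   - Vectors in C^(n+1) are  complex^('n option); the coordinate None is the
     0-th coordinate (nu_0), Some i is the coordinate i of nu.
   - A simplex sigma is a subset of 'j; its complement is  - sigma. *)

definition Acol :: "('j \<Rightarrow> nat^'n) \<Rightarrow> 'j \<Rightarrow> int^('n option)" where
  "Acol a j = (\<chi> r. case r of None \<Rightarrow> 1 | Some i \<Rightarrow> int (a j $ i))"

(* a fixed enumeration of the columns in sigma (the column order only affects
   the sign of the determinant and not A_sigma^{-1} as a map to C^sigma) *)
definition col_enum :: "'j set \<Rightarrow> ('n::finite option \<Rightarrow> 'j)" where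
  "col_enum \<sigma> = (SOME g. bij_betw g UNIV \<sigma>)"

definition Asub :: "('j \<Rightarrow> nat^'n::finite) \<Rightarrow> 'j set \<Rightarrow> int^('n option)^('n option)" where
  "Asub a \<sigma> = (\<chi> r c. Acol a (col_enum \<sigma> c) $ r)"

definition Ainv :: "('j \<Rightarrow> nat^'n::finite) \<Rightarrow> 'j set \<Rightarrow> complex^('n option) \<Rightarrow> 'j \<Rightarrow> complex" where
  "Ainv a \<sigma> v = (\<lambda>j. if j \<in> \<sigma> then
      (matrix_inv (\<chi> r c. (of_int (Asub a \<sigma> $ r $ c) :: complex)) *v v) $ (inv_into UNIV (col_enum \<sigma>) j)
     else 0)"

definition Abar_mult :: "('j::finite \<Rightarrow> nat^'n::finite) \<Rightarrow> 'j set \<Rightarrow> ('j \<Rightarrow> nat) \<Rightarrow> complex^('n option)" where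
  "Abar_mult a \<sigma> l = (\<chi> r. \<Sum>k\<in>-\<sigma>. of_nat (l k) * of_int (Acol a k $ r))"

definition lambdas :: "'j set \<Rightarrow> ('j \<Rightarrow> nat) set" where
  "lambdas \<sigma> = {l. \<forall>j\<in>\<sigma>. l j = 0}"

definition pt :: "('j \<Rightarrow> nat^'n) \<Rightarrow> 'j \<Rightarrow> real^'n" where
  "pt a j = (\<chi> i. real (a j $ i))"

definition regular_unimodular_triangulation ::
  "('j::finite \<Rightarrow> nat^'n::finite) \<Rightarrow> 'j set set \<Rightarrow> bool" where
  "regular_unimodular_triangulation a T \<longleftrightarrow>
     \<comment> \<open>full-dimensional simplices spanned by points of A\<close>
     (\<forall>\<sigma>\<in>T. card \<sigma> = CARD('n) + 1 \<and>
               aff_dim (convex hull (pt a ` \<sigma>)) = int CARD('n)) \<and>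
     \<comment> \<open>covering the Newton polytope\<close>
     \<Union> ((\<lambda>\<sigma>. convex hull (pt a ` \<sigma>)) ` T) = convex hull (range (pt a)) \<and>
     \<comment> \<open>pairwise intersecting in a common (possibly empty) face\<close>
     (\<forall>\<sigma>\<in>T. \<forall>\<tau>\<in>T.
        (convex hull (pt a ` \<sigma>) \<inter> convex hull (pt a ` \<tau>)) face_of convex hull (pt a ` \<sigma>) \<and>
        (convex hull (pt a ` \<sigma>) \<inter> convex hull (pt a ` \<tau>)) face_of convex hull (pt a ` \<tau>)) \<and>
     \<comment> \<open>regular\<close>
     (\<exists>\<omega> :: 'j \<Rightarrow> real. \<forall>\<sigma>\<in>T. \<exists>r0 :: real. \<exists>r :: real^'n.
        (\<forall>j\<in>\<sigma>. r0 + r \<bullet> pt a j = \<omega> j) \<and> (\<forall>j. j \<notin> \<sigma> \<longrightarrow> r0 + r \<bullet> pt a j < \<omega> j)) \<and>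
     \<comment> \<open>unimodular\<close>
     (\<forall>\<sigma>\<in>T. \<bar>det (Asub a \<sigma>)\<bar> = 1)"

definition Gpoly :: "('j::finite \<Rightarrow> nat^'n::finite) \<Rightarrow> complex^'j \<Rightarrow> real^'n \<Rightarrow> complex" where
  "Gpoly a z x = (\<Sum>j\<in>UNIV. z $ j * (\<Prod>i\<in>UNIV. complex_of_real (x $ i) ^ (a j $ i)))"

definition posorth :: "(real^'n) set" where
  "posorth = {x. \<forall>i. 0 < x $ i}"

definition EM_integrand :: "('j::finite \<Rightarrow> nat^'n::finite) \<Rightarrow> complex^('n option) \<Rightarrow> complex^'j \<Rightarrow> real^'n \<Rightarrow> complex" where
  "EM_integrand a nu z x =
     (\<Prod>i\<in>UNIV. complex_of_real (x $ i) powr (nu $ Some i - 1)) * Gpoly a z x powr (- (nu $ None))"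

definition EM_conv :: "('j::finite \<Rightarrow> nat^'n::finite) \<Rightarrow> complex^'j \<Rightarrow> (complex^('n option)) set" where
  "EM_conv a z = {nu. set_integrable lborel posorth (EM_integrand a nu z)}"

definition J_int :: "('j::finite \<Rightarrow> nat^'n::finite) \<Rightarrow> complex^('n option) \<Rightarrow> complex^'j \<Rightarrow> complex" where
  "J_int a nu z = Gamma (nu $ None) * (LINT x : posorth | lborel. EM_integrand a nu z x)"

(* holomorphic in several complex variables (Osgood: continuous and holomorphic
   in each variable separately) *)
definition holo_several :: "(complex^'k::finite \<Rightarrow> complex) \<Rightarrow> (complex^'k) set \<Rightarrow> bool" where
  "holo_several F U \<longleftrightarrow> open U \<and> continuous_on U F \<and>
     (\<forall>p\<in>U. \<forall>k. (\<lambda>w. F (\<chi> l. if l = k then w else p $ l)) field_differentiable (at (p $ k)))"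

(* (U, V, F) is an analytic continuation of nu |-> J_A(nu, z): F holomorphic on
   the connected open set U and equal to the integral on a nonempty open set V
   of parameters where the integral converges. The meromorphic continuation
   J_A(., z) has no pole at nu iff such data with nu \<in> U exist, and then its value
   at nu is F nu. *)
definition J_continuation ::
  "('j::finite \<Rightarrow> nat^'n::finite) \<Rightarrow> complex^'j \<Rightarrow> (complex^('n option)) set \<Rightarrow>
   (complex^('n option)) set \<Rightarrow> (complex^('n option) \<Rightarrow> complex) \<Rightarrow> bool" where
  "J_continuation a z U V F \<longleftrightarrow>
     connected U \<and> holo_several F U \<and> open V \<and> V \<noteq> {} \<and> V \<subseteq> U \<and> V \<subseteq> EM_conv a z \<and>
     (\<forall>nu\<in>V. F nu = J_int a nu z)"

definition gamma_term ::
  "('j::finite \<Rightarrow> nat^'n::finite) \<Rightarrow> 'j set \<Rightarrow> complex^('n option) \<Rightarrow> complex^'j \<Rightarrow> ('j \<Rightarrow> nat) \<Rightarrow> complex" where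
  "gamma_term a \<sigma> nu z l =
     (\<Prod>j\<in>\<sigma>. Gamma (Ainv a \<sigma> nu j + Ainv a \<sigma> (Abar_mult a \<sigma> l) j))
       / of_nat (\<Prod>k\<in>-\<sigma>. fact (l k))
     * (\<Prod>k\<in>-\<sigma>. (z $ k) ^ (l k))
       / (\<Prod>j\<in>\<sigma>. (- (z $ j)) powr (Ainv a \<sigma> (Abar_mult a \<sigma> l) j))"

definition gamma_prefactor ::
  "('j::finite \<Rightarrow> nat^'n::finite) \<Rightarrow> 'j set \<Rightarrow> complex^('n option) \<Rightarrow> complex^'j \<Rightarrow> complex" where
  "gamma_prefactor a \<sigma> nu z = (\<Prod>j\<in>\<sigma>. (z $ j) powr (- Ainv a \<sigma> nu j))"

end

(* Inserting Gamma(nu_0) G^(-nu_0) as a Gamma integral turns J into the integral of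
   exp(nu . w) exp(- sum_j z_j exp(A_j . w)) over R^(n+1). Expand exp(- sum_j u_j) into the
   multiple power series over lambda in N^N and sort the terms: for generic nu each point
   Re nu + A lambda lies in the interior of the cone over exactly one simplex sigma of T
   (existence because T covers the polytope, uniqueness by regularity). For fixed sigma, summing
   over the sigma-components of lambda gives tails of the exponential series, and after the
   unimodular substitution u = A_sigma . w the integral factors into one-dimensional integrals,
   which the Cauchy--Saalschuetz formula evaluates to values of Gamma left of the imaginary axis:
   these are the terms of the Gamma series of sigma.
   This proves the formula on an open set of nu inside any open set of convergence. As the
   shifts A_sigma^(-1) A lambda are integral, multiplication by prod sin(pi A_sigma^(-1) nu) makes
   the Gamma series entire in nu, so the identity theorem extends the formula to the continuation.
   The region of convergence does not depend on nu. *)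

theory Submission
  imports Defs "HOL-Complex_Analysis.Complex_Analysis" "HOL-Real_Asymp.Real_Asymp"
begin

(* Otherwise the dollar sign of vec_nth is ambiguous. *)
no_notation fps_nth (infixl \<open>$\<close> 75)

section \<open>Measure theory: exponential and unimodular substitutions\<close>

text \<open>The obstacle is that no single term of the expanded exponential is integrable against
  exp(nu . w). Sorting by cones repairs this: for the simplex sigma, the condition that Re nu + A
  lambda lies in its cone bounds each sigma-component of lambda from below, and the bound
  \<open>tail_index\<close> depends only on the other components. It is also exactly the number of
  Taylor terms to remove for the Gamma integral to converge left of the imaginary axis, so the class
  sums are integrable. The set V in \<open>J_continuation\<close> is an arbitrary open set of
  convergence, so Re nu in the cone over the polytope cannot be assumed. It is deduced from
  convergence: otherwise some translation would multiply a minorant of the integrand by a factor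
  larger than 1. The generic nu of the theorem avoids the poles of the Gamma factors, but some
  A_sigma^(-1) nu may still have integral coordinates, where the sine product vanishes and cannot be
  divided out. There the formula follows from continuity of both sides and from nearby points
  without integral coordinates.\<close>

lemma measure_eqI_box:
  fixes M N :: "'a::euclidean_space measure"
  assumes sets: "sets M = sets borel" "sets N = sets borel"
    and eq: "\<And>l u. emeasure M (box l u) = emeasure N (box l u)"
    and fin: "\<And>l u. emeasure M (box l u) \<noteq> \<infinity>"
  shows "M = N"
proof (rule measure_eqI_generator_eq)
  let ?E = "range (\<lambda>(a, b). box a b::'a set)"
  show "Int_stable ?E"
    by (auto simp: Int_stable_def box_Int_box)
  show "?E \<subseteq> Pow UNIV" "sets M = sigma_sets UNIV ?E" "sets N = sigma_sets UNIV ?E"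
    by (simp_all add: borel_eq_box sets)
  let ?A = "\<lambda>n::nat. box (- (real n *\<^sub>R One)) (real n *\<^sub>R One) :: 'a set"
  show "range ?A \<subseteq> ?E" "(\<Union>i. ?A i) = UNIV"
    unfolding UN_box_eq_UNIV by auto
  show "emeasure M (?A i) \<noteq> \<infinity>" for i by (rule fin)
  show "emeasure M X = emeasure N X" if "X \<in> ?E" for X
    using that eq by auto
qed

text \<open>Moves Lebesgue measure between index types: from R^m to the well-ordered copy of its
  index type and back, and from R x R^n to R^(n option).\<close>

lemma lborel_distr_Basis_bij:
  fixes f :: "'a::euclidean_space \<Rightarrow> 'b::euclidean_space"
  assumes f: "linear f" and bij: "bij_betw f Basis Basis"
  shows "distr lborel borel f = lborel"
proof (rule lborel_eqI[symmetric])
  have inner_f: "f x \<bullet> f b = x \<bullet> b" if "b \<in> Basis" for x b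
  proof -
    have "f x \<bullet> f b = f (\<Sum>c\<in>Basis. (x \<bullet> c) *\<^sub>R c) \<bullet> f b"
      by (simp add: euclidean_representation)
    also have "\<dots> = (\<Sum>c\<in>Basis. (x \<bullet> c) * (f c \<bullet> f b))"
      using f by (simp add: linear_sum linear_scale inner_sum_left)
    also have "\<dots> = (\<Sum>c\<in>Basis. if c = b then x \<bullet> c else 0)"
    proof (rule sum.cong)
      fix c :: 'a assume c: "c \<in> Basis"
      have "f c \<in> Basis" "f b \<in> Basis" using bij c that by (auto simp: bij_betw_def)
      moreover have "f c = f b \<longleftrightarrow> c = b" using bij c that by (auto simp: bij_betw_def inj_on_def)
      ultimately show "(x \<bullet> c) * (f c \<bullet> f b) = (if c = b then x \<bullet> c else 0)"
        by (simp add: inner_Basis)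
    qed simp
    finally show ?thesis using that by simp
  qed
  have [measurable]: "f \<in> borel \<rightarrow>\<^sub>M borel"
    using f by (simp add: linear_continuous_on linear_conv_bounded_linear borel_measurable_continuous_onI)
  fix l u :: 'b assume le: "\<And>b. b \<in> Basis \<Longrightarrow> l \<bullet> b \<le> u \<bullet> b"
  \<comment> \<open>The inverse of \<open>f\<close>: the bases are orthonormal, so \<open>f\<close>
    preserves inner products and the preimage of a box is the box with corners \<open>g l\<close>
    and \<open>g u\<close>.\<close>
  define g where "g y = (\<Sum>b\<in>Basis. (y \<bullet> f b) *\<^sub>R b)" for y
  have g: "g y \<bullet> b = y \<bullet> f b" if "b \<in> Basis" for y b
    using that by (simp add: g_def inner_sum_left inner_Basis if_distrib cong: if_cong)
  have B: "Basis = f ` (Basis :: 'a set)" using bij by (auto simp: bij_betw_def)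
  have "f -` box l u = box (g l) (g u)"
    by (auto simp: box_def B g inner_f)
  moreover have "g l \<bullet> b \<le> g u \<bullet> b" if "b \<in> Basis" for b
    using le[of "f b"] g that B by auto
  ultimately have "emeasure (distr lborel borel f) (box l u) = (\<Prod>b\<in>Basis. (g u - g l) \<bullet> b)"
    by (simp add: emeasure_distr)
  also have "(\<Prod>b\<in>Basis. (g u - g l) \<bullet> b) = (\<Prod>b\<in>Basis. (u - l) \<bullet> f b)"
    by (intro prod.cong) (auto simp: inner_diff_left g)
  also have "\<dots> = (\<Prod>b\<in>Basis. (u - l) \<bullet> b)"
    by (rule prod.reindex_bij_betw[OF bij])
  finally show "emeasure (distr lborel borel f) (box l u) = ennreal (\<Prod>b\<in>Basis. (u - l) \<bullet> b)" .
qed simp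

text \<open>The substitution x = exp w only reaches x > 0. For an interval that misses the positive
  axis both sides vanish; otherwise the interval is cut off at \<open>max l 0\<close>.\<close>

lemma nn_integral_exp_substitution_interval:
  "(\<integral>\<^sup>+w. ennreal (exp w) * indicator {l<..<u} (exp w) \<partial>lborel) = emeasure lborel ({0<..} \<inter> {l<..<u::real})"
proof (cases "max l 0 < u")
  case False
  then have "{0<..} \<inter> {l<..<u} = {}" by auto
  moreover have "indicator {l<..<u} (exp w) = (0::ennreal)" for w :: real
  proof -
    have "\<not> (l < exp w \<and> exp w < u)" using False exp_gt_zero[of w] by (smt (verit))
    then show ?thesis by (simp add: indicator_def)
  qed
  ultimately show ?thesis by simp
next
  case True
  have E: "{0<..} \<inter> {l<..<u} = {max l 0<..<u}" by auto
  have I: "indicat_real {max l 0<..<u} absolutely_integrable_on (exp ` UNIV) \<and>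
      integral (exp ` UNIV) (indicat_real {max l 0<..<u}) = u - max l (0::real)"
  proof -
    have 1: "(exp ` UNIV :: real set) = {0<..}"
      by (auto simp: image_iff) (metis exp_ln)
    have "(indicator {max l 0<..<u} has_integral (u - max l 0)) (exp ` UNIV :: real set)"
    proof -
      have "((\<lambda>x::real. 1::real) has_integral (u - max l 0)) {max l 0<..<u}"
        using has_integral_const_real[of "1::real" "max l 0" u] True
        by (subst has_integral_Icc_iff_Ioo[symmetric]) (auto split: if_splits)
      then have "((\<lambda>x::real. if x \<in> {max l 0<..<u} then 1 else 0::real) has_integral (u - max l 0)) (exp ` UNIV)"
        by (subst has_integral_restrict) (auto simp: 1)
      then show ?thesis by (rule has_integral_eq[rotated]) (auto simp: indicator_def)
    qed
    from integral_unique[OF this] nonnegative_absolutely_integrable_1[OF has_integral_integrable[OF this]]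
    show ?thesis by auto
  qed
  have "(\<lambda>w. \<bar>exp w\<bar> * indicator {max l 0<..<u} (exp w)) absolutely_integrable_on UNIV \<and>
           integral UNIV (\<lambda>w. \<bar>exp w\<bar> * indicator {max l 0<..<u} (exp w)) = u - max l (0::real)"
    by (subst has_absolute_integral_change_of_variables_1'[where g = exp])
       (use I in \<open>auto intro!: derivative_eq_intros simp: inj_on_def\<close>)
  then have "((\<lambda>w. exp w * indicator {max l 0<..<u} (exp w)) has_integral (u - max l (0::real))) UNIV"
    using set_lebesgue_integral_eq_integral(1) integrable_integral by fastforce
  then have "(\<integral>\<^sup>+w. ennreal (exp w * indicator {max l 0<..<u} (exp w)) \<partial>lborel) = ennreal (u - max l 0)"
    by (intro nn_integral_has_integral_lborel) auto
  moreover have "ennreal (exp w * indicator {max l 0<..<u} (exp w)) = ennreal (exp w) * indicator {l<..<u} (exp w)" for w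
    by (auto simp: indicator_def)
  ultimately show ?thesis using True by (simp add: E)
qed

text \<open>As an equality of measures, the substitution yields integrability and value together for
  every measurable integrand.\<close>

lemma distr_exp_lborel_real:
  "distr (density lborel (\<lambda>w. ennreal (exp w))) borel exp = density lborel (indicator {0::real<..})"
proof (rule measure_eqI_box)
  fix l u :: real
  have [measurable]: "exp -` {l<..<u} \<in> sets borel"
    using measurable_sets[of "exp :: real \<Rightarrow> real" borel borel "{l<..<u}"] by simp
  have "emeasure (distr (density lborel (\<lambda>w. ennreal (exp w))) borel exp) (box l u)
      = (\<integral>\<^sup>+w. ennreal (exp w) * indicator (box l u) (exp w) \<partial>lborel)"
    by (simp add: emeasure_distr emeasure_density) (auto intro!: nn_integral_cong simp: indicator_def)
  also have "\<dots> = emeasure lborel ({0<..} \<inter> {l<..<u::real})"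
    using nn_integral_exp_substitution_interval by (simp add: box_real)
  also have "\<dots> = emeasure (density lborel (indicator {0::real<..})) (box l u)"
    by (simp add: emeasure_density box_real flip: indicator_inter_arith)
  finally show *: "emeasure (distr (density lborel (\<lambda>w. ennreal (exp w))) borel exp) (box l u)
     = emeasure (density lborel (indicator {0::real<..})) (box l u)" .
  have "emeasure lborel ({0<..} \<inter> {l<..<u::real}) \<le> emeasure lborel {l<..<u}"
    by (intro emeasure_mono) auto
  also have "\<dots> < \<infinity>" using emeasure_lborel_box_finite by (simp flip: box_real)
  finally show "emeasure (distr (density lborel (\<lambda>w. ennreal (exp w))) borel exp) (box l u) \<noteq> \<infinity>"
    unfolding * by (simp add: emeasure_density box_real flip: indicator_inter_arith)
qed auto

lemma
  fixes F :: "real \<Rightarrow> complex"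
  assumes [measurable]: "F \<in> borel_measurable borel"
  shows integrable_exp_substitution:
      "integrable lborel (\<lambda>w. exp w *\<^sub>R F (exp w)) \<longleftrightarrow> set_integrable lborel {0<..} F" (is ?A)
    and integral_exp_substitution:
      "(\<integral>w. exp w *\<^sub>R F (exp w) \<partial>lborel) = (LINT x:{0<..}|lborel. F x)" (is ?B)
proof -
  have "integrable lborel (\<lambda>w. exp w *\<^sub>R F (exp w)) \<longleftrightarrow>
     integrable (density lborel (\<lambda>w. ennreal (exp w))) (\<lambda>w. F (exp w))"
    by (subst integrable_density) auto
  also have "\<dots> \<longleftrightarrow> integrable (distr (density lborel (\<lambda>w. ennreal (exp w))) borel exp) F"
    by (subst integrable_distr_eq) auto
  also have "\<dots> \<longleftrightarrow> integrable (density lborel (\<lambda>x. ennreal (indicator {0::real<..} x))) F"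
    by (simp add: distr_exp_lborel_real ennreal_indicator)
  also have "\<dots> \<longleftrightarrow> set_integrable lborel {0<..} F"
    unfolding set_integrable_def by (subst integrable_density) auto
  finally show ?A .
  have "(\<integral>w. exp w *\<^sub>R F (exp w) \<partial>lborel) = (\<integral>w. F (exp w) \<partial>density lborel (\<lambda>w. ennreal (exp w)))"
    by (subst integral_density) auto
  also have "\<dots> = integral\<^sup>L (distr (density lborel (\<lambda>w. ennreal (exp w))) borel exp) F"
    by (subst integral_distr) auto
  also have "\<dots> = integral\<^sup>L (density lborel (\<lambda>x. ennreal (indicator {0::real<..} x))) F"
    by (simp add: distr_exp_lborel_real ennreal_indicator)
  also have "\<dots> = (LINT x:{0<..}|lborel. F x)"
    unfolding set_lebesgue_integral_def by (subst integral_density) auto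
  finally show ?B .
qed

section \<open>Exponential substitution in several variables\<close>

definition vexp :: "real^'n::finite \<Rightarrow> real^'n" where
  "vexp w = (\<chi> i. exp (w $ i))"

lemma vexp_nth [simp]: "vexp w $ i = exp (w $ i)"
  by (simp add: vexp_def)

lemma vexp_measurable [measurable]: "vexp \<in> borel \<rightarrow>\<^sub>M borel"
  unfolding vexp_def by (intro borel_measurable_continuous_onI continuous_intros)

lemma nn_integral_lborel_prod_vec:
  fixes f :: "'n::finite \<Rightarrow> real \<Rightarrow> real"
  assumes [measurable]: "\<And>i. f i \<in> borel_measurable borel" and nn: "\<And>i x. 0 \<le> f i x"
  shows "(\<integral>\<^sup>+x. ennreal (\<Prod>i\<in>UNIV. f i ((x :: real^'n) $ i)) \<partial>lborel)
       = (\<Prod>i\<in>UNIV. \<integral>\<^sup>+t. ennreal (f i t) \<partial>lborel)"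
proof -
  define F :: "real^'n \<Rightarrow> real \<Rightarrow> real" where "F b = f (axis_index b)" for b
  have inj: "inj (\<lambda>i::'n. axis i (1::real))" by (auto simp: inj_def axis_eq_axis)
  have B: "(Basis :: (real^'n) set) = range (\<lambda>i. axis i 1)" by (auto simp: Basis_vec_def)
  have [simp]: "F (axis i 1) = f i" for i by (simp add: F_def axis_index_axis)
  have "(\<integral>\<^sup>+x. (\<Prod>b\<in>Basis. ennreal (F b (x \<bullet> b))) \<partial>(lborel :: (real^'n) measure))
     = (\<Prod>b\<in>Basis. \<integral>\<^sup>+t. ennreal (F b t) \<partial>lborel)"
    by (rule nn_integral_lborel_prod) (auto simp: F_def nn)
  then show ?thesis
    unfolding B by (simp add: prod.reindex[OF inj] inner_axis prod_ennreal nn)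
qed

text \<open>On boxes both measures are products over the coordinates, which reduces the claim to
  intervals.\<close>

lemma distr_vexp_lborel:
  "distr (density lborel (\<lambda>w. ennreal (\<Prod>i\<in>UNIV. exp (w $ i)))) borel vexp
     = density lborel (indicator {x::real^'n::finite. \<forall>i. 0 < x $ i})"
proof (rule measure_eqI_box)
  let ?P = "{x::real^'n. \<forall>i. 0 < x $ i}"
  have [measurable]: "?P \<in> sets borel"
    by measurable
  fix l u :: "real^'n"
  have [measurable]: "vexp -` box l u \<in> sets borel"
    using measurable_sets[of "vexp :: real^'n \<Rightarrow> _" borel borel "box l u"] by simp
  have box: "x \<in> box l u \<longleftrightarrow> (\<forall>i. x $ i \<in> {l $ i<..<u $ i})" for x
    by (auto simp: mem_box_cart)
  have "emeasure (distr (density lborel (\<lambda>w. ennreal (\<Prod>i\<in>UNIV. exp (w $ i)))) borel vexp) (box l u)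
      = (\<integral>\<^sup>+w. ennreal (\<Prod>i\<in>UNIV. exp (w $ i)) * indicator (box l u) (vexp w) \<partial>lborel)"
    by (simp add: emeasure_distr emeasure_density) (auto intro!: nn_integral_cong simp: indicator_def)
  also have "\<dots> = (\<integral>\<^sup>+w. ennreal (\<Prod>i\<in>UNIV. exp (w $ i) * indicator {l $ i<..<u $ i} (exp (w $ i))) \<partial>lborel)"
  proof (intro nn_integral_cong)
    fix w :: "real^'n"
    have "(\<Prod>i\<in>UNIV. indicat_real {l $ i<..<u $ i} (exp (w $ i))) = indicator (box l u) (vexp w)"
      by (auto simp: indicator_def box)
    then show "ennreal (\<Prod>i\<in>UNIV. exp (w $ i)) * indicator (box l u) (vexp w)
      = ennreal (\<Prod>i\<in>UNIV. exp (w $ i) * indicator {l $ i<..<u $ i} (exp (w $ i)))"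
      by (auto simp: prod.distrib indicator_def)
  qed
  also have "\<dots> = (\<Prod>i\<in>UNIV. \<integral>\<^sup>+t. ennreal (exp t * indicator {l $ i<..<u $ i} (exp t)) \<partial>lborel)"
    by (subst nn_integral_lborel_prod_vec) auto
  also have "\<dots> = (\<Prod>i\<in>UNIV. emeasure lborel ({0<..} \<inter> {l $ i<..<u $ i}))"
    unfolding nn_integral_exp_substitution_interval[symmetric]
    by (intro prod.cong nn_integral_cong refl) (auto simp: indicator_def)
  finally have 1: "emeasure (distr (density lborel (\<lambda>w. ennreal (\<Prod>i\<in>UNIV. exp (w $ i)))) borel vexp) (box l u)
      = (\<Prod>i\<in>UNIV. emeasure lborel ({0<..} \<inter> {l $ i<..<u $ i}))" .
  have "emeasure (density lborel (indicator ?P)) (box l u)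
     = (\<integral>\<^sup>+x. indicator ?P x * indicator (box l u) x \<partial>lborel)"
    by (subst emeasure_density) auto
  also have "\<dots> = (\<integral>\<^sup>+x. ennreal (\<Prod>i\<in>UNIV. indicator ({0<..} \<inter> {l $ i<..<u $ i}) (x $ i)) \<partial>lborel)"
  proof (intro nn_integral_cong)
    fix x :: "real^'n"
    have "(\<Prod>i\<in>UNIV. indicator ({0<..} \<inter> {l $ i<..<u $ i}) (x $ i) :: real)
       = of_bool (\<forall>i. x $ i \<in> {0<..} \<inter> {l $ i<..<u $ i})"
      by (auto simp: indicator_def)
    then show "indicator ?P x * indicator (box l u) x
      = ennreal (\<Prod>i\<in>UNIV. indicator ({0<..} \<inter> {l $ i<..<u $ i}) (x $ i))"
      by (auto simp: box indicator_def)
  qed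
  also have "\<dots> = (\<Prod>i\<in>UNIV. \<integral>\<^sup>+t. ennreal (indicator ({0<..} \<inter> {l $ i<..<u $ i}) t) \<partial>lborel)"
    by (subst nn_integral_lborel_prod_vec) auto
  also have "\<dots> = (\<Prod>i\<in>UNIV. emeasure lborel ({0<..} \<inter> {l $ i<..<u $ i}))"
    by (intro prod.cong refl) (simp add: ennreal_indicator)
  finally have 2: "emeasure (density lborel (indicator ?P)) (box l u)
      = (\<Prod>i\<in>UNIV. emeasure lborel ({0<..} \<inter> {l $ i<..<u $ i}))" .
  show "emeasure (distr (density lborel (\<lambda>w. ennreal (\<Prod>i\<in>UNIV. exp (w $ i)))) borel vexp) (box l u)
      = emeasure (density lborel (indicator ?P)) (box l u)"
    by (simp add: 1 2)
  have "emeasure lborel ({0<..} \<inter> {l $ i<..<u $ i}) < \<infinity>" for i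
  proof -
    have "emeasure lborel ({0<..} \<inter> {l $ i<..<u $ i}) \<le> emeasure lborel {l $ i<..<u $ i}"
      by (intro emeasure_mono) auto
    also have "\<dots> < \<infinity>" using emeasure_lborel_box_finite by (simp flip: box_real)
    finally show ?thesis .
  qed
  then show "emeasure (distr (density lborel (\<lambda>w. ennreal (\<Prod>i\<in>UNIV. exp (w $ i)))) borel vexp) (box l u) \<noteq> \<infinity>"
    by (simp add: 1 ennreal_prod_eq_top less_top)
qed auto

lemma
  fixes F :: "real^'n::finite \<Rightarrow> complex"
  assumes [measurable]: "F \<in> borel_measurable borel"
  shows integrable_vexp_substitution:
      "integrable lborel (\<lambda>w. (\<Prod>i\<in>UNIV. exp (w $ i)) *\<^sub>R F (vexp w))
        \<longleftrightarrow> set_integrable lborel {x. \<forall>i. 0 < x $ i} F" (is ?A)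
    and integral_vexp_substitution:
      "(\<integral>w. (\<Prod>i\<in>UNIV. exp (w $ i)) *\<^sub>R F (vexp w) \<partial>lborel)
        = (LINT x:{x. \<forall>i. 0 < x $ i}|lborel. F x)" (is ?B)
proof -
  let ?P = "{x::real^'n. \<forall>i. 0 < x $ i}"
  let ?d = "\<lambda>w::real^'n. \<Prod>i\<in>UNIV. exp (w $ i)"
  have [measurable]: "?P \<in> sets borel" by measurable
  have nn: "0 \<le> ?d w" for w by (simp add: prod_nonneg)
  have "integrable lborel (\<lambda>w. ?d w *\<^sub>R F (vexp w)) \<longleftrightarrow>
     integrable (density lborel (\<lambda>w. ennreal (?d w))) (\<lambda>w. F (vexp w))"
    by (subst integrable_density) (auto intro: nn)
  also have "\<dots> \<longleftrightarrow> integrable (distr (density lborel (\<lambda>w. ennreal (?d w))) borel vexp) F"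
    by (subst integrable_distr_eq) auto
  also have "\<dots> \<longleftrightarrow> integrable (density lborel (\<lambda>x. ennreal (indicator ?P x))) F"
    by (simp only: distr_vexp_lborel ennreal_indicator)
  also have "\<dots> \<longleftrightarrow> set_integrable lborel ?P F"
    unfolding set_integrable_def by (subst integrable_density) auto
  finally show ?A .
  have "(\<integral>w. ?d w *\<^sub>R F (vexp w) \<partial>lborel) = (\<integral>w. F (vexp w) \<partial>density lborel (\<lambda>w. ennreal (?d w)))"
    by (subst integral_density) (auto intro: nn)
  also have "\<dots> = integral\<^sup>L (distr (density lborel (\<lambda>w. ennreal (?d w))) borel vexp) F"
    by (subst integral_distr) auto
  also have "\<dots> = integral\<^sup>L (density lborel (\<lambda>x. ennreal (indicator ?P x))) F"
    by (simp only: distr_vexp_lborel ennreal_indicator)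
  also have "\<dots> = (LINT x:?P|lborel. F x)"
    unfolding set_lebesgue_integral_def by (subst integral_density) auto
  finally show ?B .
qed

lemma
  fixes h :: "'n::finite \<Rightarrow> real \<Rightarrow> complex"
  assumes int: "\<And>i. integrable lborel (h i)"
  shows integrable_lborel_prod_vec: "integrable lborel (\<lambda>x::real^'n. \<Prod>i\<in>UNIV. h i (x $ i))" (is ?A)
    and integral_lborel_prod_vec: "(\<integral>x. (\<Prod>i\<in>UNIV. h i (x $ i)) \<partial>(lborel :: (real^'n) measure))
          = (\<Prod>i\<in>UNIV. \<integral>t. h i t \<partial>lborel)" (is ?B)
    and integral_norm_lborel_prod_vec: "(\<integral>x. norm (\<Prod>i\<in>UNIV. h i (x $ i)) \<partial>(lborel :: (real^'n) measure))
          = (\<Prod>i\<in>UNIV. \<integral>t. norm (h i t) \<partial>lborel)" (is ?C)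
proof -
  have [measurable]: "h i \<in> borel_measurable borel" for i
    using int[of i] by simp
  define F :: "real^'n \<Rightarrow> real \<Rightarrow> complex" where "F b = h (axis_index b)" for b
  have inj: "inj (\<lambda>i::'n. axis i (1::real))" by (auto simp: inj_def axis_eq_axis)
  have B: "(Basis :: (real^'n) set) = range (\<lambda>i. axis i 1)" by (auto simp: Basis_vec_def)
  have [simp]: "F (axis i 1) = h i" for i by (simp add: F_def axis_index_axis)
  interpret product_sigma_finite "\<lambda>_::real^'n. lborel :: real measure" ..
  have nth: "(\<Sum>b\<in>Basis. f b *\<^sub>R b) $ i = f (axis i 1)" for f and i :: 'n
    unfolding B by (subst sum.reindex[OF inj]) (simp add: axis_def if_distrib cong: if_cong)
  have P: "(\<Prod>i\<in>UNIV. h i (f (axis i 1))) = (\<Prod>b\<in>Basis. F b (f b))" for f :: "real^'n \<Rightarrow> real"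
    unfolding B by (subst prod.reindex[OF inj]) simp
  have F: "integrable lborel (F b)" for b by (simp add: F_def int)
  have m1: "(\<lambda>f. \<Sum>b\<in>Basis. f b *\<^sub>R (b::real^'n)) \<in> (\<Pi>\<^sub>M b\<in>Basis. lborel) \<rightarrow>\<^sub>M borel"
    by measurable
  have m2: "(\<lambda>x::real^'n. \<Prod>i\<in>UNIV. h i (x $ i)) \<in> borel_measurable borel"
    by measurable
  have m3: "(\<lambda>x::real^'n. norm (\<Prod>i\<in>UNIV. h i (x $ i))) \<in> borel_measurable borel"
    by measurable
  show ?A
    by (subst lborel_eq, subst integrable_distr_eq[OF m1 m2], unfold nth P, rule product_integrable_prod)
       (auto intro: F)
  have "(\<integral>x. (\<Prod>i\<in>UNIV. h i (x $ i)) \<partial>(lborel :: (real^'n) measure))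
     = (\<integral>f. (\<Prod>b\<in>Basis. F b (f b)) \<partial>(\<Pi>\<^sub>M b\<in>(Basis :: (real^'n) set). lborel))"
    by (subst lborel_eq, subst integral_distr[OF m1 m2], unfold nth P, rule refl)
  also have "\<dots> = (\<Prod>b\<in>Basis. \<integral>t. F b t \<partial>lborel)"
    by (rule product_integral_prod) (auto intro: F)
  finally show ?B unfolding B by (simp add: prod.reindex[OF inj])
  have Pn: "(\<Prod>i\<in>UNIV. norm (h i (f (axis i 1)))) = (\<Prod>b\<in>Basis. norm (F b (f b)))" for f :: "real^'n \<Rightarrow> real"
    unfolding B by (subst prod.reindex[OF inj]) simp
  have "(\<integral>x. norm (\<Prod>i\<in>UNIV. h i (x $ i)) \<partial>(lborel :: (real^'n) measure))
     = (\<integral>f. (\<Prod>b\<in>Basis. norm (F b (f b))) \<partial>(\<Pi>\<^sub>M b\<in>(Basis :: (real^'n) set). lborel))"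
    by (subst lborel_eq, subst integral_distr[OF m1 m3], unfold nth prod_norm[symmetric] Pn, rule refl)
  also have "\<dots> = (\<Prod>b\<in>Basis. \<integral>t. norm (F b t) \<partial>lborel)"
    by (rule product_integral_prod) (auto intro: F)
  finally show ?C unfolding B by (simp add: prod.reindex[OF inj])
qed

text \<open>The linear change of variables of the library needs a well-ordered index type; this copy of a
  finite type provides one.\<close>

typedef (overloaded) ('a::finite) enumerated = "UNIV :: 'a set"
  by simp

instance enumerated :: (finite) finite
proof
  show "finite (UNIV :: 'a enumerated set)"
  proof (rule finite_surj[of UNIV _ Abs_enumerated])
    show "(UNIV :: 'a enumerated set) \<subseteq> range Abs_enumerated"
      by (metis Rep_enumerated_inverse rangeI subsetI)
  qed simp
qed

instantiation enumerated :: (finite) wellorder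
begin

definition less_eq_enumerated :: "'a enumerated \<Rightarrow> 'a enumerated \<Rightarrow> bool" where
  "less_eq_enumerated x y \<longleftrightarrow> to_nat_on UNIV x \<le> to_nat_on UNIV y"

definition less_enumerated :: "'a enumerated \<Rightarrow> 'a enumerated \<Rightarrow> bool" where
  "less_enumerated x y \<longleftrightarrow> to_nat_on UNIV x < to_nat_on UNIV y"

instance
proof
  have inj: "inj (to_nat_on (UNIV :: 'a enumerated set))"
    by (simp add: countable_finite inj_on_to_nat_on)
  show "x \<le> y \<Longrightarrow> y \<le> x \<Longrightarrow> x = y" for x y :: "'a enumerated"
    using inj by (auto simp: less_eq_enumerated_def dest: injD)
  show "P x" if "\<And>x. (\<And>y. y < x \<Longrightarrow> P y) \<Longrightarrow> P x" for P and x :: "'a enumerated"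
    using measure_induct_rule[of "to_nat_on UNIV" P x] that unfolding less_enumerated_def by blast
qed (auto simp: less_eq_enumerated_def less_enumerated_def)

end

lemma bij_Rep_enumerated: "bij Rep_enumerated"
  by (rule bij_betw_byWitness[of _ Abs_enumerated])
     (auto simp: Abs_enumerated_inverse Rep_enumerated_inverse)

lemma lborel_distr_linear_wellorder:
  fixes f :: "real^'m::{finite,wellorder} \<Rightarrow> real^'m::_"
  assumes f: "linear f" and det: "\<bar>det (matrix f)\<bar> = 1"
  shows "distr lborel borel f = lborel"
proof (rule lborel_eqI[symmetric])
  have [measurable]: "f \<in> borel \<rightarrow>\<^sub>M borel"
    using f by (simp add: linear_continuous_on linear_conv_bounded_linear borel_measurable_continuous_onI)
  fix l u :: "real^'m::_" assume le: "\<And>b. b \<in> Basis \<Longrightarrow> l \<bullet> b \<le> u \<bullet> b"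
  have nz: "det (matrix f) \<noteq> 0" using det by auto
  then obtain g where g: "linear g" "\<And>x. g (f x) = x" "\<And>x. f (g x) = x"
    using f det_nz_iff_inj linear_injective_isomorphism by metis
  have eq: "f -` box l u = g ` box l u"
  proof (intro equalityI subsetI)
    fix x assume "x \<in> f -` box l u"
    then have "g (f x) \<in> g ` box l u" by (intro imageI) simp
    then show "x \<in> g ` box l u" by (simp add: g(2))
  qed (auto simp: g(3))
  have "matrix f ** matrix g = mat 1"
    using g f by (simp add: matrix_compose[symmetric] o_def matrix_id_mat_1[unfolded id_def])
  then have "det (matrix f) * det (matrix g) = 1"
    by (metis det_mul det_I)
  with det have det_g: "\<bar>det (matrix g)\<bar> = 1"
    using abs_mult[of "det (matrix f)" "det (matrix g)"] by simp
  have "g ` box l u \<in> lmeasurable" "measure lebesgue (g ` box l u) = measure lebesgue (box l u)"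
    using measurable_linear_image[OF g(1), of "box l u"] measure_linear_image[OF g(1), of "box l u"] det_g
    by auto
  then have "emeasure lebesgue (g ` box l u) = emeasure lebesgue (box l u)"
    by (metis emeasure_eq_measure2 lmeasurable_box)
  moreover have "g ` box l u \<in> sets borel"
    unfolding eq[symmetric] using measurable_sets[of f borel borel "box l u"] by simp
  ultimately have "emeasure lborel (g ` box l u) = emeasure lborel (box l u)"
    by simp
  then show "emeasure (distr lborel borel f) (box l u) = ennreal (\<Prod>b\<in>Basis. (u - l) \<bullet> b)"
    using le by (simp add: emeasure_distr eq)
qed simp

lemma det_in_Ints:
  fixes M :: "'a::comm_ring_1^'m::finite^'m"
  assumes "\<And>i j. M $ i $ j \<in> \<int>"
  shows "det M \<in> \<int>"
  unfolding det_def using assms by (intro Ints_sum Ints_mult Ints_of_int Ints_prod) auto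

text \<open>Inverse integer matrices have integer determinants with product 1, so \<open>M\<close>
  has determinant 1 or -1. The determinants are taken over the well-ordered copy of the index type;
  the two relabellings of coordinates preserve the measure.\<close>

lemma lborel_distr_matrix:
  fixes M N :: "real^'m::finite^'m"
  assumes MN: "M ** N = mat 1" and M: "\<And>i j. M $ i $ j \<in> \<int>" and N: "\<And>i j. N $ i $ j \<in> \<int>"
  shows "distr lborel borel (\<lambda>w. M *v w) = lborel"
proof -
  let ?R = "Rep_enumerated :: 'm enumerated \<Rightarrow> 'm"
  define \<psi> :: "real^'m \<Rightarrow> real^'m enumerated" where "\<psi> x = (\<chi> i. x $ ?R i)" for x
  define \<phi> :: "real^'m enumerated \<Rightarrow> real^'m" where "\<phi> x = (\<chi> i. x $ Abs_enumerated i)" for x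
  have RA [simp]: "?R (Abs_enumerated i) = i" "Abs_enumerated (?R k) = k" for i k
    by (simp_all add: Abs_enumerated_inverse Rep_enumerated_inverse)
  have lin: "linear \<psi>" "linear \<phi>"
    by (auto intro!: linearI simp: \<psi>_def \<phi>_def vec_eq_iff)
  have [simp]: "\<psi> (\<phi> y) = y" "\<phi> (\<psi> x) = x" for x y
    by (simp_all add: \<psi>_def \<phi>_def vec_eq_iff)
  have ax: "\<psi> (axis i 1) = axis (Abs_enumerated i) 1" "\<phi> (axis k 1) = axis (?R k) 1" for i k
    unfolding \<psi>_def \<phi>_def vec_eq_iff by (auto simp: axis_def)
  have "bij_betw \<psi> Basis Basis"
    by (rule bij_betw_byWitness[where f' = \<phi>]) (auto simp: Basis_vec_def ax)
  moreover have "bij_betw \<phi> Basis Basis"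
    by (rule bij_betw_byWitness[where f' = \<psi>]) (auto simp: Basis_vec_def ax)
  ultimately have d: "distr lborel borel \<psi> = lborel" "distr lborel borel \<phi> = lborel"
    using lin lborel_distr_Basis_bij by blast+
  have [measurable]: "\<psi> \<in> borel \<rightarrow>\<^sub>M borel" "\<phi> \<in> borel \<rightarrow>\<^sub>M borel" "(\<lambda>w. A *v w) \<in> borel \<rightarrow>\<^sub>M borel"
    for A :: "real^'k::finite^'k"
    using lin by (auto intro!: borel_measurable_continuous_onI linear_continuous_on
       simp: linear_conv_bounded_linear[symmetric] matrix_vector_mul_linear)
  define lift :: "real^'m^'m \<Rightarrow> real^'m enumerated^'m enumerated"
    where "lift A = (\<chi> i j. A $ ?R i $ ?R j)" for A
  have lift_mult: "lift A ** lift B = lift (A ** B)" for A B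
    by (auto simp: lift_def matrix_matrix_mult_def vec_eq_iff
        intro!: sum.reindex_bij_betw[OF bij_Rep_enumerated, of "\<lambda>k. A $ _ $ k * B $ k $ _"])
  have lift_1: "lift (mat 1) = mat 1"
    by (simp add: lift_def mat_def vec_eq_iff Rep_enumerated_inject)
  have "det (lift M) * det (lift N) = 1"
    by (simp add: det_mul[symmetric] lift_mult MN lift_1)
  moreover have "det (lift M) \<in> \<int>" "det (lift N) \<in> \<int>"
    by (intro det_in_Ints; simp add: lift_def M N)+
  then obtain p q where pq: "det (lift M) = of_int p" "det (lift N) = of_int q"
    by (auto elim!: Ints_cases)
  ultimately have "p * q = 1" by (simp flip: of_int_mult)
  then have "\<bar>p\<bar> = 1" using zmult_eq_1_iff by auto
  then have det: "\<bar>det (lift M)\<bar> = 1" unfolding pq by (simp flip: of_int_abs)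
  have eq: "M *v w = \<phi> (lift M *v \<psi> w)" for w
    by (auto simp: lift_def \<phi>_def \<psi>_def matrix_vector_mult_def vec_eq_iff
        intro!: sum.reindex_bij_betw[OF bij_Rep_enumerated, of "\<lambda>j. M $ _ $ j * w $ j", symmetric])
  have "distr lborel borel (\<lambda>w. M *v w)
      = distr (distr (distr lborel borel \<psi>) borel (\<lambda>w. lift M *v w)) borel \<phi>"
    by (simp add: distr_distr o_def eq)
  also have "\<dots> = lborel"
    by (simp add: d lborel_distr_linear_wellorder matrix_vector_mul_linear matrix_of_matrix_vector_mul det)
  finally show ?thesis .
qed

section \<open>The Gamma integral in logarithmic coordinates\<close>

lemma cexp_ln_powr: "complex_of_real (exp w) powr v = exp (v * of_real w)"
  by (simp add: powr_def Ln_of_real)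

text \<open>Euler's integral after t = exp w; the factor exp w from dt raises the exponent v - 1 to
  v.\<close>

lemma
  fixes v :: complex
  assumes v: "Re v > 0"
  shows integrable_exp_Gamma: "integrable lborel (\<lambda>w::real. exp (v * w) * exp (- of_real (exp w)))" (is ?A)
    and integral_exp_Gamma: "(\<integral>w. exp (v * of_real w) * exp (- of_real (exp w)) \<partial>lborel) = Gamma v" (is ?B)
proof -
  let ?F = "\<lambda>t. complex_of_real t powr (v - 1) / of_real (exp t)"
  have m: "?F \<in> borel_measurable borel" by measurable
  have eq: "exp w *\<^sub>R ?F (exp w) = exp (v * w) * exp (- of_real (exp w))" for w :: real
    unfolding cexp_ln_powr scaleR_conv_of_real
    by (simp add: exp_minus field_simps exp_diff left_diff_distrib flip: exp_of_real)
  have "?F absolutely_integrable_on {0<..}" by (rule absolutely_integrable_Gamma_integral'[OF v])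
  then have F: "set_integrable lborel {0<..} ?F"
    unfolding set_integrable_def by (subst (asm) integrable_completion) auto
  then show ?A using integrable_exp_substitution[OF m] by (simp add: eq)
  have "(LINT x:{0<..}|lborel. ?F x) = integral {0<..} ?F"
    using F by (rule set_borel_integral_eq_integral)
  also have "\<dots> = Gamma v" using Gamma_integral_complex'[OF v] by (rule integral_unique)
  finally show ?B using integral_exp_substitution[OF m] by (simp add: eq)
qed

lemma
  fixes v :: complex and r :: real
  assumes v: "Re v > 0" and r: "r > 0"
  shows integrable_exp_Gamma_scaled: "integrable lborel (\<lambda>w::real. exp (v * w) * exp (- of_real (r * exp w)))" (is ?A)
    and integral_exp_Gamma_scaled: "(\<integral>w. exp (v * of_real w) * exp (- of_real (r * exp w)) \<partial>lborel)
       = of_real r powr (- v) * Gamma v" (is ?B)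
proof -
  let ?f = "\<lambda>w::real. exp (v * w) * exp (- of_real (exp w))"
  \<comment> \<open>The factor r is absorbed by shifting w by ln r.\<close>
  have eq: "exp (v * w) * exp (- of_real (r * exp w)) = of_real r powr (- v) * ?f (ln r + 1 * w)" for w
  proof -
    have "of_real r powr (- v) * exp (v * of_real (ln r + w)) = exp (v * w)"
      using r by (simp add: powr_def Ln_of_real algebra_simps flip: exp_add)
    moreover have "r * exp w = exp (ln r + w)" using r by (simp add: exp_add)
    ultimately show ?thesis by (simp add: mult.assoc[symmetric])
  qed
  show ?A unfolding eq
    by (intro integrable_mult_right lborel_integrable_real_affine integrable_exp_Gamma v) auto
  show ?B unfolding eq integral_mult_right_zero
    using lborel_integral_real_affine[of 1 ?f "ln r"] by (simp add: integral_exp_Gamma v)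
qed

lemma Gamma_plus_of_nat:
  fixes v :: complex assumes "Re v > 0"
  shows "Gamma (v + of_nat k) = pochhammer v k * Gamma v"
proof -
  have "v \<notin> \<int>\<^sub>\<le>\<^sub>0" using assms by (auto elim!: nonpos_Ints_cases)
  then show ?thesis using pochhammer_Gamma[of v k] by (simp add: Gamma_eq_zero_iff)
qed

text \<open>Instead of rotating the contour, exp(-z t) is expanded around exp(-r t) for a real r
  with |r - z| < r. The termwise integrals form the binomial series of (1 + (z - r)/r)^(-v), which
  converges for such r.\<close>

lemma
  fixes v z :: complex
  assumes v: "Re v > 0" and z: "Re z > 0"
  shows integrable_exp_Gamma_complex: "integrable lborel (\<lambda>w::real. exp (v * w) * exp (- z * of_real (exp w)))" (is ?A)
    and integral_exp_Gamma_complex: "(\<integral>w. exp (v * of_real w) * exp (- z * of_real (exp w)) \<partial>lborel)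
       = z powr (- v) * Gamma v" (is ?B)
proof -
  \<comment> \<open>For this r one has |r - z|^2 = r^2 - 2 r Re z + |z|^2 = r^2 - |z|^2, which is
    less than r^2.\<close>
  define r where "r = (cmod z)\<^sup>2 / Re z"
  have z0: "z \<noteq> 0" using z by auto
  have r: "r > 0" using z z0 by (simp add: r_def)
  have zr: "cmod (of_real r - z) < r"
  proof -
    have "(cmod (of_real r - z))\<^sup>2 = r\<^sup>2 - 2 * r * Re z + (cmod z)\<^sup>2"
      unfolding cmod_power2 by (simp add: power2_eq_square algebra_simps)
    also have "\<dots> = r\<^sup>2 - (cmod z)\<^sup>2" using z by (simp add: r_def)
    also have "\<dots> < r\<^sup>2" using z0 by simp
    finally show ?thesis using r by (simp add: power_less_imp_less_base)
  qed
  define f where "f k w = exp (v * of_real w) * exp (- of_real (r * exp w)) * ((of_real r - z) * of_real (exp w)) ^ k / fact k"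
    for k and w :: real
  have f_eq: "f k w = (of_real r - z) ^ k / fact k * (exp ((v + of_nat k) * of_real w) * exp (- of_real (r * exp w)))" for k w
  proof -
    have "exp ((v + of_nat k) * complex_of_real w) = exp (v * of_real w) * of_real (exp w) ^ k"
      by (simp add: distrib_right exp_add exp_of_nat_mult exp_of_real)
    then show ?thesis by (simp add: f_def power_mult_distrib)
  qed
  have vk: "Re (v + of_nat k) > 0" for k using v by simp
  have int_f: "integrable lborel (f k)" for k
    unfolding f_eq[abs_def] by (intro integrable_mult_right integrable_exp_Gamma_scaled vk r)
  have val_f: "(\<integral>w. f k w \<partial>lborel) = of_real r powr (- v) * Gamma v * (((- v) gchoose k) * ((z - of_real r) / of_real r) ^ k)" for k
  proof -
    have "(\<integral>w. f k w \<partial>lborel) = (of_real r - z) ^ k / fact k * (of_real r powr (- (v + of_nat k)) * (pochhammer v k * Gamma v))"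
      unfolding f_eq integral_mult_right_zero integral_exp_Gamma_scaled[OF vk r] Gamma_plus_of_nat[OF v] ..
    also have "of_real r powr (- (v + of_nat k)) = of_real r powr (- v) / of_real r ^ k"
      using r by (simp add: powr_diff powr_nat)
    also have "(of_real r - z) ^ k = (-1) ^ k * (z - of_real r) ^ k"
      by (simp flip: power_mult_distrib)
    finally show ?thesis by (simp add: gbinomial_pochhammer power_divide)
  qed
  define x where "x = Re v"
  have x: "x > 0" using v by (simp add: x_def)
  have norm_f: "norm (f k w) = (cmod (of_real r - z)) ^ k / fact k * Re (exp ((of_real x + of_nat k) * of_real w) * exp (- of_real (r * exp w)))" for k w
  proof -
    have "exp ((of_real x + of_nat k) * of_real w) * exp (- complex_of_real (r * exp w)) = of_real (exp ((x + real k) * w) * exp (- (r * exp w)))"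
      by (simp flip: exp_of_real)
    then show ?thesis
      unfolding f_eq by (simp add: norm_mult norm_divide norm_power x_def norm_exp)
  qed
  have xk: "Re (of_real x + of_nat k :: complex) > 0" for k using x by simp
  define q where "q = cmod (of_real r - z) / r"
  have q: "\<bar>q\<bar> < 1" using zr r by (simp add: q_def)
  \<comment> \<open>Taking norms replaces v by Re v and (z - r)/r by -q, so the series of L1 norms
    is again a binomial series, now real and inside its radius of convergence.\<close>
  have norm_val: "(\<integral>w. norm (f k w) \<partial>lborel) = r powr (- x) * Gamma x * (((- x) gchoose k) * (- q) ^ k)" for k
  proof -
    let ?g = "\<lambda>w::real. exp ((of_real x + of_nat k :: complex) * of_real w) * exp (- of_real (r * exp w))"
    have "(\<integral>w. norm (f k w) \<partial>lborel) = (cmod (of_real r - z)) ^ k / fact k * Re (\<integral>w. ?g w \<partial>lborel)"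
      unfolding norm_f integral_mult_right_zero
      by (subst integral_Re) (use integrable_exp_Gamma_scaled[OF xk r] in simp_all)
    also have "(\<integral>w. ?g w \<partial>lborel) = of_real r powr (- (of_real x + of_nat k)) * (pochhammer (of_real x) k * Gamma (of_real x))"
      unfolding integral_exp_Gamma_scaled[OF xk r] using Gamma_plus_of_nat[of "of_real x" k] x by simp
    also have "\<dots> = of_real (r powr (- x) / r ^ k * (pochhammer x k * Gamma x))"
      using r x by (simp add: powr_diff powr_nat powr_of_real[symmetric] pochhammer_of_real Gamma_complex_of_real)
    finally have "(\<integral>w. norm (f k w) \<partial>lborel) = r powr (- x) * Gamma x * (pochhammer x k / fact k * q ^ k)"
      by (simp add: q_def power_divide)
    also have "q ^ k = (-1) ^ k * (- q) ^ k" by (simp flip: power_mult_distrib)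
    finally show ?thesis by (simp add: gbinomial_pochhammer)
  qed
  have "summable (\<lambda>k. ((- x) gchoose k) * (- q) ^ k)"
    using gen_binomial_real[of "- q" "- x"] q by (auto simp: sums_iff)
  then have summ: "summable (\<lambda>k. \<integral>w. norm (f k w) \<partial>lborel)"
    unfolding norm_val by (rule summable_mult)
  have f_sums: "(\<lambda>k. f k w) sums (exp (v * w) * exp (- z * of_real (exp w)))" for w
  proof -
    let ?u = "(of_real r - z) * of_real (exp w)"
    have "(\<lambda>k. exp (v * of_real w) * exp (- of_real (r * exp w)) * (?u ^ k /\<^sub>R fact k)) sums
        (exp (v * of_real w) * exp (- of_real (r * exp w)) * exp ?u)"
      by (intro sums_mult exp_converges)
    moreover have "exp (- of_real (r * exp w)) * exp ?u = exp (- z * of_real (exp w))"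
      by (simp add: algebra_simps flip: exp_add)
    ultimately show ?thesis
      by (simp add: f_def scaleR_conv_of_real mult.assoc divide_inverse mult_ac)
  qed
  have f_norm: "summable (\<lambda>k. norm (f k w))" for w
  proof -
    let ?u = "(of_real r - z) * of_real (exp w)"
    have "norm (f k w) = norm (exp (v * of_real w) * exp (- of_real (r * exp w))) * norm (?u ^ k /\<^sub>R fact k)" for k
      by (simp add: f_def norm_mult norm_divide norm_power divide_inverse norm_inverse)
    then show ?thesis
      using summable_mult[OF summable_norm_exp[of ?u],
          of "norm (exp (v * of_real w) * exp (- of_real (r * exp w)))"]
      by (simp only:)
  qed
  have suminf_f: "(\<Sum>k. f k w) = exp (v * w) * exp (- z * of_real (exp w))" for w
    using f_sums by (simp add: sums_iff)
  show ?A using integrable_suminf[OF int_f AE_I2[OF f_norm] summ] by (simp add: suminf_f)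
  have S1: "(\<lambda>k. \<integral>w. f k w \<partial>lborel) sums (\<integral>w. exp (v * w) * exp (- z * of_real (exp w)) \<partial>lborel)"
    using sums_integral[OF int_f AE_I2[OF f_norm] summ] by (simp add: suminf_f)
  have S2: "(\<lambda>k. \<integral>w. f k w \<partial>lborel) sums
     (of_real r powr (- v) * Gamma v * (1 + (z - of_real r) / of_real r) powr (- v))"
    unfolding val_f using zr r
    by (intro sums_mult gen_binomial_complex) (simp add: norm_divide norm_minus_commute)
  have P: "of_real r powr (- v) * (1 + (z - of_real r) / of_real r) powr (- v) = z powr (- v)"
  proof -
    have "1 + (z - of_real r) / of_real r = z / of_real r" using r by (simp add: field_simps)
    then show ?thesis using r z0
      by (simp add: powr_def Ln_of_real Ln_divide_of_real algebra_simps flip: exp_add)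
  qed
  show ?B
    using sums_unique2[OF S1 S2] by (simp only: P[symmetric] mult_ac)
qed

section \<open>Taylor remainders of exp(-w) and their Gamma integrals\<close>

definition exp_tail :: "nat \<Rightarrow> complex \<Rightarrow> complex" where
  "exp_tail m w = exp (- w) - (\<Sum>i<m. (- w) ^ i / fact i)"

lemma exp_tail_0: "exp_tail 0 w = exp (- w)"
  by (simp add: exp_tail_def)

lemma continuous_exp_tail [continuous_intros]:
  "continuous_on S f \<Longrightarrow> continuous_on S (\<lambda>x. exp_tail m (f x))"
  unfolding exp_tail_def by (intro continuous_intros) auto

lemma measurable_exp_tail [measurable]: "exp_tail m \<in> borel_measurable borel"
  by (intro borel_measurable_continuous_onI continuous_intros)

lemma exp_tail_Suc_at_0 [simp]: "exp_tail (Suc m) 0 = 0"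
  unfolding exp_tail_def sum.lessThan_Suc_shift by simp

lemma DERIV_exp_tail_Suc:
  "(exp_tail (Suc m) has_field_derivative - exp_tail m w) (at w)"
proof -
  have "((\<lambda>w. exp (- w) - (\<Sum>i<Suc m. (- w) ^ i / fact i)) has_field_derivative
     (exp (- w) * - 1 - (\<Sum>i<Suc m. of_nat i * ((- w) ^ (i - 1) * - 1) / fact i))) (at w)"
    by (auto intro!: derivative_eq_intros)
  moreover have "(\<Sum>i<Suc m. of_nat i * ((- w) ^ (i - 1) * - 1) / fact i) = - (\<Sum>i<m. (- w) ^ i / fact i)"
    unfolding sum.lessThan_Suc_shift sum_negf[symmetric]
    by (auto intro!: sum.cong simp: field_simps simp del: of_nat_Suc)
  ultimately show ?thesis by (simp add: exp_tail_def[abs_def])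
qed

lemma exp_tail_has_sum: "((\<lambda>i. (- w) ^ i / fact i) has_sum exp_tail m w) {m..}"
proof -
  have "(\<lambda>i. (- w) ^ i / fact i) sums exp (- w)"
    using exp_converges[of "- w"] by (simp add: scaleR_conv_of_real divide_inverse mult.commute)
  moreover have "summable (\<lambda>i. norm ((- w) ^ i / fact i))"
    using summable_norm_exp[of "- w"] by (simp add: norm_mult norm_inverse norm_power divide_inverse mult.commute)
  ultimately have "((\<lambda>i. (- w) ^ i / fact i) has_sum exp (- w)) UNIV"
    by (simp add: norm_summable_imp_has_sum)
  from has_sum_Diff[OF this has_sum_finite[of "{..<m}"]]
  show ?thesis by (simp add: exp_tail_def Compl_eq_Diff_UNIV[symmetric])
qed

lemma
  fixes v :: complex
  assumes v: "Re v < 0"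
  shows set_integrable_exp_Ioi: "set_integrable lborel {t<..} (\<lambda>w::real. exp (v * w))"
    and integral_exp_Ioi: "(LINT w:{t<..}|lborel. exp (v * of_real w)) = - exp (v * of_real t) / v"
    and integral_norm_exp_Ioi: "(LINT w:{t<..}|lborel. norm (exp (v * of_real w))) = exp (Re v * t) / - Re v"
proof -
  have *: "((\<lambda>w. exp (- (- Re v) * w)) has_integral exp (- (- Re v) * t) / (- Re v)) {t..}"
    using v by (intro has_integral_exp_minus_to_infinity) auto
  have h: "((\<lambda>w. exp (Re v * w)) has_integral exp (Re v * t) / (- Re v)) {t<..}"
  proof -
    have "{t..} - {t<..} = {t}" by auto
    then show ?thesis
      using has_integral_interior[of "{t..}" "\<lambda>w. exp (Re v * w)"] * by (simp add: frontier_def)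
  qed
  then have abs: "(\<lambda>w. exp (Re v * w)) absolutely_integrable_on {t<..}"
    by (intro nonnegative_absolutely_integrable_1) (auto intro: has_integral_integrable)
  then have i: "set_integrable lborel {t<..} (\<lambda>w. exp (Re v * w))"
    unfolding set_integrable_def by (subst (asm) integrable_completion) auto
  then show s: "set_integrable lborel {t<..} (\<lambda>w::real. exp (v * w))"
    by (rule set_integrable_bound) (auto simp: set_borel_measurable_def)
  have "(LINT w:{t<..}|lborel. exp (Re v * w)) = exp (Re v * t) / - Re v"
    using set_borel_integral_eq_integral(2)[OF i] h by (simp add: integral_unique)
  then show "(LINT w:{t<..}|lborel. norm (exp (v * of_real w))) = exp (Re v * t) / - Re v"
    by simp
  have v0: "v \<noteq> 0" using v by auto
  have "(LBINT w=ereal t..\<infinity>. exp (v * complex_of_real w)) = 0 - exp (v * of_real t) / v"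
  proof (rule interval_integral_FTC_integrable[where F = "\<lambda>w. exp (v * of_real w) / v"])
    show "((\<lambda>w. exp (v * of_real w) / v) has_vector_derivative exp (v * complex_of_real w)) (at w)" for w
      using v0 by (auto intro!: derivative_eq_intros has_vector_derivative_real_field)
    show "set_integrable lborel (einterval (ereal t) \<infinity>) (\<lambda>w. exp (v * complex_of_real w))"
      using s by simp
    show "(((\<lambda>w. exp (v * of_real w) / v) \<circ> real_of_ereal) \<longlongrightarrow> exp (v * of_real t) / v) (at_right (ereal t))"
      unfolding ereal_tendsto_simps by (intro tendsto_intros filterlim_ident) (use v0 in auto)
    have e: "((\<lambda>w. exp (Re v * w)) \<longlongrightarrow> 0) at_top"
      using v by real_asymp
    have "((\<lambda>w. exp (Re v * w) / norm v) \<longlongrightarrow> 0) at_top"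
      using tendsto_divide[OF e tendsto_const[of "norm v"]] v0 by simp
    then show "(((\<lambda>w. exp (v * of_real w) / v) \<circ> real_of_ereal) \<longlongrightarrow> 0) (at_left \<infinity>)"
      unfolding ereal_tendsto_simps
      by (subst tendsto_norm_zero_iff[symmetric]) (simp add: norm_divide)
  qed auto
  then show "(LINT w:{t<..}|lborel. exp (v * of_real w)) = - exp (v * of_real t) / v"
    by (simp add: interval_lebesgue_integral_def)
qed

text \<open>The Cauchy--Saalschuetz formula: removing the first Taylor terms of the exponential
  continues the Gamma integral to the strips left of the imaginary axis. The step from
  \<open>m\<close> to \<open>m + 1\<close> writes a tail as the integral of the previous one and swaps the integrals.\<close>

lemma exp_tail_eq_integral:
  fixes z :: complex
  assumes z: "z \<noteq> 0"
    and int: "set_integrable lborel {..<w} (\<lambda>t. exp_tail m (z * of_real (exp t)) * of_real (exp t))"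
  shows "(LINT t:{..<w}|lborel. exp_tail m (z * of_real (exp t)) * of_real (exp t))
     = - exp_tail (Suc m) (z * of_real (exp w)) / z"
proof -
  let ?F = "\<lambda>t. - exp_tail (Suc m) (z * complex_of_real (exp t)) / z"
  have cont: "isCont ?F t" for t
  proof -
    have "continuous_on UNIV ?F" using z by (intro continuous_intros) auto
    then show ?thesis by (simp add: continuous_on_eq_continuous_at)
  qed
  have "(LBINT t=-\<infinity>..ereal w. exp_tail m (z * of_real (exp t)) * of_real (exp t)) = ?F w - 0"
  proof (rule interval_integral_FTC_integrable[where F = ?F])
    fix t :: real
    have "((\<lambda>t. z * complex_of_real (exp t)) has_vector_derivative z * of_real (exp t)) (at t)"
      using has_vector_derivative_mult_right[OF has_vector_derivative_of_real[OF DERIV_exp], of z t] by simp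
    from field_vector_diff_chain_at[OF this DERIV_exp_tail_Suc[of m]]
    have "((\<lambda>t. exp_tail (Suc m) (z * complex_of_real (exp t))) has_vector_derivative
       z * of_real (exp t) * - exp_tail m (z * complex_of_real (exp t))) (at t)"
      by (simp add: o_def)
    from has_vector_derivative_mult_left[OF this, of "- 1 / z"] z
    show "(?F has_vector_derivative exp_tail m (z * of_real (exp t)) * of_real (exp t)) (at t)"
      by (simp add: mult_ac)
    have "continuous_on UNIV (\<lambda>t. exp_tail m (z * of_real (exp t)) * complex_of_real (exp t))"
      by (intro continuous_intros)
    then show "isCont (\<lambda>t. exp_tail m (z * of_real (exp t)) * complex_of_real (exp t)) t"
      by (simp add: continuous_on_eq_continuous_at)
  next
    show "set_integrable lborel (einterval (-\<infinity>) (ereal w)) (\<lambda>t. exp_tail m (z * of_real (exp t)) * of_real (exp t))"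
      using int by simp
    \<comment> \<open>The boundary term at minus infinity vanishes because a tail of positive order
      is zero at 0.\<close>
    have "((\<lambda>t. complex_of_real (exp t)) \<longlongrightarrow> of_real 0) at_bot"
      by (intro tendsto_of_real exp_at_bot)
    moreover have "isCont (\<lambda>u. - exp_tail (Suc m) (z * u) / z) (of_real 0)"
    proof -
      have "continuous_on UNIV (\<lambda>u. - exp_tail (Suc m) (z * u) / z)"
        using z by (intro continuous_intros) auto
      then show ?thesis unfolding continuous_on_eq_continuous_at[OF open_UNIV] by blast
    qed
    ultimately have "(?F \<longlongrightarrow> - exp_tail (Suc m) (z * of_real 0) / z) at_bot"
      by (rule isCont_tendsto_compose[rotated])
    then show "((?F \<circ> real_of_ereal) \<longlongrightarrow> 0) (at_right (-\<infinity>))"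
      unfolding ereal_tendsto_simps by simp
    have "(?F \<longlongrightarrow> ?F w) (at_left w)"
      using cont[of w] unfolding isCont_def by (rule tendsto_mono[OF at_le, rotated]) simp
    then show "((?F \<circ> real_of_ereal) \<longlongrightarrow> ?F w) (at_left (ereal w))"
      unfolding ereal_tendsto_simps .
  qed auto
  then show ?thesis by (simp add: interval_lebesgue_integral_def)
qed

text \<open>For m = 0 this is the plain Gamma integral, hence no upper bound on Re v in that case.
  The L1 bound is what later permits summing over lambda under the integral; each step from m to m +
  1 multiplies it by |z| / Re z, where |z| comes from the primitive of the tail and 1 / Re z from
  adjusting the power of Re z.\<close>

theorem Cauchy_Saalschuetz:
  fixes v z :: complex
  assumes z: "Re z > 0" and v: "Re v + m > 0" and m: "m = 0 \<or> Re v + m < 1"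
  shows "integrable lborel (\<lambda>w. exp (v * of_real w) * exp_tail m (z * of_real (exp w)))"
    and "(\<integral>w. exp (v * of_real w) * exp_tail m (z * of_real (exp w)) \<partial>lborel) = z powr (- v) * Gamma v"
    and "(\<integral>w. norm (exp (v * of_real w) * exp_tail m (z * of_real (exp w))) \<partial>lborel)
           \<le> (norm z / Re z) ^ m * (Re z powr (- Re v) * \<bar>Gamma (Re v)\<bar>)"
  using v m
proof (induction m arbitrary: v)
  case 0
  {
    case 1 then show ?case
      using integrable_exp_Gamma_complex[of v z] z by (simp add: exp_tail_0)
  next
    case 2 then show ?case
      using integral_exp_Gamma_complex[of v z] z by (simp add: exp_tail_0)
  next
    case 3
    have "(\<integral>w. norm (exp (v * of_real w) * exp_tail 0 (z * of_real (exp w))) \<partial>lborel)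
       = (\<integral>w. Re (exp (of_real (Re v) * of_real w) * exp (- of_real (Re z * exp w))) \<partial>lborel)"
      by (intro Bochner_Integration.integral_cong) (auto simp: exp_tail_0 norm_mult exp_of_real simp flip: of_real_mult of_real_minus)
    also have "\<dots> = Re (\<integral>w. exp (of_real (Re v) * of_real w) * exp (- of_real (Re z * exp w)) \<partial>lborel)"
      using 3 z integrable_exp_Gamma_scaled[of "of_real (Re v)" "Re z"] by (intro integral_Re) auto
    also have "\<dots> = Re (of_real (Re z) powr (- of_real (Re v)) * Gamma (of_real (Re v)))"
      using 3 z by (subst integral_exp_Gamma_scaled) auto
    also have "\<dots> = Re z powr (- Re v) * Gamma (Re v)"
      using z by (simp add: powr_of_real Gamma_complex_of_real flip: of_real_minus)
    finally show ?case using 3 by (simp add: Gamma_real_pos)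
  }
next
  case (Suc m)
  have key: "integrable lborel (\<lambda>w. exp (v * of_real w) * exp_tail (Suc m) (z * of_real (exp w))) \<and>
    (\<integral>w. exp (v * of_real w) * exp_tail (Suc m) (z * of_real (exp w)) \<partial>lborel) = z powr (- v) * Gamma v \<and>
    (\<integral>w. norm (exp (v * of_real w) * exp_tail (Suc m) (z * of_real (exp w))) \<partial>lborel)
           \<le> (norm z / Re z) ^ Suc m * (Re z powr (- Re v) * \<bar>Gamma (Re v)\<bar>)"
    if prems: "Re v + real (Suc m) > 0" "Re v + real (Suc m) < 1" for v
  proof -
    have z0: "z \<noteq> 0" using z by auto
    have v0: "Re v < 0" "v \<noteq> 0" using prems by auto
    \<comment> \<open>The open strip contains no integral real part, so the recurrence of Gamma
      applies both at v and at Re v.\<close>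
    have notint: "Re v \<noteq> of_int n" for n :: int
    proof
      assume "Re v = of_int n"
      with prems have "0 < n + int m + 1" "n + int m + 1 < 1" by linarith+
      then show False by simp
    qed
    have nonpole: "v \<notin> \<int>\<^sub>\<le>\<^sub>0" "Re v \<notin> \<int>\<^sub>\<le>\<^sub>0"
      using notint by (metis complex_Re_of_int nonpos_Ints_cases)+
    define E where "E t = exp_tail m (z * complex_of_real (exp t))" for t
    have [measurable]: "E \<in> borel_measurable borel" by (simp add: E_def[abs_def])
    have IH: "integrable lborel (\<lambda>t. exp ((v + 1) * of_real t) * E t)"
       "(\<integral>t. exp ((v + 1) * of_real t) * E t \<partial>lborel) = z powr (- (v + 1)) * Gamma (v + 1)"
       "(\<integral>t. norm (exp ((v + 1) * of_real t) * E t) \<partial>lborel)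
           \<le> (norm z / Re z) ^ m * (Re z powr (- Re (v + 1)) * \<bar>Gamma (Re (v + 1))\<bar>)"
      using Suc[of "v + 1"] prems unfolding E_def by auto
    \<comment> \<open>The kernel on t < w. Integrating out w returns the integrand of order m at v +
      1; integrating out t produces the tail of order m + 1 at v.\<close>
    define H where "H t w = indicator {t<..} w *\<^sub>R (exp (v * of_real w) * (E t * of_real (exp t)))" for t w :: real
    have H_meas: "(\<lambda>(t, w). H t w) \<in> borel_measurable (lborel \<Otimes>\<^sub>M lborel)"
    proof -
      have "(\<lambda>(t, w). H t w) = (\<lambda>(t, w). if t < w then exp (v * of_real w) * (E t * of_real (exp t)) else 0)"
        by (auto simp: H_def fun_eq_iff)
      also have "\<dots> \<in> borel_measurable (lborel \<Otimes>\<^sub>M lborel)" by measurable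
      finally show ?thesis .
    qed
    have Hw: "integrable lborel (\<lambda>w. H t w)"
      "(\<integral>w. H t w \<partial>lborel) = exp ((v + 1) * of_real t) * E t * (- 1 / v)"
      "(\<integral>w. norm (H t w) \<partial>lborel) = norm (exp ((v + 1) * of_real t) * E t) * (1 / - Re v)" for t
    proof -
      have eq: "H t w = (E t * of_real (exp t)) * (indicator {t<..} w *\<^sub>R exp (v * of_real w))" for w
        by (simp add: H_def mult_ac scaleR_conv_of_real)
      show "integrable lborel (\<lambda>w. H t w)"
        unfolding eq using set_integrable_exp_Ioi[OF v0(1), of t] unfolding set_integrable_def
        by (rule integrable_mult_right)
      have e: "exp ((v + 1) * complex_of_real t) = exp (v * of_real t) * of_real (exp t)"
        by (simp add: distrib_right exp_add exp_of_real)
      show "(\<integral>w. H t w \<partial>lborel) = exp ((v + 1) * of_real t) * E t * (- 1 / v)"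
        unfolding eq integral_mult_right_zero e
        using integral_exp_Ioi[OF v0(1), of t] unfolding set_lebesgue_integral_def by simp
      have eqn: "norm (H t w) = norm (E t * of_real (exp t)) * (indicator {t<..} w *\<^sub>R norm (exp (v * of_real w)))" for w
        unfolding eq by (simp add: norm_mult)
      show "(\<integral>w. norm (H t w) \<partial>lborel) = norm (exp ((v + 1) * of_real t) * E t) * (1 / - Re v)"
        unfolding eqn integral_mult_right_zero e
        using integral_norm_exp_Ioi[OF v0(1), of t] unfolding set_lebesgue_integral_def by (simp add: norm_mult)
    qed
    have H_int: "integrable (lborel \<Otimes>\<^sub>M lborel) (\<lambda>(t, w). H t w)"
    proof (rule lborel_pair.Fubini_integrable[OF H_meas])
      show "integrable lborel (\<lambda>t. \<integral>w. norm (case (t, w) of (t, w) \<Rightarrow> H t w) \<partial>lborel)"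
        by (simp only: prod.case Hw) (intro integrable_mult_left integrable_norm IH)
      show "AE t in lborel. integrable lborel (\<lambda>w. case (t, w) of (t, w) \<Rightarrow> H t w)"
        by (simp add: Hw)
    qed
    \<comment> \<open>The integrability required by \<open>exp_tail_eq_integral\<close> is read off
      Fubini's theorem and is therefore available only almost everywhere.\<close>
    have AE_w: "AE w in lborel. (\<integral>t. H t w \<partial>lborel) = exp (v * of_real w) * exp_tail (Suc m) (z * of_real (exp w)) * (- 1 / z)"
      using lborel_pair.AE_integrable_snd[OF H_int]
    proof eventually_elim
      case (elim w)
      have eq: "H t w = exp (v * of_real w) * (indicator {..<w} t *\<^sub>R (E t * of_real (exp t)))" for t
        by (auto simp: H_def indicator_def)
      from elim have "integrable lborel (\<lambda>t. indicator {..<w} t *\<^sub>R (E t * of_real (exp t)))"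
        unfolding eq using integrable_mult_right[of "inverse (exp (v * of_real w))"]
        by (force simp: mult.assoc[symmetric] simp del: mult_scaleR_right)
      then have "set_integrable lborel {..<w} (\<lambda>t. E t * of_real (exp t))"
        unfolding set_integrable_def .
      from exp_tail_eq_integral[OF z0 this[unfolded E_def]]
      show ?case
        unfolding eq integral_mult_right_zero set_lebesgue_integral_def E_def by simp
    qed
    define T where "T w = exp (v * of_real w) * exp_tail (Suc m) (z * of_real (exp w))" for w
    have [measurable]: "T \<in> borel_measurable borel" by (simp add: T_def[abs_def])
    have "integrable lborel (\<lambda>w. \<integral>t. H t w \<partial>lborel)" by (rule lborel_pair.integrable_snd[OF H_int])
    then have "integrable lborel (\<lambda>w. T w * (- 1 / z))"
      by (rule integrable_cong_AE_imp) (use AE_w in \<open>auto simp: T_def\<close>)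
    then have "integrable lborel (\<lambda>w. T w * (- 1 / z) * - z)"
      by (rule integrable_mult_left)
    then have T_int: "integrable lborel T" using z0 by simp
    have "(\<integral>w. T w * (- 1 / z) \<partial>lborel) = (\<integral>w. (\<integral>t. H t w \<partial>lborel) \<partial>lborel)"
      by (rule integral_cong_AE) (use AE_w H_meas in \<open>auto simp: T_def\<close>)
    also have "\<dots> = (\<integral>t. (\<integral>w. H t w \<partial>lborel) \<partial>lborel)"
      by (rule lborel_pair.Fubini_integral[OF H_int])
    also have "\<dots> = z powr (- (v + 1)) * Gamma (v + 1) * (- 1 / v)"
      unfolding Hw integral_mult_left_zero IH ..
    finally have "(\<integral>w. T w \<partial>lborel) = z * (z powr (- (v + 1)) * (Gamma (v + 1) / v))"
      using z0 v0 by (simp add: field_simps)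
    also have "Gamma (v + 1) / v = Gamma v"
      using v0 Gamma_plus1[OF nonpole(1)] by simp
    also have "z * (z powr (- (v + 1)) * Gamma v) = z powr (- v) * Gamma v"
      using z0 powr_add[of z "- (v + 1)" 1] by (simp add: mult_ac)
    finally have T_val: "(\<integral>w. T w \<partial>lborel) = z powr (- v) * Gamma v" .
    have "(\<integral>w. norm (T w) \<partial>lborel) = norm z * (\<integral>w. norm (T w * (- 1 / z)) \<partial>lborel)"
      using z0 by (simp add: norm_mult norm_divide)
    also have "(\<integral>w. norm (T w * (- 1 / z)) \<partial>lborel) \<le> (\<integral>w. (\<integral>t. norm (H t w) \<partial>lborel) \<partial>lborel)"
    proof (rule integral_mono_AE)
      show "integrable lborel (\<lambda>w. norm (T w * (- 1 / z)))" by (intro integrable_norm integrable_mult_left T_int)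
      have "integrable (lborel \<Otimes>\<^sub>M lborel) (\<lambda>(t, w). norm (H t w))"
        using integrable_norm[OF H_int] by (simp add: case_prod_unfold)
      from lborel_pair.integrable_snd[OF this]
      show "integrable lborel (\<lambda>w. \<integral>t. norm (H t w) \<partial>lborel)" .
      show "AE w in lborel. norm (T w * (- 1 / z)) \<le> (\<integral>t. norm (H t w) \<partial>lborel)"
        using AE_w
      proof eventually_elim
        case (elim w)
        show ?case unfolding T_def elim[symmetric] by (rule integral_norm_bound)
      qed
    qed
    also have "(\<integral>w. (\<integral>t. norm (H t w) \<partial>lborel) \<partial>lborel) = (\<integral>t. (\<integral>w. norm (H t w) \<partial>lborel) \<partial>lborel)"
      using integrable_norm[OF H_int] by (intro lborel_pair.Fubini_integral) (simp add: case_prod_unfold)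
    also have "\<dots> = (\<integral>t. norm (exp ((v + 1) * of_real t) * E t) \<partial>lborel) * (1 / - Re v)"
      unfolding Hw integral_mult_left_zero ..
    also have "norm z * \<dots> \<le> norm z * (((norm z / Re z) ^ m * (Re z powr (- Re (v + 1)) * \<bar>Gamma (Re (v + 1))\<bar>)) * (1 / - Re v))"
      using v0 by (intro mult_left_mono mult_right_mono IH) auto
    also have "\<dots> = (norm z / Re z) ^ Suc m * (Re z powr (- Re v) * \<bar>Gamma (Re v)\<bar>)"
    proof -
      have "\<bar>Gamma (Re v + 1)\<bar> = - Re v * \<bar>Gamma (Re v)\<bar>"
        using v0 Gamma_plus1[OF nonpole(2)] by (simp add: abs_mult)
      moreover have "Re z powr (- Re v) = Re z powr (- Re (v + 1)) * Re z"
        using z powr_add[of "Re z" "- Re (v + 1)" 1] by simp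
      ultimately show ?thesis using v0 z by (simp add: field_simps)
    qed
    finally show ?thesis using T_int T_val unfolding T_def by (simp add: mult_left_mono)
  qed
  {
    case 1 show ?case by (rule key[THEN conjunct1]) (use 1 in auto)
  next
    case 2 show ?case by (rule key[THEN conjunct2, THEN conjunct1]) (use 2 in auto)
  next
    case 3 show ?case by (rule key[THEN conjunct2, THEN conjunct2]) (use 3 in auto)
  }
qed

section \<open>Unimodular simplices\<close>

definition unimodular_simplex :: "('j::finite \<Rightarrow> nat^'n::finite) \<Rightarrow> 'j set \<Rightarrow> bool" where
  "unimodular_simplex a \<sigma> \<longleftrightarrow> card \<sigma> = CARD('n) + 1 \<and> \<bar>det (Asub a \<sigma>)\<bar> = 1"

text \<open>The entry of the inverse of A_sigma in row j and column r, read off from the image of a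
  unit vector. Unimodularity makes it an integer, so the floor loses nothing; rows j outside sigma
  are zero.\<close>

definition icoef :: "('j \<Rightarrow> nat^'n::finite) \<Rightarrow> 'j set \<Rightarrow> 'j \<Rightarrow> 'n option \<Rightarrow> int" where
  "icoef a \<sigma> j r = \<lfloor>Re (Ainv a \<sigma> (axis r 1) j)\<rfloor>"

lemma col_enum_bij:
  fixes a :: "'j::finite \<Rightarrow> nat^'n::finite"
  assumes "unimodular_simplex a \<sigma>"
  shows "bij_betw (col_enum \<sigma> :: 'n option \<Rightarrow> 'j) UNIV \<sigma>"
proof -
  have "card (UNIV :: 'n option set) = card \<sigma>"
    using assms by (simp add: unimodular_simplex_def UNIV_option_conv card_image)
  then have "\<exists>g :: 'n option \<Rightarrow> 'j. bij_betw g UNIV \<sigma>"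
    by (intro finite_same_card_bij) auto
  then show ?thesis unfolding col_enum_def by (rule someI_ex)
qed

lemma det_of_int:
  fixes M :: "int^'m::finite^'m"
  shows "det (\<chi> r c. (of_int (M $ r $ c) :: 'a::comm_ring_1)) = of_int (det M)"
  by (simp add: det_def)

lemma
  assumes "invertible A"
  shows matrix_inv_right: "A ** matrix_inv A = mat 1"
    and matrix_inv_left: "matrix_inv A ** A = mat 1"
proof -
  have "A ** matrix_inv A = mat 1 \<and> matrix_inv A ** A = mat 1"
    using assms unfolding invertible_def matrix_inv_def by (rule someI_ex)
  then show "A ** matrix_inv A = mat 1" "matrix_inv A ** A = mat 1" by auto
qed

text \<open>By Cramer's rule every entry is the quotient of a determinant with integer entries by
  det B, which is 1 or -1.\<close>

lemma Ints_matrix_inv: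
  fixes B :: "complex^'m::finite^'m"
  assumes ints: "\<And>r c. B $ r $ c \<in> \<int>" and det: "det B = 1 \<or> det B = - 1"
  shows "matrix_inv B $ k $ r \<in> \<int>"
proof -
  have nz: "det B \<noteq> 0" using det by auto
  then have inv: "invertible B" by (simp add: invertible_det_nz)
  let ?b = "axis r 1 :: complex^'m"
  have "B *v (matrix_inv B *v ?b) = ?b"
    using inv by (simp add: matrix_vector_mul_assoc matrix_inv_right)
  then have "matrix_inv B *v ?b = (\<chi> k. det (\<chi> i j. if j = k then ?b $ i else B $ i $ j) / det B)"
    using cramer[OF nz] by blast
  moreover have "(matrix_inv B *v ?b) $ k = matrix_inv B $ k $ r"
    by (simp add: matrix_vector_mult_def axis_def if_distrib cong: if_cong)
  ultimately have "matrix_inv B $ k $ r = det (\<chi> i j. if j = k then ?b $ i else B $ i $ j) / det B"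
    by simp
  moreover have "det (\<chi> i j. if j = k then ?b $ i else B $ i $ j) \<in> \<int>"
    by (intro det_in_Ints) (auto simp: ints axis_def)
  ultimately show ?thesis using det by auto
qed

text \<open>From here on the matrix inverse enters only through these integer coefficients, which
  form a two-sided inverse of the columns of sigma.\<close>

lemma
  fixes a :: "'j::finite \<Rightarrow> nat^'n::finite"
  assumes \<sigma>: "unimodular_simplex a \<sigma>"
  shows Ainv_eq_icoef: "Ainv a \<sigma> v j = (\<Sum>r\<in>UNIV. of_int (icoef a \<sigma> j r) * v $ r)"
    and icoef_Acol: "j \<in> \<sigma> \<Longrightarrow> k \<in> \<sigma> \<Longrightarrow> (\<Sum>r\<in>UNIV. icoef a \<sigma> j r * Acol a k $ r) = (if j = k then 1 else 0)"
    and Acol_icoef: "(\<Sum>j\<in>\<sigma>. Acol a j $ r * icoef a \<sigma> j s) = (if r = s then 1 else 0)"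
proof -
  let ?e = "col_enum \<sigma> :: 'n option \<Rightarrow> 'j"
  note bij = col_enum_bij[OF \<sigma>]
  define B where "B = (\<chi> r c. (of_int (Asub a \<sigma> $ r $ c) :: complex))"
  have "det B = of_int (det (Asub a \<sigma>))" by (simp add: B_def det_of_int)
  moreover have "det (Asub a \<sigma>) = 1 \<or> det (Asub a \<sigma>) = -1"
    using \<sigma> unfolding unimodular_simplex_def by linarith
  ultimately have det: "det B = 1 \<or> det B = -1" by auto
  have ints: "matrix_inv B $ k $ r \<in> \<int>" for k r
    by (rule Ints_matrix_inv[OF _ det]) (simp add: B_def)
  have "det B \<noteq> 0" using det by auto
  then have inv: "invertible B" by (simp add: invertible_det_nz)
  have inv_e: "inv_into UNIV ?e (?e c) = c" for c
    using bij by (simp add: bij_betw_def)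
  have AB: "Ainv a \<sigma> v (?e c) = (matrix_inv B *v v) $ c" for v c
    using bij inv_e by (auto simp: Ainv_def B_def bij_betw_def)
  have ic: "of_int (icoef a \<sigma> (?e c) r) = matrix_inv B $ c $ r" for c r
  proof -
    have "Ainv a \<sigma> (axis r 1) (?e c) = matrix_inv B $ c $ r"
      unfolding AB by (simp add: matrix_vector_mult_def axis_def if_distrib cong: if_cong)
    moreover obtain m where "matrix_inv B $ c $ r = of_int m"
      using ints[of c r] by (auto elim: Ints_cases)
    ultimately show ?thesis by (simp add: icoef_def)
  qed
  have in_e: "\<exists>c. j = ?e c" if "j \<in> \<sigma>" for j
    using bij that by (auto simp: bij_betw_def)
  show "Ainv a \<sigma> v j = (\<Sum>r\<in>UNIV. of_int (icoef a \<sigma> j r) * v $ r)"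
  proof (cases "j \<in> \<sigma>")
    case True
    then obtain c where "j = ?e c" using in_e by auto
    then show ?thesis by (simp add: AB ic matrix_vector_mult_def)
  next
    case False
    then show ?thesis by (simp add: Ainv_def icoef_def)
  qed
  have BA: "B $ r $ c = of_int (Acol a (?e c) $ r)" for r c
    by (simp add: B_def Asub_def)
  show "(\<Sum>r\<in>UNIV. icoef a \<sigma> j r * Acol a k $ r) = (if j = k then 1 else 0)" if jk: "j \<in> \<sigma>" "k \<in> \<sigma>"
  proof -
    obtain c d where cd: "j = ?e c" "k = ?e d" using in_e jk by metis
    have "(matrix_inv B ** B) $ c $ d = (mat 1 :: complex^_^_) $ c $ d"
      using inv by (simp add: matrix_inv_left)
    then have "(\<Sum>r\<in>UNIV. of_int (icoef a \<sigma> j r) * of_int (Acol a k $ r)) = (if c = d then 1 else 0 :: complex)"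
      by (simp add: matrix_matrix_mult_def mat_def cd ic BA)
    moreover have "c = d \<longleftrightarrow> j = k" using cd inv_e by metis
    ultimately have "(of_int (\<Sum>r\<in>UNIV. icoef a \<sigma> j r * Acol a k $ r) :: complex) = of_int (if j = k then 1 else 0)"
      by simp
    then show ?thesis by (simp only: of_int_eq_iff)
  qed
  have "(B ** matrix_inv B) $ r $ s = (mat 1 :: complex^_^_) $ r $ s"
    using inv by (simp add: matrix_inv_right)
  then have "(\<Sum>c\<in>UNIV. of_int (Acol a (?e c) $ r) * of_int (icoef a \<sigma> (?e c) s)) = (if r = s then 1 else 0 :: complex)"
    by (simp add: matrix_matrix_mult_def mat_def ic BA)
  then have "(of_int (\<Sum>c\<in>UNIV. Acol a (?e c) $ r * icoef a \<sigma> (?e c) s) :: complex) = of_int (if r = s then 1 else 0)"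
    by simp
  then have "(\<Sum>c\<in>UNIV. Acol a (?e c) $ r * icoef a \<sigma> (?e c) s) = (if r = s then 1 else 0)"
    by (simp only: of_int_eq_iff)
  then show "(\<Sum>j\<in>\<sigma>. Acol a j $ r * icoef a \<sigma> j s) = (if r = s then 1 else 0)"
    using sum.reindex_bij_betw[OF bij, of "\<lambda>j. Acol a j $ r * icoef a \<sigma> j s"] by simp
qed

definition dotA :: "('j \<Rightarrow> nat^'n::finite) \<Rightarrow> 'j \<Rightarrow> real^('n option) \<Rightarrow> real" where
  "dotA a j w = (\<Sum>r\<in>UNIV. of_int (Acol a j $ r) * w $ r)"

lemma measurable_dotA [measurable]: "dotA a j \<in> borel_measurable borel"
  unfolding dotA_def[abs_def] by measurable

text \<open>The forms \<open>dotA a j\<close> for j in sigma are the coordinates of a substitution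
  whose matrix and inverse are integral. It preserves Lebesgue measure, and in these coordinates the
  integrand is a product of functions of one variable.\<close>

lemma
  fixes a :: "'j::finite \<Rightarrow> nat^'n::finite" and h :: "'j \<Rightarrow> real \<Rightarrow> complex"
  assumes \<sigma>: "unimodular_simplex a \<sigma>" and int: "\<And>j. j \<in> \<sigma> \<Longrightarrow> integrable lborel (h j)"
  shows integrable_prod_dotA: "integrable lborel (\<lambda>w. \<Prod>j\<in>\<sigma>. h j (dotA a j w))"
    and integral_prod_dotA: "(\<integral>w. (\<Prod>j\<in>\<sigma>. h j (dotA a j w)) \<partial>lborel) = (\<Prod>j\<in>\<sigma>. \<integral>t. h j t \<partial>lborel)"
    and integral_norm_prod_dotA: "(\<integral>w. norm (\<Prod>j\<in>\<sigma>. h j (dotA a j w)) \<partial>lborel) = (\<Prod>j\<in>\<sigma>. \<integral>t. norm (h j t) \<partial>lborel)"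
proof -
  let ?e = "col_enum \<sigma> :: 'n option \<Rightarrow> 'j"
  note bij = col_enum_bij[OF \<sigma>]
  have e: "?e c \<in> \<sigma>" for c using bij by (auto simp: bij_betw_def)
  define M :: "real^('n option)^('n option)" where "M = (\<chi> c r. of_int (Acol a (?e c) $ r))"
  define N :: "real^('n option)^('n option)" where "N = (\<chi> r c. of_int (icoef a \<sigma> (?e c) r))"
  have "N ** M = mat 1"
  proof -
    have "(\<Sum>c\<in>UNIV. icoef a \<sigma> (?e c) r * Acol a (?e c) $ s) = (if r = s then 1 else 0)" for r s
      using Acol_icoef[OF \<sigma>, of s r] sum.reindex_bij_betw[OF bij, of "\<lambda>j. Acol a j $ s * icoef a \<sigma> j r"]
      by (simp add: mult.commute eq_commute)
    then have "real_of_int (\<Sum>c\<in>UNIV. icoef a \<sigma> (?e c) r * Acol a (?e c) $ s) = of_int (if r = s then 1 else 0)" for r s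
      by simp
    then show ?thesis by (simp add: N_def M_def matrix_matrix_mult_def mat_def vec_eq_iff)
  qed
  then have MN: "M ** N = mat 1" by (simp add: matrix_left_right_inverse)
  have distr: "distr lborel borel (\<lambda>w. M *v w) = lborel"
    by (rule lborel_distr_matrix[OF MN]) (auto simp: M_def N_def)
  have [measurable]: "(\<lambda>w. M *v w) \<in> borel \<rightarrow>\<^sub>M borel"
    by (intro borel_measurable_continuous_onI linear_continuous_on)
       (simp add: linear_conv_bounded_linear[symmetric] matrix_vector_mul_linear)
  define g where "g c = h (?e c)" for c
  have g: "integrable lborel (g c)" for c by (simp add: g_def int e)
  have [measurable]: "g c \<in> borel_measurable borel" for c using g[of c] by simp
  have Mw: "(M *v w) $ c = dotA a (?e c) w" for w c
    by (simp add: M_def matrix_vector_mult_def dotA_def)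
  have prod: "(\<Prod>j\<in>\<sigma>. F j) = (\<Prod>c\<in>UNIV. F (?e c))" for F :: "'j \<Rightarrow> 'x::comm_monoid_mult"
    using prod.reindex_bij_betw[OF bij, of F] by simp
  have eq: "(\<Prod>j\<in>\<sigma>. h j (dotA a j w)) = (\<Prod>c\<in>UNIV. g c ((M *v w) $ c))" for w
    by (simp add: prod g_def Mw)
  note P = integrable_lborel_prod_vec[of g, OF g] integral_lborel_prod_vec[of g, OF g] integral_norm_lborel_prod_vec[of g, OF g]
  have m: "(\<lambda>x::real^('n option). \<Prod>c\<in>UNIV. g c (x $ c)) \<in> borel_measurable borel" by measurable
  have m': "(\<lambda>x::real^('n option). norm (\<Prod>c\<in>UNIV. g c (x $ c))) \<in> borel_measurable borel" by measurable
  have "integrable (distr lborel borel (\<lambda>w. M *v w)) (\<lambda>x. \<Prod>c\<in>UNIV. g c (x $ c))"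
    unfolding distr by (rule P)
  then show "integrable lborel (\<lambda>w. \<Prod>j\<in>\<sigma>. h j (dotA a j w))"
    unfolding eq by (subst (asm) integrable_distr_eq[OF _ m]) auto
  have "(\<integral>w. (\<Prod>j\<in>\<sigma>. h j (dotA a j w)) \<partial>lborel) = (\<integral>x. (\<Prod>c\<in>UNIV. g c (x $ c)) \<partial>distr lborel borel (\<lambda>w. M *v w))"
    unfolding eq by (subst integral_distr[OF _ m]) auto
  also have "\<dots> = (\<Prod>c\<in>UNIV. \<integral>t. g c t \<partial>lborel)" unfolding distr by (rule P)
  finally show "(\<integral>w. (\<Prod>j\<in>\<sigma>. h j (dotA a j w)) \<partial>lborel) = (\<Prod>j\<in>\<sigma>. \<integral>t. h j t \<partial>lborel)"
    by (simp add: prod g_def)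
  have "(\<integral>w. norm (\<Prod>j\<in>\<sigma>. h j (dotA a j w)) \<partial>lborel) = (\<integral>x. norm (\<Prod>c\<in>UNIV. g c (x $ c)) \<partial>distr lborel borel (\<lambda>w. M *v w))"
    unfolding eq by (subst integral_distr[OF _ m']) auto
  also have "\<dots> = (\<Prod>c\<in>UNIV. \<integral>t. norm (g c t) \<partial>lborel)" unfolding distr by (rule P)
  finally show "(\<integral>w. norm (\<Prod>j\<in>\<sigma>. h j (dotA a j w)) \<partial>lborel) = (\<Prod>j\<in>\<sigma>. \<integral>t. norm (h j t) \<partial>lborel)"
    by (simp add: prod g_def)
qed

section \<open>Multi-indexed exponential series\<close>

lemma summable_on_nat_prod:
  fixes f :: "'j::finite \<Rightarrow> nat \<Rightarrow> complex"
  assumes f: "\<And>j. (\<lambda>i. norm (f j i)) summable_on UNIV"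
  shows "(\<lambda>l. norm (\<Prod>j\<in>UNIV. f j (l j))) summable_on UNIV"
    and "infsum (\<lambda>l. \<Prod>j\<in>UNIV. f j (l j)) UNIV = (\<Prod>j\<in>UNIV. infsum (f j) UNIV)"
proof -
  have "Infinite_Set_Sum.abs_summable_on (\<lambda>l. \<Prod>j\<in>UNIV. f j (l j)) (PiE UNIV (\<lambda>_. UNIV))"
    using f by (intro abs_summable_on_prod_PiE) (auto simp: abs_summable_equivalent[symmetric])
  then show "(\<lambda>l. norm (\<Prod>j\<in>UNIV. f j (l j))) summable_on UNIV"
    by (simp add: abs_summable_equivalent[symmetric])
  show "infsum (\<lambda>l. \<Prod>j\<in>UNIV. f j (l j)) UNIV = (\<Prod>j\<in>UNIV. infsum (f j) UNIV)"
    using infsum_prod_PiE_abs[of UNIV f "\<lambda>_. UNIV"] f by simp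
qed

lemma exp_has_sum_norm:
  fixes w :: complex
  shows "(\<lambda>i. norm (w ^ i / fact i)) summable_on UNIV"
  using summable_norm_exp[of w]
  by (intro norm_summable_imp_summable_on)
     (simp add: norm_mult norm_inverse norm_divide norm_power divide_inverse mult.commute)

lemma exp_sum_multi_has_sum:
  fixes u :: "'j::finite \<Rightarrow> complex"
  shows "(\<lambda>l. norm (\<Prod>j\<in>UNIV. (- u j) ^ l j / fact (l j))) summable_on UNIV"
    and "infsum (\<lambda>l. \<Prod>j\<in>UNIV. (- u j) ^ l j / fact (l j)) UNIV = exp (- (\<Sum>j\<in>UNIV. u j))"
proof -
  show "(\<lambda>l. norm (\<Prod>j\<in>UNIV. (- u j) ^ l j / fact (l j))) summable_on UNIV"
    by (rule summable_on_nat_prod(1)) (rule exp_has_sum_norm)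
  have "infsum (\<lambda>i. (- u j) ^ i / fact i) UNIV = exp (- u j)" for j
    using exp_tail_has_sum[of "u j" 0] by (simp add: exp_tail_0 infsumI)
  then show "infsum (\<lambda>l. \<Prod>j\<in>UNIV. (- u j) ^ l j / fact (l j)) UNIV = exp (- (\<Sum>j\<in>UNIV. u j))"
    by (subst summable_on_nat_prod(2)) (auto simp: exp_has_sum_norm exp_sum sum_negf[symmetric])
qed

text \<open>In C the thresholds for the sigma-components depend only on the components outside
  sigma; setting the sigma-components to 0 makes this explicit. Hence C fibres over
  \<open>lambdas \<sigma>\<close>, each fibre is a product of half-lines, and each half-line sums to
  a tail of the exponential.\<close>

lemma exp_multi_class_sum:
  fixes u :: "'j::finite \<Rightarrow> complex" and \<sigma> :: "'j set" and m :: "('j \<Rightarrow> nat) \<Rightarrow> 'j \<Rightarrow> nat"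
  defines "C \<equiv> {l. \<forall>j\<in>\<sigma>. m (\<lambda>k. if k \<in> \<sigma> then 0 else l k) j \<le> l j}"
  shows "(\<lambda>l'. norm ((\<Prod>k\<in>-\<sigma>. (- u k) ^ l' k / fact (l' k)) * (\<Prod>j\<in>\<sigma>. exp_tail (m l' j) (u j)))) summable_on lambdas \<sigma>"
    and "infsum (\<lambda>l. \<Prod>j\<in>UNIV. (- u j) ^ l j / fact (l j)) C
      = infsum (\<lambda>l'. (\<Prod>k\<in>-\<sigma>. (- u k) ^ l' k / fact (l' k)) * (\<Prod>j\<in>\<sigma>. exp_tail (m l' j) (u j))) (lambdas \<sigma>)"
proof -
  let ?t = "\<lambda>l. \<Prod>j\<in>UNIV. (- u j) ^ l j / fact (l j)"
  let ?S = "Sigma (lambdas \<sigma>) (\<lambda>l'. PiE \<sigma> (\<lambda>j. {m l' j..}))"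
  define \<Phi> where "\<Phi> = (\<lambda>(l', g). (\<lambda>j. if j \<in> \<sigma> then g j else l' j :: nat))"
  have bij: "bij_betw \<Phi> ?S C"
  proof (rule bij_betw_byWitness[where f' = "\<lambda>l. (\<lambda>k. if k \<in> \<sigma> then 0 else l k, restrict l \<sigma>)"])
    show "\<forall>x\<in>?S. (\<lambda>l. (\<lambda>k. if k \<in> \<sigma> then 0 else l k, restrict l \<sigma>)) (\<Phi> x) = x"
      by (auto simp: \<Phi>_def lambdas_def fun_eq_iff PiE_def extensional_def)
    show "\<forall>l\<in>C. \<Phi> (\<lambda>k. if k \<in> \<sigma> then 0 else l k, restrict l \<sigma>) = l"
      by (auto simp: \<Phi>_def fun_eq_iff)
    show "\<Phi> ` ?S \<subseteq> C"
    proof safe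
      fix l' g assume *: "l' \<in> lambdas \<sigma>" "g \<in> (\<Pi>\<^sub>E j\<in>\<sigma>. {m l' j..})"
      then have "(\<lambda>k. if k \<in> \<sigma> then 0 else \<Phi> (l', g) k) = l'"
        by (auto simp: \<Phi>_def lambdas_def)
      then show "\<Phi> (l', g) \<in> C" using * by (auto simp: C_def) (auto simp: \<Phi>_def PiE_def Pi_def)
    qed
    show "(\<lambda>l. (\<lambda>k. if k \<in> \<sigma> then 0 else l k, restrict l \<sigma>)) ` C \<subseteq> ?S"
      by (auto simp: C_def lambdas_def)
  qed
  have t_\<Phi>: "?t (\<Phi> (l', g)) = (\<Prod>k\<in>-\<sigma>. (- u k) ^ l' k / fact (l' k)) * (\<Prod>j\<in>\<sigma>. (- u j) ^ g j / fact (g j))" for l' g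
  proof -
    have "?t (\<Phi> (l', g)) = (\<Prod>j\<in>-\<sigma>. (- u j) ^ \<Phi> (l', g) j / fact (\<Phi> (l', g) j)) * (\<Prod>j\<in>\<sigma>. (- u j) ^ \<Phi> (l', g) j / fact (\<Phi> (l', g) j))"
      by (subst prod.union_disjoint[symmetric]) auto
    then show ?thesis by (simp add: \<Phi>_def)
  qed
  have "(\<lambda>l. norm (?t l)) summable_on C"
    using exp_sum_multi_has_sum(1)[of u] by (rule summable_on_subset_banach) simp
  then have S_abs: "(\<lambda>p. norm (?t (\<Phi> p))) summable_on ?S"
    using summable_on_reindex_bij_betw[OF bij, of "\<lambda>l. norm (?t l)"] by simp
  have inner: "infsum (\<lambda>g. ?t (\<Phi> (l', g))) (PiE \<sigma> (\<lambda>j. {m l' j..}))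
     = (\<Prod>k\<in>-\<sigma>. (- u k) ^ l' k / fact (l' k)) * (\<Prod>j\<in>\<sigma>. exp_tail (m l' j) (u j))" for l'
  proof -
    have "infsum (\<lambda>g. \<Prod>j\<in>\<sigma>. (- u j) ^ g j / fact (g j)) (PiE \<sigma> (\<lambda>j. {m l' j..}))
       = (\<Prod>j\<in>\<sigma>. infsum (\<lambda>i. (- u j) ^ i / fact i) {m l' j..})"
      by (rule infsum_prod_PiE_abs) (auto intro: summable_on_subset_banach[OF exp_has_sum_norm])
    also have "\<dots> = (\<Prod>j\<in>\<sigma>. exp_tail (m l' j) (u j))"
      by (intro prod.cong refl infsumI exp_tail_has_sum)
    finally show ?thesis unfolding t_\<Phi> by (simp add: infsum_cmult_right')
  qed
  have S_sum: "(\<lambda>p. ?t (\<Phi> p)) summable_on ?S" by (rule abs_summable_summable[OF S_abs])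
  have "infsum ?t C = infsum (\<lambda>p. ?t (\<Phi> p)) ?S"
    by (rule infsum_reindex_bij_betw[OF bij, symmetric])
  also have "\<dots> = infsum (\<lambda>l'. infsum (\<lambda>g. ?t (\<Phi> (l', g))) (PiE \<sigma> (\<lambda>j. {m l' j..}))) (lambdas \<sigma>)"
    using infsum_Sigma'_banach[of "\<lambda>l' g. ?t (\<Phi> (l', g))" "lambdas \<sigma>" "\<lambda>l'. PiE \<sigma> (\<lambda>j. {m l' j..})"] S_sum
    by (simp add: case_prod_unfold)
  finally show "infsum ?t C
      = infsum (\<lambda>l'. (\<Prod>k\<in>-\<sigma>. (- u k) ^ l' k / fact (l' k)) * (\<Prod>j\<in>\<sigma>. exp_tail (m l' j) (u j))) (lambdas \<sigma>)"
    by (simp add: inner)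
  have "(\<lambda>l'. infsum (\<lambda>g. norm (?t (\<Phi> (l', g)))) (PiE \<sigma> (\<lambda>j. {m l' j..}))) summable_on lambdas \<sigma>"
    by (rule summable_on_Sigma_banach) (use S_abs in \<open>simp add: case_prod_unfold\<close>)
  then show "(\<lambda>l'. norm ((\<Prod>k\<in>-\<sigma>. (- u k) ^ l' k / fact (l' k)) * (\<Prod>j\<in>\<sigma>. exp_tail (m l' j) (u j)))) summable_on lambdas \<sigma>"
  proof (rule summable_on_comparison_test)
    fix l' assume l': "l' \<in> lambdas \<sigma>"
    have "(\<lambda>g. norm (?t (\<Phi> (l', g)))) summable_on (PiE \<sigma> (\<lambda>j. {m l' j..}))"
      using S_abs l' unfolding Infinite_Sum.abs_summable_on_Sigma_iff by auto
    from norm_infsum_bound[OF this]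
    show "norm ((\<Prod>k\<in>-\<sigma>. (- u k) ^ l' k / fact (l' k)) * (\<Prod>j\<in>\<sigma>. exp_tail (m l' j) (u j)))
       \<le> infsum (\<lambda>g. norm (?t (\<Phi> (l', g)))) (PiE \<sigma> (\<lambda>j. {m l' j..}))"
      by (simp add: inner)
  qed simp
qed

text \<open>Fubini's theorem for the product with counting measure; countability of A provides
  sigma-finiteness and joint measurability.\<close>

lemma integral_infsum:
  fixes f :: "'i \<Rightarrow> 'a::euclidean_space \<Rightarrow> complex"
  assumes A: "countable A" and int: "\<And>i. i \<in> A \<Longrightarrow> integrable lborel (f i)"
    and sum: "(\<lambda>i. \<integral>x. norm (f i x) \<partial>lborel) summable_on A"
    and pt: "\<And>x. (\<lambda>i. norm (f i x)) summable_on A"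
  shows "integrable lborel (\<lambda>x. infsum (\<lambda>i. f i x) A)"
    and "(\<integral>x. infsum (\<lambda>i. f i x) A \<partial>lborel) = infsum (\<lambda>i. \<integral>x. f i x \<partial>lborel) A"
proof -
  interpret C: sigma_finite_measure "count_space A"
    using A by (rule sigma_finite_measure_count_space_countable)
  interpret P: pair_sigma_finite "count_space A" "lborel :: 'a measure" ..
  have meas: "case_prod f \<in> borel_measurable (count_space A \<Otimes>\<^sub>M lborel)"
    using int by (intro measurable_pair_measure_countable1 A) auto
  have i1: "integrable (count_space A) (\<lambda>i. \<integral>x. norm (f i x) \<partial>lborel)"
  proof -
    have "(\<lambda>i. norm (\<integral>x. norm (f i x) \<partial>lborel)) summable_on A"
      using sum by (simp add: abs_of_nonneg[OF Bochner_Integration.integral_nonneg])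
    then show ?thesis
      by (simp only: abs_summable_equivalent abs_summable_on_def)
  qed
  have I: "integrable (count_space A \<Otimes>\<^sub>M lborel) (case_prod f)"
    by (rule P.Fubini_integrable[OF meas]) (use i1 int in \<open>auto simp: AE_count_space\<close>)
  have eq: "(\<integral>i. f i x \<partial>count_space A) = infsum (\<lambda>i. f i x) A" for x
    using infsetsum_infsum[of "\<lambda>i. f i x" A] pt[of x] by (simp add: infsetsum_def abs_summable_equivalent)
  show "integrable lborel (\<lambda>x. infsum (\<lambda>i. f i x) A)"
    using P.integrable_snd[OF I] by (simp add: eq)
  have "(\<lambda>i. norm (\<integral>x. f i x \<partial>lborel)) summable_on A"
    by (rule summable_on_comparison_test[OF sum]) (auto intro: integral_norm_bound)
  then have eq2: "(\<integral>i. (\<integral>x. f i x \<partial>lborel) \<partial>count_space A) = infsum (\<lambda>i. \<integral>x. f i x \<partial>lborel) A"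
    using infsetsum_infsum[of "\<lambda>i. \<integral>x. f i x \<partial>lborel" A] by (simp add: infsetsum_def abs_summable_equivalent)
  show "(\<integral>x. infsum (\<lambda>i. f i x) A \<partial>lborel) = infsum (\<lambda>i. \<integral>x. f i x \<partial>lborel) A"
    using P.Fubini_integral[OF I] by (simp add: eq eq2)
qed

section \<open>The cone partition\<close>

text \<open>In the notation of the statement, \<open>mu a \<sigma> j k\<close> is the entry \<open>(\<A>\<^sub>\<sigma>\<^sup>-\<^sup>1 \<A>\<^sub>k)\<^sub>j\<close>, and \<open>mm a \<sigma> \<lambda> j\<close> is the
  \<open>j\<close>-th component of the shift of the Gamma arguments by \<open>\<lambda>\<close>.\<close>

definition mu :: "('j::finite \<Rightarrow> nat^'n::finite) \<Rightarrow> 'j set \<Rightarrow> 'j \<Rightarrow> 'j \<Rightarrow> int" where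
  "mu a \<sigma> j k = (\<Sum>r\<in>UNIV. icoef a \<sigma> j r * Acol a k $ r)"

definition mm :: "('j::finite \<Rightarrow> nat^'n::finite) \<Rightarrow> 'j set \<Rightarrow> ('j \<Rightarrow> nat) \<Rightarrow> 'j \<Rightarrow> int" where
  "mm a \<sigma> l j = (\<Sum>k\<in>-\<sigma>. int (l k) * mu a \<sigma> j k)"

lemma Ainv_Abar_mult:
  fixes a :: "'j::finite \<Rightarrow> nat^'n::finite"
  assumes \<sigma>: "unimodular_simplex a \<sigma>"
  shows "Ainv a \<sigma> (Abar_mult a \<sigma> l) j = of_int (mm a \<sigma> l j)"
  unfolding Ainv_eq_icoef[OF \<sigma>] Abar_mult_def mm_def mu_def
  by (simp add: sum_distrib_left mult_ac) (rule sum.swap)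

text \<open>The columns of A_sigma and the rows of its inverse are dual bases, and this is the
  resulting expansion of the pairing of x and y. Unit vectors or columns of A in place of x or y
  give the expansions below.\<close>

lemma sum_dotA:
  fixes a :: "'j::finite \<Rightarrow> nat^'n::finite" and y :: "'n option \<Rightarrow> 'b::comm_ring_1"
  assumes \<sigma>: "unimodular_simplex a \<sigma>"
  shows "(\<Sum>j\<in>\<sigma>. (\<Sum>r\<in>UNIV. of_int (icoef a \<sigma> j r) * x r) * (\<Sum>r\<in>UNIV. of_int (Acol a j $ r) * y r))
     = (\<Sum>r\<in>UNIV. x r * y r)"
proof -
  have "(\<Sum>j\<in>\<sigma>. (\<Sum>s\<in>UNIV. of_int (icoef a \<sigma> j s) * x s) * (\<Sum>r\<in>UNIV. of_int (Acol a j $ r) * y r))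
     = (\<Sum>j\<in>\<sigma>. \<Sum>s\<in>UNIV. \<Sum>r\<in>UNIV. of_int (Acol a j $ r * icoef a \<sigma> j s) * (x s * y r))"
    by (simp add: sum_product mult_ac)
  also have "\<dots> = (\<Sum>s\<in>UNIV. \<Sum>r\<in>UNIV. of_int (\<Sum>j\<in>\<sigma>. Acol a j $ r * icoef a \<sigma> j s) * (x s * y r))"
    by (subst sum.swap, intro sum.cong refl, subst sum.swap) (simp add: sum_distrib_right)
  also have "\<dots> = (\<Sum>s\<in>UNIV. x s * y s)"
    by (simp add: Acol_icoef[OF \<sigma>] if_distrib if_distribR cong: if_cong)
  finally show ?thesis .
qed

lemma dotA_eq_sum_mu:
  fixes a :: "'j::finite \<Rightarrow> nat^'n::finite"
  assumes \<sigma>: "unimodular_simplex a \<sigma>"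
  shows "dotA a k w = (\<Sum>j\<in>\<sigma>. of_int (mu a \<sigma> j k) * dotA a j w)"
  using sum_dotA[OF \<sigma>, of "\<lambda>r. of_int (Acol a k $ r)" "\<lambda>r. w $ r"]
  by (simp add: dotA_def mu_def)

lemma mu_in:
  fixes a :: "'j::finite \<Rightarrow> nat^'n::finite"
  assumes "unimodular_simplex a \<sigma>" "j \<in> \<sigma>" "k \<in> \<sigma>"
  shows "mu a \<sigma> j k = (if j = k then 1 else 0)"
  using icoef_Acol[OF assms] by (simp add: mu_def)

lemma Acol_eq_sum_mu:
  fixes a :: "'j::finite \<Rightarrow> nat^'n::finite"
  assumes \<sigma>: "unimodular_simplex a \<sigma>"
  shows "Acol a k $ r = (\<Sum>j\<in>\<sigma>. mu a \<sigma> j k * Acol a j $ r)"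
  using sum_dotA[OF \<sigma>, of "\<lambda>r. Acol a k $ r" "\<lambda>s. if s = r then 1 else 0"]
  by (simp add: mu_def if_distrib cong: if_cong)

text \<open>The first row of A consists of ones; this is its component of
  \<open>Acol_eq_sum_mu\<close>.\<close>

lemma sum_mu:
  fixes a :: "'j::finite \<Rightarrow> nat^'n::finite"
  assumes \<sigma>: "unimodular_simplex a \<sigma>"
  shows "(\<Sum>j\<in>\<sigma>. mu a \<sigma> j k) = 1"
  using Acol_eq_sum_mu[OF \<sigma>, of k None] by (simp add: Acol_def)

text \<open>Homogeneity of the shifts: their total is |lambda|. It decides the sign of each term and
  balances the Gamma factors against lambda! in the convergence estimate.\<close>

lemma sum_mm:
  fixes a :: "'j::finite \<Rightarrow> nat^'n::finite"
  assumes \<sigma>: "unimodular_simplex a \<sigma>"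
  shows "(\<Sum>j\<in>\<sigma>. mm a \<sigma> l j) = (\<Sum>k\<in>-\<sigma>. int (l k))"
  unfolding mm_def by (subst sum.swap) (simp add: sum_distrib_left[symmetric] sum_mu[OF \<sigma>])

text \<open>The coordinate of x along column j in the basis given by sigma; x is interior to the
  cone over sigma when all of them are positive.\<close>

definition Lr :: "('j \<Rightarrow> nat^'n::finite) \<Rightarrow> 'j set \<Rightarrow> 'j \<Rightarrow> real^('n option) \<Rightarrow> real" where
  "Lr a \<sigma> j x = (\<Sum>r\<in>UNIV. of_int (icoef a \<sigma> j r) * x $ r)"

definition conecomb :: "('j::finite \<Rightarrow> nat^'n::finite) \<Rightarrow> ('j \<Rightarrow> real) \<Rightarrow> real^('n option)" where
  "conecomb a c = (\<chi> r. \<Sum>j\<in>UNIV. c j * of_int (Acol a j $ r))"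

lemma Lr_conecomb: "Lr a \<sigma> i (conecomb a c) = (\<Sum>j\<in>UNIV. c j * of_int (mu a \<sigma> i j))"
  unfolding Lr_def conecomb_def mu_def
  by (simp add: sum_distrib_left mult_ac) (rule sum.swap)

lemma Lr_repr:
  fixes a :: "'j::finite \<Rightarrow> nat^'n::finite"
  assumes \<sigma>: "unimodular_simplex a \<sigma>"
  shows "x $ r = (\<Sum>j\<in>\<sigma>. Lr a \<sigma> j x * of_int (Acol a j $ r))"
  using sum_dotA[OF \<sigma>, of "\<lambda>r. x $ r" "\<lambda>s. if s = r then 1 else 0"]
  by (simp add: Lr_def if_distrib cong: if_cong)

lemma triangulation_simplex:
  assumes "regular_unimodular_triangulation a T" "\<sigma> \<in> T"
  shows "unimodular_simplex a \<sigma>"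
  using assms by (simp add: regular_unimodular_triangulation_def unimodular_simplex_def)

lemma inj_pt:
  assumes "inj a" shows "inj (pt a)"
proof (rule injI)
  fix x y assume "pt a x = pt a y"
  then have "a x = a y" by (simp add: pt_def vec_eq_iff)
  then show "x = y" using assms by (simp add: inj_eq)
qed

lemma hull_image_coeffs:
  fixes \<sigma> :: "'j::finite set"
  assumes "inj a" and "p \<in> convex hull (pt a ` \<sigma>)"
  obtains u where "\<And>j. 0 \<le> u j" "\<And>j. j \<notin> \<sigma> \<Longrightarrow> u j = 0" "sum u \<sigma> = 1" "p = (\<Sum>j\<in>\<sigma>. u j *\<^sub>R pt a j)"
proof -
  have inj: "inj_on (pt a) \<sigma>" using inj_pt[OF assms(1)] by (rule inj_on_subset) simp
  obtain v where v: "\<forall>x\<in>pt a ` \<sigma>. 0 \<le> v x" "sum v (pt a ` \<sigma>) = 1" "(\<Sum>x\<in>pt a ` \<sigma>. v x *\<^sub>R x) = p"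
    using assms(2) by (auto simp: convex_hull_finite)
  show ?thesis
    by (rule that[of "\<lambda>j. if j \<in> \<sigma> then v (pt a j) else 0"])
       (use v in \<open>auto simp: sum.reindex[OF inj] o_def intro: sum.cong\<close>)
qed

text \<open>Covering yields nonnegative coordinates with respect to some sigma, and
  \<open>gen\<close> makes them positive. For uniqueness, compare the omega-heights of two
  expansions of the same x.\<close>

lemma cone_partition:
  fixes a :: "'j::finite \<Rightarrow> nat^'n::finite"
  assumes inj: "inj a" and T: "regular_unimodular_triangulation a T"
    and c: "\<And>j. 0 \<le> c j" and x: "x = conecomb a c" and pos: "x $ None > 0"
    and gen: "\<And>\<sigma> j. \<sigma> \<in> T \<Longrightarrow> j \<in> \<sigma> \<Longrightarrow> Lr a \<sigma> j x \<noteq> 0"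
  shows "\<exists>!\<sigma>. \<sigma> \<in> T \<and> (\<forall>j\<in>\<sigma>. Lr a \<sigma> j x > 0)"
proof -
  note us = triangulation_simplex[OF T]
  define s where "s = x $ None"
  have s: "s = (\<Sum>j\<in>UNIV. c j)" by (simp add: s_def x conecomb_def Acol_def)
  have s0: "s > 0" using pos by (simp add: s_def)
  \<comment> \<open>The point of the Newton polytope on the ray through x, obtained by scaling the
    first coordinate to 1.\<close>
  define p where "p = (\<Sum>j\<in>UNIV. (c j / s) *\<^sub>R pt a j)"
  have p_nth: "s * p $ i = x $ Some i" for i
    using s0 by (simp add: p_def x conecomb_def Acol_def pt_def sum_distrib_left)
  have "p \<in> convex hull (range (pt a))"
    unfolding p_def
  proof (rule convex_sum)
    show "(\<Sum>j\<in>UNIV. c j / s) = 1" using s s0 by (simp add: sum_divide_distrib[symmetric])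
  qed (use c s0 in \<open>auto simp: hull_inc\<close>)
  moreover have "\<Union> ((\<lambda>\<sigma>. convex hull (pt a ` \<sigma>)) ` T) = convex hull (range (pt a))"
    using T unfolding regular_unimodular_triangulation_def by (elim conjE)
  ultimately obtain \<sigma> where \<sigma>: "\<sigma> \<in> T" "p \<in> convex hull (pt a ` \<sigma>)"
    by blast
  obtain u where u: "\<And>j. 0 \<le> u j" "\<And>j. j \<notin> \<sigma> \<Longrightarrow> u j = 0" "sum u \<sigma> = 1" "p = (\<Sum>j\<in>\<sigma>. u j *\<^sub>R pt a j)"
    using hull_image_coeffs[OF inj \<sigma>(2)] by metis
  have su: "sum u UNIV = 1"
    using u(2,3) by (metis (no_types, lifting) Compl_iff ComplD DiffD2 finite subset_UNIV sum.mono_neutral_right)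
  have pu: "p = (\<Sum>j\<in>UNIV. u j *\<^sub>R pt a j)"
    unfolding u(4) by (rule sum.mono_neutral_left) (auto simp: u(2))
  have xu: "x = conecomb a (\<lambda>j. s * u j)"
  proof (subst vec_eq_iff, intro allI)
    fix r show "x $ r = conecomb a (\<lambda>j. s * u j) $ r"
    proof (cases r)
      case None
      then show ?thesis using su by (simp add: conecomb_def Acol_def s_def sum_distrib_left[symmetric])
    next
      case (Some i)
      have "x $ Some i = s * p $ i" by (simp add: p_nth)
      then show ?thesis unfolding pu using Some
        by (simp add: conecomb_def Acol_def pt_def sum_distrib_left mult_ac)
    qed
  qed
  have "Lr a \<sigma> i x = s * u i" if i: "i \<in> \<sigma>" for i
  proof -
    have "Lr a \<sigma> i x = (\<Sum>j\<in>UNIV. s * u j * of_int (mu a \<sigma> i j))" unfolding xu Lr_conecomb ..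
    also have "\<dots> = (\<Sum>j\<in>UNIV. if j = i then s * u j else 0)"
      by (intro sum.cong refl) (metis (full_types) i mu_in[OF us[OF \<sigma>(1)] i] mult.commute mult_1 mult_zero_right of_int_0 of_int_1 u(2))
    finally show ?thesis by simp
  qed
  then have "\<forall>j\<in>\<sigma>. Lr a \<sigma> j x > 0"
    using gen[OF \<sigma>(1)] u(1) s0 by (metis less_eq_real_def mult_nonneg_nonneg)
  moreover have False if \<sigma>: "\<sigma> \<in> T" "\<forall>j\<in>\<sigma>. Lr a \<sigma> j x > 0" and \<tau>: "\<tau> \<in> T" "\<forall>j\<in>\<tau>. Lr a \<tau> j x > 0" and ne: "\<sigma> \<noteq> \<tau>" for \<sigma> \<tau>
  proof -
    obtain \<omega> where \<omega>: "\<And>\<sigma>. \<sigma> \<in> T \<Longrightarrow> \<exists>r0 r. (\<forall>j\<in>\<sigma>. r0 + r \<bullet> pt a j = \<omega> j) \<and> (\<forall>j. j \<notin> \<sigma> \<longrightarrow> r0 + r \<bullet> pt a j < \<omega> j)"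
      using T unfolding regular_unimodular_triangulation_def by metis
    \<comment> \<open>The linear functional (r0, r) of sigma agrees with omega on sigma and lies
      below it elsewhere. Evaluated at x through both expansions, it shows that the expansion over
      sigma has the strictly smaller omega-height; exchanging the simplices gives the
      contradiction.\<close>
    have key: "(\<Sum>j\<in>\<sigma>. Lr a \<sigma> j x * \<omega> j) < (\<Sum>j\<in>\<tau>. Lr a \<tau> j x * \<omega> j)"
      if \<sigma>: "\<sigma> \<in> T" and \<tau>: "\<tau> \<in> T" "\<forall>j\<in>\<tau>. Lr a \<tau> j x > 0" and ne: "\<sigma> \<noteq> \<tau>" for \<sigma> \<tau> :: "'j set"
    proof -
      obtain r0 r where r: "\<And>j. j \<in> \<sigma> \<Longrightarrow> r0 + r \<bullet> pt a j = \<omega> j" "\<And>j. j \<notin> \<sigma> \<Longrightarrow> r0 + r \<bullet> pt a j < \<omega> j"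
        using \<omega>[OF \<sigma>] by metis
      have aff: "r0 * x $ None + (\<Sum>i\<in>UNIV. r $ i * x $ Some i) = (\<Sum>j\<in>\<rho>. Lr a \<rho> j x * (r0 + r \<bullet> pt a j))"
        if "\<rho> \<in> T" for \<rho>
      proof -
        have "r0 * x $ None + (\<Sum>i\<in>UNIV. r $ i * x $ Some i)
          = r0 * (\<Sum>j\<in>\<rho>. Lr a \<rho> j x) + (\<Sum>i\<in>UNIV. r $ i * (\<Sum>j\<in>\<rho>. Lr a \<rho> j x * real (a j $ i)))"
          by (subst (1 2) Lr_repr[OF us[OF that]]) (simp add: Acol_def)
        also have "(\<Sum>i\<in>UNIV. r $ i * (\<Sum>j\<in>\<rho>. Lr a \<rho> j x * real (a j $ i))) = (\<Sum>j\<in>\<rho>. Lr a \<rho> j x * (r \<bullet> pt a j))"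
          unfolding sum_distrib_left by (subst sum.swap) (simp add: inner_vec_def pt_def sum_distrib_left mult_ac)
        finally show ?thesis by (simp add: sum_distrib_left sum.distrib[symmetric] distrib_left mult_ac)
      qed
      have "(\<Sum>j\<in>\<sigma>. Lr a \<sigma> j x * \<omega> j) = (\<Sum>j\<in>\<sigma>. Lr a \<sigma> j x * (r0 + r \<bullet> pt a j))"
        by (simp add: r)
      also have "\<dots> = (\<Sum>j\<in>\<tau>. Lr a \<tau> j x * (r0 + r \<bullet> pt a j))"
        using aff[OF \<sigma>] aff[OF \<tau>(1)] by simp
      also have "\<dots> < (\<Sum>j\<in>\<tau>. Lr a \<tau> j x * \<omega> j)"
      proof (rule sum_strict_mono_ex1)
        show "\<forall>j\<in>\<tau>. Lr a \<tau> j x * (r0 + r \<bullet> pt a j) \<le> Lr a \<tau> j x * \<omega> j"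
          using \<tau>(2) r by (metis less_eq_real_def mult_left_mono)
        \<comment> \<open>Equal cardinality supplies a vertex of tau outside sigma, where the
          inequality is strict.\<close>
        have "card \<sigma> = card \<tau>" using us[OF \<sigma>] us[OF \<tau>(1)] by (simp add: unimodular_simplex_def)
        then have "\<not> \<tau> \<subseteq> \<sigma>" using ne card_subset_eq[of \<sigma> \<tau>] by auto
        then obtain j where "j \<in> \<tau>" "j \<notin> \<sigma>" by auto
        then show "\<exists>j\<in>\<tau>. Lr a \<tau> j x * (r0 + r \<bullet> pt a j) < Lr a \<tau> j x * \<omega> j"
          using \<tau>(2) r(2) by (intro bexI[of _ j]) auto
      qed simp
      finally show ?thesis .
    qed
    show False using key[OF \<sigma>(1) \<tau> ne] key[OF \<tau>(1) \<sigma> ne[symmetric]] by auto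
  qed
  ultimately show ?thesis using \<sigma>(1) by metis
qed

section \<open>The integral as a sum of Gamma series\<close>

lemma infsum_UN_disjoint:
  fixes f :: "'a \<Rightarrow> 'b::banach"
  assumes "finite I" and "disjoint_family_on A I" and "\<And>i. i \<in> I \<Longrightarrow> f summable_on A i"
  shows "infsum f (\<Union>i\<in>I. A i) = (\<Sum>i\<in>I. infsum f (A i)) \<and> f summable_on (\<Union>i\<in>I. A i)"
  using assms
proof (induction I rule: finite_induct)
  case (insert i I)
  have d: "A i \<inter> (\<Union>i\<in>I. A i) = {}"
    using insert by (auto simp: disjoint_family_on_def)
  have "disjoint_family_on A I" using insert by (auto simp: disjoint_family_on_def)
  then have IH: "infsum f (\<Union>i\<in>I. A i) = (\<Sum>i\<in>I. infsum f (A i))" "f summable_on (\<Union>i\<in>I. A i)"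
    using insert by auto
  have "f summable_on A i" using insert by auto
  with infsum_Un_disjoint[OF this IH(2) d] summable_on_Un_disjoint[OF this IH(2) d] show ?case
    using insert.hyps IH by simp
qed simp

lemma countable_lambdas: "countable (lambdas \<sigma> :: ('j::finite \<Rightarrow> nat) set)"
  by (rule countableI_type)

text \<open>The least m for which the real part of the shifted Gamma argument plus m is nonnegative,
  that is, the order of the tail in \<open>Cauchy_Saalschuetz\<close>.\<close>

definition tail_index :: "('j::finite \<Rightarrow> nat^'n::finite) \<Rightarrow> 'j set \<Rightarrow> complex^('n option) \<Rightarrow> ('j \<Rightarrow> nat) \<Rightarrow> 'j \<Rightarrow> nat" where
  "tail_index a \<sigma> nu l j = nat \<lceil>- (Re (Ainv a \<sigma> nu j) + mm a \<sigma> l j)\<rceil>"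

text \<open>For nonintegral x one number plays both roles: it is the threshold of the cone
  condition, and it selects the strip in which the Gamma integral with that many Taylor terms
  removed converges.\<close>

lemma nat_ceiling_tail:
  fixes x :: real
  assumes "x \<notin> \<int>"
  shows "nat \<lceil>- x\<rceil> \<le> i \<longleftrightarrow> x + real i > 0"
    and "x + nat \<lceil>- x\<rceil> > 0" and "nat \<lceil>- x\<rceil> = 0 \<or> x + nat \<lceil>- x\<rceil> < 1"
proof -
  have ne: "- x \<noteq> of_int k" for k :: int using assms by (metis Ints_minus Ints_of_int minus_minus)
  show *: "nat \<lceil>- x\<rceil> \<le> i \<longleftrightarrow> x + real i > 0" for i
    using ne[of "int i"] by (simp add: nat_le_iff ceiling_le_iff) linarith
  show "x + nat \<lceil>- x\<rceil> > 0" using *[of "nat \<lceil>- x\<rceil>"] by simp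
  show "nat \<lceil>- x\<rceil> = 0 \<or> x + nat \<lceil>- x\<rceil> < 1" by linarith
qed

text \<open>A bound for the L1 norm of the class term with index l; each factor over sigma is the
  third part of \<open>Cauchy_Saalschuetz\<close>.\<close>

definition gamma_bound :: "('j::finite \<Rightarrow> nat^'n::finite) \<Rightarrow> 'j set \<Rightarrow> complex^('n option) \<Rightarrow> complex^'j \<Rightarrow> ('j \<Rightarrow> nat) \<Rightarrow> real" where
  "gamma_bound a \<sigma> nu z l = (\<Prod>k\<in>-\<sigma>. norm (z $ k) ^ l k / fact (l k)) *
     (\<Prod>j\<in>\<sigma>. (norm (z $ j) / Re (z $ j)) ^ tail_index a \<sigma> nu l j *
        (Re (z $ j) powr (- (Re (Ainv a \<sigma> nu j) + mm a \<sigma> l j)) * \<bar>Gamma (Re (Ainv a \<sigma> nu j) + mm a \<sigma> l j)\<bar>))"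

definition EM_exp :: "('j::finite \<Rightarrow> nat^'n::finite) \<Rightarrow> complex^('n option) \<Rightarrow> complex^'j \<Rightarrow> real^('n option) \<Rightarrow> complex" where
  "EM_exp a nu z w = exp (\<Sum>r\<in>UNIV. nu $ r * of_real (w $ r)) * exp (- (\<Sum>j\<in>UNIV. z $ j * of_real (exp (dotA a j w))))"

text \<open>In the basis of sigma, coordinate i of Re nu + A l is the real part of the i-th shifted
  Gamma argument plus l_i, because the columns of sigma itself contribute only to their own
  coordinates. Nonintegrality keeps it away from 0.\<close>

lemma tail_index_class:
  fixes a :: "'j::finite \<Rightarrow> nat^'n::finite"
  assumes \<sigma>: "unimodular_simplex a \<sigma>" and i: "i \<in> \<sigma>" and notint: "Re (Ainv a \<sigma> nu i) \<notin> \<int>"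
    and c: "(\<chi> r. Re (nu $ r)) = conecomb a c"
  shows "tail_index a \<sigma> nu l i \<le> l i \<longleftrightarrow> Lr a \<sigma> i (conecomb a (\<lambda>j. c j + l j)) > 0"
    and "Lr a \<sigma> i (conecomb a (\<lambda>j. c j + l j)) \<noteq> 0"
proof -
  have "Lr a \<sigma> i (conecomb a (\<lambda>j. c j + l j)) = Lr a \<sigma> i (conecomb a c) + (\<Sum>j\<in>UNIV. of_int (int (l j) * mu a \<sigma> i j))"
    unfolding Lr_conecomb by (simp add: distrib_right sum.distrib)
  also have "Lr a \<sigma> i (conecomb a c) = Re (Ainv a \<sigma> nu i)"
    unfolding c[symmetric] by (simp add: Lr_def Ainv_eq_icoef[OF \<sigma>])
  also have "(\<Sum>j\<in>UNIV. of_int (int (l j) * mu a \<sigma> i j)) =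
     (\<Sum>j\<in>\<sigma>. of_int (int (l j) * mu a \<sigma> i j)) + (\<Sum>j\<in>-\<sigma>. real_of_int (int (l j) * mu a \<sigma> i j))"
    by (subst sum.union_disjoint[symmetric]) auto
  also have "(\<Sum>j\<in>\<sigma>. of_int (int (l j) * mu a \<sigma> i j)) = (\<Sum>j\<in>\<sigma>. if j = i then real (l j) else 0)"
    by (intro sum.cong refl) (auto simp: mu_in[OF \<sigma> i])
  also have "\<dots> = real (l i)" using i by simp
  finally have eq: "Lr a \<sigma> i (conecomb a (\<lambda>j. c j + l j)) = (Re (Ainv a \<sigma> nu i) + of_int (mm a \<sigma> l i)) + real (l i)"
    by (simp add: mm_def)
  have ni: "Re (Ainv a \<sigma> nu i) + of_int (mm a \<sigma> l i) \<notin> \<int>"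
    using notint by (metis Ints_diff Ints_of_int add_diff_cancel_right')
  show "tail_index a \<sigma> nu l i \<le> l i \<longleftrightarrow> Lr a \<sigma> i (conecomb a (\<lambda>j. c j + l j)) > 0"
    unfolding eq tail_index_def using nat_ceiling_tail(1)[OF ni, of "l i"] by simp
  show "Lr a \<sigma> i (conecomb a (\<lambda>j. c j + l j)) \<noteq> 0"
    unfolding eq using ni by (metis Ints_minus Ints_of_nat add.commute add_eq_0_iff)
qed

text \<open>By \<open>cone_partition\<close> the index sets belonging to the simplices partition all
  exponents, and \<open>exp_multi_class_sum\<close> evaluates each part.\<close>

lemma EM_exp_decomposition:
  fixes a :: "'j::finite \<Rightarrow> nat^'n::finite"
  assumes inj: "inj a" and T: "regular_unimodular_triangulation a T"
    and gen: "\<And>\<sigma> j. \<sigma> \<in> T \<Longrightarrow> j \<in> \<sigma> \<Longrightarrow> Re (Ainv a \<sigma> nu j) \<notin> \<int>"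
    and c: "(\<chi> r. Re (nu $ r)) = conecomb a c" "\<And>j. 0 \<le> c j" and pos: "Re (nu $ None) > 0"
  shows "exp (- (\<Sum>j\<in>UNIV. u j)) = (\<Sum>\<sigma>\<in>T. infsum (\<lambda>l. (\<Prod>k\<in>-\<sigma>. (- u k) ^ l k / fact (l k)) *
            (\<Prod>j\<in>\<sigma>. exp_tail (tail_index a \<sigma> nu l j) (u j))) (lambdas \<sigma>))"
proof -
  let ?t = "\<lambda>l. \<Prod>j\<in>UNIV. (- u j) ^ l j / fact (l j)"
  \<comment> \<open>Masking l on sigma gives the form wanted by \<open>exp_multi_class_sum\<close>;
    it changes nothing, since the shift sees only components outside sigma.\<close>
  define C where "C \<sigma> = {l. \<forall>j\<in>\<sigma>. tail_index a \<sigma> nu (\<lambda>k. if k \<in> \<sigma> then 0 else l k) j \<le> l j}" for \<sigma>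
  have mm_restrict: "mm a \<sigma> (\<lambda>k. if k \<in> \<sigma> then 0 else l k) j = mm a \<sigma> l j" for \<sigma> l j
    unfolding mm_def by (intro sum.cong) auto
  have C: "l \<in> C \<sigma> \<longleftrightarrow> (\<forall>j\<in>\<sigma>. Lr a \<sigma> j (conecomb a (\<lambda>j. c j + l j)) > 0)" if "\<sigma> \<in> T" for l \<sigma>
    using tail_index_class(1)[OF triangulation_simplex[OF T that] _ gen[OF that] c(1)]
    by (simp add: C_def tail_index_def mm_restrict)
  have ex1: "\<exists>!\<sigma>. \<sigma> \<in> T \<and> (\<forall>j\<in>\<sigma>. Lr a \<sigma> j (conecomb a (\<lambda>j. c j + l j)) > 0)"
    for l :: "'j \<Rightarrow> nat"
  proof (rule cone_partition[OF inj T _ refl])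
    have "(\<chi> r. Re (nu $ r)) $ None = (\<Sum>j\<in>UNIV. c j)" unfolding c(1) by (simp add: conecomb_def Acol_def)
    then have "(\<Sum>j\<in>UNIV. c j) > 0" using pos by simp
    then show "conecomb a (\<lambda>j. c j + l j) $ None > 0"
      by (auto simp: conecomb_def Acol_def sum.distrib intro!: add_pos_nonneg sum_nonneg)
    show "0 \<le> c j + real (l j)" for j using c(2)[of j] by simp
    show "Lr a \<sigma> j (conecomb a (\<lambda>j. c j + real (l j))) \<noteq> 0" if "\<sigma> \<in> T" "j \<in> \<sigma>" for \<sigma> j
      by (rule tail_index_class(2)[OF triangulation_simplex[OF T that(1)] that(2) gen[OF that] c(1)])
  qed
  have disj: "disjoint_family_on C T"
  proof (unfold disjoint_family_on_def, intro ballI impI equals0I)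
    fix \<sigma> \<tau> l assume *: "\<sigma> \<in> T" "\<tau> \<in> T" "\<sigma> \<noteq> \<tau>" "l \<in> C \<sigma> \<inter> C \<tau>"
    then have "\<forall>j\<in>\<sigma>. Lr a \<sigma> j (conecomb a (\<lambda>j. c j + l j)) > 0" "\<forall>j\<in>\<tau>. Lr a \<tau> j (conecomb a (\<lambda>j. c j + l j)) > 0"
      using C by auto
    then show False using ex1[of l] *(1-3) by (elim ex1E) metis
  qed
  have un: "(\<Union>\<sigma>\<in>T. C \<sigma>) = UNIV"
  proof (intro equalityI subsetI UNIV_I)
    fix l :: "'j \<Rightarrow> nat"
    obtain \<sigma> where "\<sigma> \<in> T" "\<forall>j\<in>\<sigma>. Lr a \<sigma> j (conecomb a (\<lambda>j. c j + l j)) > 0"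
      using ex1[of l] by (elim ex1E conjE)
    then show "l \<in> (\<Union>\<sigma>\<in>T. C \<sigma>)" using C by auto
  qed
  have Tsum: "?t summable_on C \<sigma>" for \<sigma>
    by (rule summable_on_subset_banach[OF abs_summable_summable[OF exp_sum_multi_has_sum(1)[of u]]]) simp
  have "exp (- (\<Sum>j\<in>UNIV. u j)) = infsum ?t UNIV" by (rule exp_sum_multi_has_sum(2)[symmetric])
  also have "\<dots> = (\<Sum>\<sigma>\<in>T. infsum ?t (C \<sigma>))"
    using infsum_UN_disjoint[OF finite disj Tsum] unfolding un by (rule conjunct1)
  finally show ?thesis
    by (simp only: C_def exp_multi_class_sum(2))
qed

text \<open>In the coordinates \<open>dotA a j w\<close> with j in sigma the integrand separates: nu
  . w contributes the exponents A_sigma^(-1) nu, and the monomials outside sigma, rewritten by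
  \<open>dotA_eq_sum_mu\<close>, add the integral shift. Every factor is then a Cauchy--Saalschuetz
  integral.\<close>

lemma class_term_integral:
  fixes a :: "'j::finite \<Rightarrow> nat^'n::finite"
  assumes \<sigma>: "unimodular_simplex a \<sigma>" and zpos: "\<And>j. 0 < Re (z $ j)"
    and gen: "\<And>j. j \<in> \<sigma> \<Longrightarrow> Re (Ainv a \<sigma> nu j) \<notin> \<int>"
  defines "f \<equiv> \<lambda>l w. exp (\<Sum>r\<in>UNIV. nu $ r * of_real (w $ r)) *
      ((\<Prod>k\<in>-\<sigma>. (- (z $ k * of_real (exp (dotA a k w)))) ^ l k / fact (l k)) *
       (\<Prod>j\<in>\<sigma>. exp_tail (tail_index a \<sigma> nu l j) (z $ j * of_real (exp (dotA a j w)))))"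
  shows "integrable lborel (f l)"
    and "(\<integral>w. f l w \<partial>lborel) = gamma_prefactor a \<sigma> nu z * gamma_term a \<sigma> nu z l"
    and "(\<integral>w. norm (f l w) \<partial>lborel) \<le> gamma_bound a \<sigma> nu z l"
proof -
  let ?v = "\<lambda>j. Ainv a \<sigma> nu j + of_int (mm a \<sigma> l j)"
  define K where "K = (\<Prod>k\<in>-\<sigma>. (- (z $ k)) ^ l k / fact (l k))"
  define h where "h j t = exp (?v j * complex_of_real t) * exp_tail (tail_index a \<sigma> nu l j) (z $ j * of_real (exp t))" for j t
  have z0: "z $ j \<noteq> 0" for j using zpos[of j] by auto
  have f: "f l w = K * (\<Prod>j\<in>\<sigma>. h j (dotA a j w))" for w
  proof -
    have "(\<Sum>r\<in>UNIV. nu $ r * complex_of_real (w $ r)) = (\<Sum>j\<in>\<sigma>. Ainv a \<sigma> nu j * of_real (dotA a j w))"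
      using sum_dotA[OF \<sigma>, of "\<lambda>r. nu $ r" "\<lambda>r. complex_of_real (w $ r)"]
      by (simp add: Ainv_eq_icoef[OF \<sigma>] dotA_def)
    then have e1: "exp (\<Sum>r\<in>UNIV. nu $ r * complex_of_real (w $ r)) = (\<Prod>j\<in>\<sigma>. exp (Ainv a \<sigma> nu j * of_real (dotA a j w)))"
      by (simp add: exp_sum)
    have "(\<Prod>k\<in>-\<sigma>. (- (z $ k * of_real (exp (dotA a k w)))) ^ l k / fact (l k))
       = K * (\<Prod>k\<in>-\<sigma>. complex_of_real (exp (dotA a k w)) ^ l k)"
      unfolding K_def prod.distrib[symmetric]
      by (intro prod.cong refl) (simp add: power_mult_distrib[symmetric])
    also have "(\<Prod>k\<in>-\<sigma>. complex_of_real (exp (dotA a k w)) ^ l k) = (\<Prod>k\<in>-\<sigma>. exp (of_nat (l k) * complex_of_real (dotA a k w)))"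
      by (intro prod.cong refl) (simp add: exp_of_nat_mult exp_of_real)
    also have "\<dots> = exp (\<Sum>k\<in>-\<sigma>. of_nat (l k) * complex_of_real (dotA a k w))"
      by (simp add: exp_sum)
    also have "(\<Sum>k\<in>-\<sigma>. of_nat (l k) * complex_of_real (dotA a k w)) = (\<Sum>j\<in>\<sigma>. of_int (mm a \<sigma> l j) * of_real (dotA a j w))"
      unfolding mm_def
      by (subst dotA_eq_sum_mu[OF \<sigma>]) (simp add: sum_distrib_left sum_distrib_right mult_ac sum.swap[of _ \<sigma>])
    also have "exp \<dots> = (\<Prod>j\<in>\<sigma>. exp (of_int (mm a \<sigma> l j) * of_real (dotA a j w)))"
      by (simp add: exp_sum)
    finally have e2: "(\<Prod>k\<in>-\<sigma>. (- (z $ k * of_real (exp (dotA a k w)))) ^ l k / fact (l k))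
       = K * (\<Prod>j\<in>\<sigma>. exp (of_int (mm a \<sigma> l j) * complex_of_real (dotA a j w)))" .
    show ?thesis
      unfolding f_def e1 e2 h_def distrib_right exp_add prod.distrib by (simp only: mult_ac)
  qed
  have x: "Re (?v j) \<notin> \<int>" if "j \<in> \<sigma>" for j
    using gen[OF that] Ints_diff[OF _ Ints_of_int, of "Re (?v j)" "mm a \<sigma> l j"] by auto
  note tail = nat_ceiling_tail(2,3)[OF x]
  have ti: "tail_index a \<sigma> nu l j = nat \<lceil>- Re (?v j)\<rceil>" for j by (simp add: tail_index_def)
  have CS: "integrable lborel (h j)"
    "(\<integral>t. h j t \<partial>lborel) = z $ j powr (- ?v j) * Gamma (?v j)"
    "(\<integral>t. norm (h j t) \<partial>lborel) \<le> (norm (z $ j) / Re (z $ j)) ^ tail_index a \<sigma> nu l j *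
        (Re (z $ j) powr (- Re (?v j)) * \<bar>Gamma (Re (?v j))\<bar>)" if "j \<in> \<sigma>" for j
    unfolding h_def[abs_def] ti
    by (rule Cauchy_Saalschuetz[OF zpos tail(1)[OF that] tail(2)[OF that]])+
  have P: "integrable lborel (\<lambda>w. \<Prod>j\<in>\<sigma>. h j (dotA a j w))"
    "(\<integral>w. (\<Prod>j\<in>\<sigma>. h j (dotA a j w)) \<partial>lborel) = (\<Prod>j\<in>\<sigma>. \<integral>t. h j t \<partial>lborel)"
    "(\<integral>w. norm (\<Prod>j\<in>\<sigma>. h j (dotA a j w)) \<partial>lborel) = (\<Prod>j\<in>\<sigma>. \<integral>t. norm (h j t) \<partial>lborel)"
    by (rule integrable_prod_dotA[OF \<sigma> CS(1)] integral_prod_dotA[OF \<sigma> CS(1)]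
          integral_norm_prod_dotA[OF \<sigma> CS(1)]; assumption)+
  show "integrable lborel (f l)" unfolding f[abs_def] by (intro integrable_mult_right P)
  have "(\<integral>w. f l w \<partial>lborel) = K * (\<Prod>j\<in>\<sigma>. z $ j powr (- ?v j) * Gamma (?v j))"
    unfolding f integral_mult_right_zero P(2) using CS(2) by simp
  also have "\<dots> = gamma_prefactor a \<sigma> nu z * gamma_term a \<sigma> nu z l"
  proof -
    have "(\<Prod>j\<in>\<sigma>. z $ j powr (- ?v j)) = (\<Prod>j\<in>\<sigma>. z $ j powr (- Ainv a \<sigma> nu j)) * (\<Prod>j\<in>\<sigma>. inverse (z $ j powr of_int (mm a \<sigma> l j)))"
      unfolding prod.distrib[symmetric]
      by (intro prod.cong refl) (simp add: powr_diff powr_minus divide_inverse)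
    \<comment> \<open>The exponents are integers with sum |lambda|, so no branch is involved, and
      passing from z_j to -z_j produces exactly the sign that K carries.\<close>
    moreover have "(\<Prod>j\<in>\<sigma>. (- (z $ j)) powr of_int (mm a \<sigma> l j)) = (-1) ^ (\<Sum>k\<in>-\<sigma>. l k) * (\<Prod>j\<in>\<sigma>. z $ j powr of_int (mm a \<sigma> l j))"
    proof -
      have "(- (z $ j)) powr of_int (mm a \<sigma> l j) = (-1) powi (mm a \<sigma> l j) * z $ j powr of_int (mm a \<sigma> l j)" for j
        using z0[of j] by (simp add: complex_powr_of_int flip: power_int_mult_distrib)
      moreover have "(\<Prod>j\<in>S. (-1 :: complex) powi g j) = (-1) powi (\<Sum>j\<in>S. g j)" for S :: "'j set" and g
        by (induction S rule: infinite_finite_induct) (auto simp: power_int_add)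
      ultimately show ?thesis
        by (simp add: prod.distrib sum_mm[OF \<sigma>] flip: of_nat_sum)
    qed
    moreover have "K = (-1) ^ (\<Sum>k\<in>-\<sigma>. l k) * ((\<Prod>k\<in>-\<sigma>. (z $ k) ^ l k) / of_nat (\<Prod>k\<in>-\<sigma>. fact (l k)))"
    proof -
      have "K = (\<Prod>k\<in>-\<sigma>. (-1) ^ l k * ((z $ k) ^ l k / of_nat (fact (l k))))"
        unfolding K_def by (intro prod.cong refl) (simp add: power_mult_distrib[symmetric])
      then show ?thesis by (simp add: prod.distrib prod_dividef power_sum)
    qed
    moreover have "inverse ((-1) ^ i) = (-1 :: complex) ^ i" for i :: nat by (simp add: power_inverse[symmetric])
    moreover have "(\<Prod>j\<in>\<sigma>. inverse (g j)) = inverse (prod g \<sigma>)" for g :: "'j \<Rightarrow> complex"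
      using prod_inversef[of g \<sigma>] by (simp add: o_def)
    ultimately show ?thesis
      unfolding gamma_prefactor_def gamma_term_def Ainv_Abar_mult[OF \<sigma>]
      by (simp add: prod.distrib divide_inverse mult_ac)
  qed
  finally show "(\<integral>w. f l w \<partial>lborel) = gamma_prefactor a \<sigma> nu z * gamma_term a \<sigma> nu z l" .
  have "(\<integral>w. norm (f l w) \<partial>lborel) = norm K * (\<Prod>j\<in>\<sigma>. \<integral>t. norm (h j t) \<partial>lborel)"
    unfolding f norm_mult[of K] integral_mult_right_zero P(3) ..
  also have "norm K = (\<Prod>k\<in>-\<sigma>. norm (z $ k) ^ l k / fact (l k))"
    by (simp add: K_def norm_power norm_divide flip: prod_norm)
  also have "(\<Prod>j\<in>\<sigma>. \<integral>t. norm (h j t) \<partial>lborel) \<le> (\<Prod>j\<in>\<sigma>. (norm (z $ j) / Re (z $ j)) ^ tail_index a \<sigma> nu l j *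
        (Re (z $ j) powr (- (Re (?v j))) * \<bar>Gamma (Re (?v j))\<bar>))"
    by (intro prod_mono conjI CS(3)) (auto intro: Bochner_Integration.integral_nonneg)
  finally show "(\<integral>w. norm (f l w) \<partial>lborel) \<le> gamma_bound a \<sigma> nu z l"
    by (simp add: gamma_bound_def mult_left_mono prod_nonneg)
qed

text \<open>Summability of the L1 norms gives the value and also the integrability in n + 1
  variables, on which Fubini's theorem in \<open>J_int_eq_EM_exp\<close> rests.\<close>

lemma EM_exp_integral:
  fixes a :: "'j::finite \<Rightarrow> nat^'n::finite"
  assumes inj: "inj a" and T: "regular_unimodular_triangulation a T" and zpos: "\<And>j. 0 < Re (z $ j)"
    and gen: "\<And>\<sigma> j. \<sigma> \<in> T \<Longrightarrow> j \<in> \<sigma> \<Longrightarrow> Re (Ainv a \<sigma> nu j) \<notin> \<int>"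
    and c: "(\<chi> r. Re (nu $ r)) = conecomb a c" "\<And>j. 0 \<le> c j" and pos: "Re (nu $ None) > 0"
    and summ: "\<And>\<sigma>. \<sigma> \<in> T \<Longrightarrow> gamma_bound a \<sigma> nu z summable_on lambdas \<sigma>"
  shows "integrable lborel (EM_exp a nu z)"
    and "(\<integral>w. EM_exp a nu z w \<partial>lborel) = (\<Sum>\<sigma>\<in>T. gamma_prefactor a \<sigma> nu z * infsum (gamma_term a \<sigma> nu z) (lambdas \<sigma>))"
proof -
  let ?u = "\<lambda>w j. z $ j * complex_of_real (exp (dotA a j w))"
  define f where "f \<sigma> l w = exp (\<Sum>r\<in>UNIV. nu $ r * of_real (w $ r)) *
      ((\<Prod>k\<in>-\<sigma>. (- ?u w k) ^ l k / fact (l k)) * (\<Prod>j\<in>\<sigma>. exp_tail (tail_index a \<sigma> nu l j) (?u w j)))"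
    for \<sigma> l and w :: "real^('n option)"
  have ct: "integrable lborel (f \<sigma> l)"
    "(\<integral>w. f \<sigma> l w \<partial>lborel) = gamma_prefactor a \<sigma> nu z * gamma_term a \<sigma> nu z l"
    "(\<integral>w. norm (f \<sigma> l w) \<partial>lborel) \<le> gamma_bound a \<sigma> nu z l" if "\<sigma> \<in> T" for \<sigma> l
    unfolding f_def[abs_def]
    by (rule class_term_integral[OF triangulation_simplex[OF T that] zpos gen[OF that]]; assumption)+
  have pt: "(\<lambda>l. norm (f \<sigma> l w)) summable_on lambdas \<sigma>" for \<sigma> w
    unfolding f_def norm_mult[of "exp _"]
    by (intro summable_on_cmult_right exp_multi_class_sum(1)[where m = "tail_index a \<sigma> nu"])
  have eq: "EM_exp a nu z w = (\<Sum>\<sigma>\<in>T. infsum (\<lambda>l. f \<sigma> l w) (lambdas \<sigma>))" for w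
  proof -
    have "exp (- (\<Sum>j\<in>UNIV. ?u w j)) = (\<Sum>\<sigma>\<in>T. infsum (\<lambda>l. (\<Prod>k\<in>-\<sigma>. (- ?u w k) ^ l k / fact (l k)) *
            (\<Prod>j\<in>\<sigma>. exp_tail (tail_index a \<sigma> nu l j) (?u w j))) (lambdas \<sigma>))"
      by (rule EM_exp_decomposition[OF inj T gen c pos])
    then show ?thesis
      unfolding EM_exp_def f_def by (simp only: sum_distrib_left infsum_cmult_right')
  qed
  have sum: "(\<lambda>l. \<integral>w. norm (f \<sigma> l w) \<partial>lborel) summable_on lambdas \<sigma>" if "\<sigma> \<in> T" for \<sigma>
    by (rule summable_on_comparison_test[OF summ[OF that]]) (auto intro: ct(3)[OF that])
  have I: "integrable lborel (\<lambda>w. infsum (\<lambda>l. f \<sigma> l w) (lambdas \<sigma>))"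
    "(\<integral>w. infsum (\<lambda>l. f \<sigma> l w) (lambdas \<sigma>) \<partial>lborel) = infsum (\<lambda>l. \<integral>w. f \<sigma> l w \<partial>lborel) (lambdas \<sigma>)"
    if "\<sigma> \<in> T" for \<sigma>
    using integral_infsum[of "lambdas \<sigma>" "f \<sigma>", OF countable_lambdas ct(1)[OF that] sum[OF that] pt] by auto
  show "integrable lborel (EM_exp a nu z)"
    unfolding eq[abs_def] by (intro Bochner_Integration.integrable_sum I(1))
  have "(\<integral>w. EM_exp a nu z w \<partial>lborel) = (\<Sum>\<sigma>\<in>T. \<integral>w. infsum (\<lambda>l. f \<sigma> l w) (lambdas \<sigma>) \<partial>lborel)"
    unfolding eq by (intro Bochner_Integration.integral_sum I(1))
  also have "\<dots> = (\<Sum>\<sigma>\<in>T. infsum (\<lambda>l. \<integral>w. f \<sigma> l w \<partial>lborel) (lambdas \<sigma>))"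
    by (intro sum.cong refl I(2))
  also have "\<dots> = (\<Sum>\<sigma>\<in>T. gamma_prefactor a \<sigma> nu z * infsum (gamma_term a \<sigma> nu z) (lambdas \<sigma>))"
    by (intro sum.cong refl) (simp add: ct(2) infsum_cmult_right')
  finally show "(\<integral>w. EM_exp a nu z w \<partial>lborel) = (\<Sum>\<sigma>\<in>T. gamma_prefactor a \<sigma> nu z * infsum (gamma_term a \<sigma> nu z) (lambdas \<sigma>))" .
qed

section \<open>Bounds for shifted Gamma factors\<close>

text \<open>The order of magnitude of \<open>Gamma (v + m)\<close> up to factors exponential in \<open>\<bar>m\<bar>\<close>.\<close>

definition gfact :: "int \<Rightarrow> real" where
  "gfact m = (if 0 \<le> m then fact (nat m) else 1 / fact (nat (- m)))"

lemma gfact_pos: "gfact m > 0"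
  by (simp add: gfact_def)

lemma fact_add_le: "fact (a + b) \<le> (2 ^ (a + b) * fact a * fact b :: real)"
proof -
  have "real ((a + b) choose a) \<le> 2 ^ (a + b)"
    using binomial_le_pow2[of "a + b" a] by (metis of_nat_le_iff of_nat_numeral of_nat_power)
  then show ?thesis
    by (simp add: binomial_fact field_simps)
qed

lemma pochhammer_one_add: "pochhammer (real R + 1) M \<le> 2 ^ (R + M) * fact M"
proof -
  have "pochhammer (1 + real R) M = fact (R + M) / fact R"
    using pochhammer_product'[of "1::real" R M] by (simp add: field_simps flip: pochhammer_fact)
  also have "\<dots> \<le> 2 ^ (R + M) * fact M"
    using fact_add_le[of R M] by (simp add: field_simps)
  finally show ?thesis by (simp add: add.commute)
qed

text \<open>For m >= 0 the recurrence multiplies the value at 1 - v by a product of norm at most (R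
  + 1) ... (R + m). For -m at most R compactness suffices. Beyond that, the recurrence from 1 - v +
  R divides by a product of at least factorial size.\<close>

lemma norm_rGamma_le:
  fixes R :: nat
  obtains C where "C > 0" "\<And>v m. norm v \<le> real R \<Longrightarrow> norm (rGamma (1 - v - of_int m :: complex)) \<le> C * 2 ^ nat \<bar>m\<bar> * gfact m"
proof -
  have "\<exists>B>0. \<forall>v\<in>cball 0 (real R). norm (rGamma (1 - v + of_nat M :: complex)) \<le> B" for M
  proof -
    have "compact ((\<lambda>v. rGamma (1 - v + of_nat M :: complex)) ` cball 0 (real R))"
      by (intro compact_continuous_image continuous_on_compose2[OF continuous_on_rGamma[of UNIV]] continuous_intros) auto
    from compact_imp_bounded[OF this] show ?thesis by (auto simp: bounded_pos)
  qed
  then have "\<forall>M. \<exists>B. B > 0 \<and> (\<forall>v\<in>cball 0 (real R). norm (rGamma (1 - v + of_nat M :: complex)) \<le> B)"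
    by blast
  from choice[OF this] obtain B where
    "\<forall>M. B M > 0 \<and> (\<forall>v\<in>cball 0 (real R). norm (rGamma (1 - v + of_nat M :: complex)) \<le> B M)" ..
  then have B: "B M > 0" "norm v \<le> real R \<Longrightarrow> norm (rGamma (1 - v + of_nat M :: complex)) \<le> B M" for M v
    by auto
  \<comment> \<open>The summand M = 0 serves nonnegative m, the summand M = R the shifts beyond R,
    and the others the shifts in between.\<close>
  define K where "K = (\<Sum>M\<le>R. B M)"
  have K: "B M \<le> K" if "M \<le> R" for M
    unfolding K_def using that B(1) by (intro member_le_sum) (auto intro: less_imp_le)
  have K0: "K > 0" using B(1)[of 0] K[of 0] by simp
  show ?thesis
  proof (rule that[of "K * 2 ^ R * fact R"])
    show "K * 2 ^ R * fact R > 0" using K0 by simp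
    fix v :: complex and m :: int assume v: "norm v \<le> real R"
    have one: "1 \<le> (2::real) ^ R * fact R" "1 \<le> (2::real) ^ R" "1 \<le> (fact R :: real)"
      using mult_mono[of 1 "2 ^ R" 1 "fact R :: real"] by auto
    show "norm (rGamma (1 - v - of_int m)) \<le> K * 2 ^ R * fact R * 2 ^ nat \<bar>m\<bar> * gfact m"
    proof (cases "m \<ge> 0")
      case True
      define M where "M = nat m"
      have m: "of_int m = (of_nat M :: complex)" using True by (simp add: M_def)
      have g: "gfact m = fact M" "nat \<bar>m\<bar> = M" using True by (auto simp: gfact_def M_def)
      have "rGamma (1 - v - of_nat M) = pochhammer (1 - v - of_nat M) M * rGamma (1 - v)"
        using pochhammer_rGamma[of "1 - v - of_nat M" M] by simp
      moreover have "norm (pochhammer (1 - v - of_nat M) M) \<le> pochhammer (real R + 1) M"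
      proof -
        have "norm (pochhammer (1 - v - of_nat M) M) = (\<Prod>i<M. norm (1 - v - of_nat M + of_nat i))"
          by (simp add: pochhammer_prod prod_norm atLeast0LessThan)
        also have "\<dots> \<le> (\<Prod>i<M. real R + 1 + real (M - Suc i))"
        proof (intro prod_mono conjI)
          fix i assume "i \<in> {..<M}"
          then have "1 - v - of_nat M + of_nat i = - (v + of_nat (M - Suc i))" by (simp add: of_nat_diff)
          then have "norm (1 - v - of_nat M + of_nat i) \<le> norm v + real (M - Suc i)"
            using norm_triangle_ineq[of v "of_nat (M - Suc i)"] by (simp only: norm_minus_cancel norm_of_nat)
          then show "norm (1 - v - of_nat M + of_nat i) \<le> real R + 1 + real (M - Suc i)" using v by simp
        qed auto
        also have "\<dots> = (\<Prod>i<M. real R + 1 + real i)"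
          using prod.nat_diff_reindex[of "\<lambda>i. real R + 1 + real i" M] by simp
        finally show ?thesis by (simp add: pochhammer_prod atLeast0LessThan)
      qed
      moreover have "norm (rGamma (1 - v)) \<le> K" using B(2)[OF v, of 0] K[of 0] by simp
      ultimately have "norm (rGamma (1 - v - of_nat M)) \<le> pochhammer (real R + 1) M * K"
        unfolding norm_mult by (simp only: norm_mult) (intro mult_mono; simp add: pochhammer_nonneg)
      also have "\<dots> \<le> (2 ^ (R + M) * fact M) * K"
        using pochhammer_one_add[of R M] K0 by (intro mult_right_mono) auto
      also have "\<dots> = (2 ^ (R + M) * fact M) * K * 1" by simp
      also have "\<dots> \<le> (2 ^ (R + M) * fact M) * K * fact R"
        using one K0 by (intro mult_left_mono) auto
      finally show ?thesis unfolding m g by (simp add: power_add mult_ac)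
    next
      case False
      define M where "M = nat (- m)"
      have m: "1 - v - of_int m = 1 - v + of_nat M" using False by (simp add: M_def)
      have g: "gfact m = 1 / fact M" "nat \<bar>m\<bar> = M" using False by (auto simp: gfact_def M_def)
      show ?thesis
      proof (cases "M \<le> R")
        case True
        have "norm (rGamma (1 - v + of_nat M)) \<le> K" using B(2)[OF v, of M] K[OF True] by simp
        also have "K = K * (1 / fact M * fact M)" by simp
        also have "\<dots> \<le> K * (1 / fact M * (2 ^ R * fact R * 2 ^ M))"
        proof (intro mult_left_mono)
          have "(fact M :: real) \<le> fact R" using True by (rule fact_mono)
          moreover have "1 \<le> (2::real) ^ R * 2 ^ M" by (simp add: power_add[symmetric])
          ultimately have "fact M * 1 \<le> fact R * ((2::real) ^ R * 2 ^ M)"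
            by (intro mult_mono) auto
          then show "fact M \<le> (2::real) ^ R * fact R * 2 ^ M" by (simp add: mult_ac)
        qed (use K0 in auto)
        finally show ?thesis by (simp add: m g mult_ac)
      next
        case False
        then have MR: "M = R + (M - R)" by simp
        define n where "n = M - R"
        have M: "M = R + n" using MR n_def by simp
        have "rGamma (1 - v + of_nat R) = pochhammer (1 - v + of_nat R) n * rGamma (1 - v + of_nat M)"
          using pochhammer_rGamma[of "1 - v + of_nat R" n] by (simp add: M add.assoc)
        then have *: "norm (pochhammer (1 - v + of_nat R) n) * norm (rGamma (1 - v + of_nat M)) \<le> K"
          using B(2)[OF v, of R] K[of R] by (simp add: norm_mult)
        \<comment> \<open>Since |v| is at most R, the factor 1 - v + R + i has norm at least 1 +
          i.\<close>
        have "fact n \<le> norm (pochhammer (1 - v + of_nat R) n)"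
        proof -
          have "(fact n :: real) = (\<Prod>i<n. 1 + real i)"
            by (simp add: pochhammer_fact pochhammer_prod atLeast0LessThan)
          also have "\<dots> \<le> (\<Prod>i<n. norm (1 - v + of_nat R + of_nat i))"
          proof (intro prod_mono conjI)
            fix i
            have "norm (of_nat (Suc (R + i)) :: complex) - norm v \<le> norm (of_nat (Suc (R + i)) - v)"
              by (rule norm_triangle_ineq2)
            moreover have "of_nat (Suc (R + i)) - v = 1 - v + of_nat R + of_nat i" by simp
            ultimately show "1 + real i \<le> norm (1 - v + of_nat R + of_nat i)"
              using v by (simp only: norm_of_nat)
          qed auto
          finally show ?thesis by (simp add: pochhammer_prod prod_norm atLeast0LessThan)
        qed
        then have "fact n * norm (rGamma (1 - v + of_nat M)) \<le> K"
          using * order.trans[OF mult_right_mono[OF _ norm_ge_zero]] by blast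
        then have "norm (rGamma (1 - v + of_nat M)) \<le> K / fact n" by (simp add: field_simps)
        also have "\<dots> \<le> K * (2 ^ M * fact R) / fact M"
          using fact_add_le[of R n] K0 by (simp add: M field_simps)
        also have "\<dots> = (K * (2 ^ M * fact R) / fact M) * 1" by simp
        also have "\<dots> \<le> (K * (2 ^ M * fact R) / fact M) * 2 ^ R"
          using K0 one by (intro mult_left_mono) auto
        finally show ?thesis by (simp add: m g mult_ac)
      qed
    qed
  qed
qed

lemma Re_pos_not_nonpos_Int: "Re w > 0 \<Longrightarrow> w \<notin> \<int>\<^sub>\<le>\<^sub>0"
  by (metis complex_Re_of_int nonpos_Ints_cases of_int_le_0_iff not_le)

text \<open>The point is one neighbourhood for all m. If v0 is not an integer, the sine stays away
  from 0 nearby and the reflection formula reduces the claim to \<open>norm_rGamma_le\<close>. If v0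
  is an integer, the admissible m make v0 + m a positive integer, and v + m is reached from 1 + (v -
  v0) by the recurrence.\<close>

lemma Gamma_locally_bounded:
  fixes v0 :: complex
  obtains d C where "d > 0" "C > 0" "\<And>v m. dist v v0 < d \<Longrightarrow> v0 + of_int m \<notin> \<int>\<^sub>\<le>\<^sub>0 \<Longrightarrow>
     v + of_int m \<notin> \<int>\<^sub>\<le>\<^sub>0 \<and> norm (Gamma (v + of_int m)) \<le> C * 2 ^ nat \<bar>m\<bar> * gfact m"
proof (cases "v0 \<in> \<int>")
  case False
  have "sin (of_real pi * v0) \<noteq> 0"
    using False sin_eq_0[of "of_real pi * v0"] by auto
  then have s0: "norm (sin (of_real pi * v0)) > 0" by simp
  have "isCont (\<lambda>v::complex. norm (sin (of_real pi * v))) v0" by (intro continuous_intros)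
  then have "eventually (\<lambda>v. norm (sin (of_real pi * v)) > norm (sin (of_real pi * v0)) / 2) (at v0)"
    using s0 by (intro order_tendstoD(1)[OF isContD]) auto
  then obtain d where d: "d > 0" "\<And>v. dist v v0 < d \<Longrightarrow> norm (sin (of_real pi * v)) > norm (sin (of_real pi * v0)) / 2"
    unfolding eventually_at using s0 by (metis (no_types, lifting) UNIV_I field_sum_of_halves less_add_same_cancel1 zero_less_divide_iff zero_less_numeral)
  obtain R :: nat where R: "norm v0 + d \<le> real R" by (metis real_arch_simple)
  obtain C where C: "C > 0" "\<And>v m. norm v \<le> real R \<Longrightarrow> norm (rGamma (1 - v - of_int m :: complex)) \<le> C * 2 ^ nat \<bar>m\<bar> * gfact m"
    using norm_rGamma_le by blast
  define c where "c = norm (sin (of_real pi * v0)) / 2"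
  have c: "c > 0" using s0 by (simp add: c_def)
  show ?thesis
  proof (rule that[of d "pi / c * C"])
    fix v :: complex and m :: int
    assume v: "dist v v0 < d"
    have sin: "norm (sin (of_real pi * v)) > c" using d(2)[OF v] by (simp add: c_def)
    have vm: "norm (sin (of_real pi * (v + of_int m))) = norm (sin (of_real pi * v))"
    proof -
      have "sin (of_real pi * (v + of_int m)) = sin (of_real pi * v) * cos (of_int m * of_real pi) + cos (of_real pi * v) * sin (of_int m * of_real pi)"
        by (simp add: distrib_left sin_add mult.commute)
      moreover have sin0: "sin (of_int m * complex_of_real pi) = 0"
        using sin_eq_0 by auto
      moreover have "norm (cos (of_int m * complex_of_real pi)) = 1"
      proof -
        have "(cos (of_int m * complex_of_real pi))\<^sup>2 = 1"
          using sin_cos_squared_add[of "of_int m * complex_of_real pi"] sin0 by simp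
        then have "(norm (cos (of_int m * complex_of_real pi)))\<^sup>2 = 1"
          by (metis norm_one norm_power)
        then show ?thesis using norm_ge_zero by (smt (verit) power2_eq_1_iff)
      qed
      ultimately show ?thesis by (simp add: norm_mult)
    qed
    have ni: "v + of_int m \<notin> \<int>"
    proof
      assume "v + of_int m \<in> \<int>"
      then obtain k where k: "v + of_int m = of_int k" by (rule Ints_cases)
      have "sin (of_real pi * (v + of_int m)) = 0"
        unfolding k sin_eq_0 by (rule exI[of _ k]) simp
      then show False using vm sin c by simp
    qed
    have nn: "norm v \<le> real R"
      using v R norm_triangle_ineq2[of v v0] by (simp add: dist_norm)
    have "rGamma (v + of_int m) * rGamma (1 - (v + of_int m)) = sin (of_real pi * (v + of_int m)) / of_real pi"
      by (rule rGamma_reflection_complex)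
    moreover have "rGamma (v + of_int m) \<noteq> 0" using ni by (auto simp: rGamma_eq_zero_iff)
    ultimately have "Gamma (v + of_int m) = of_real pi / sin (of_real pi * (v + of_int m)) * rGamma (1 - v - of_int m)"
      using sin c vm by (auto simp: Gamma_def field_simps diff_diff_eq)
    then have "norm (Gamma (v + of_int m)) = pi / norm (sin (of_real pi * v)) * norm (rGamma (1 - v - of_int m))"
      by (simp add: norm_mult norm_divide vm)
    also have "\<dots> \<le> pi / c * (C * 2 ^ nat \<bar>m\<bar> * gfact m)"
      using sin c C(2)[OF nn, of m] order.strict_trans[OF c sin]
      by (intro mult_mono divide_left_mono mult_pos_pos) auto
    finally show "v + of_int m \<notin> \<int>\<^sub>\<le>\<^sub>0 \<and> norm (Gamma (v + of_int m)) \<le> pi / c * C * 2 ^ nat \<bar>m\<bar> * gfact m"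
      using ni by (auto simp: mult_ac)
  qed (use d c C in auto)
next
  case True
  then obtain n where n: "v0 = of_int n" by (auto elim: Ints_cases)
  \<comment> \<open>Chosen so that v0 + m is at most N + m for m >= 0 and at most N for negative m,
    where |m| is at most N as well.\<close>
  define N where "N = nat \<bar>n\<bar> + 1"
  have nonpole: "1 + e \<notin> \<int>\<^sub>\<le>\<^sub>0" if "norm e \<le> 1/2" for e :: complex
  proof -
    have "\<bar>Re e\<bar> \<le> 1/2" using abs_Re_le_cmod[of e] that by simp
    then have "Re (1 + e) > 0" by simp
    then show ?thesis by (rule Re_pos_not_nonpos_Int)
  qed
  have "continuous_on (cball 0 (1/2)) (\<lambda>e. Gamma (1 + e :: complex))"
  proof (rule continuous_on_compose2[OF continuous_on_Gamma[of "- \<int>\<^sub>\<le>\<^sub>0"]])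
    show "(\<lambda>e. 1 + e) ` cball 0 (1/2) \<subseteq> - (\<int>\<^sub>\<le>\<^sub>0 :: complex set)"
    proof (rule image_subsetI)
      fix e :: complex assume "e \<in> cball 0 (1/2)"
      then show "1 + e \<in> - \<int>\<^sub>\<le>\<^sub>0" using nonpole[of e] by (simp add: mem_cball_0)
    qed
  qed (auto intro!: continuous_intros)
  then have "bounded ((\<lambda>e. Gamma (1 + e :: complex)) ` cball 0 (1/2))"
    by (intro compact_imp_bounded compact_continuous_image) auto
  then obtain B where B: "B > 0" "\<And>e. norm e \<le> 1/2 \<Longrightarrow> norm (Gamma (1 + e :: complex)) \<le> B"
    by (auto simp: bounded_pos)
  show ?thesis
  proof (rule that[of "1/2" "B * (2 ^ N * fact N * fact N)"])
    fix v :: complex and m :: int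
    assume v: "dist v v0 < 1/2" and vm: "v0 + of_int m \<notin> \<int>\<^sub>\<le>\<^sub>0"
    define e where "e = v - v0"
    have e: "norm e \<le> 1/2" using v by (simp add: e_def dist_norm)
    have "n + m > 0" using vm unfolding n by (metis nonpos_Ints_of_int not_le of_int_add)
    \<comment> \<open>Nonnegative because the excluded poles leave only n + m > 0.\<close>
    define i where "i = nat (n + m - 1)"
    have i: "v + of_int m = (1 + e) + of_nat i" using \<open>n + m > 0\<close> by (simp add: e_def n i_def of_nat_nat)
    have "\<bar>Re e\<bar> \<le> 1/2" using e abs_Re_le_cmod[of e] by simp
    then have re: "Re (1 + e) > 0" "Re (v + of_int m) > 0" unfolding i by simp_all
    have p: "norm (pochhammer (1 + e) i) \<le> fact (Suc i)"
    proof -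
      have "norm (pochhammer (1 + e) i) = (\<Prod>l<i. norm (1 + e + of_nat l))"
        by (simp add: pochhammer_prod prod_norm atLeast0LessThan)
      also have "\<dots> \<le> (\<Prod>l<i. 2 + real l)"
      proof (intro prod_mono conjI)
        fix l
        have "norm (1 + e + of_nat l) \<le> norm e + norm (of_nat (Suc l) :: complex)"
          using norm_triangle_ineq[of e "of_nat (Suc l)"] by (simp add: add_ac)
        then show "norm (1 + e + of_nat l) \<le> 2 + real l" using e by (simp only: norm_of_nat)
      qed auto
      also have "\<dots> = fact (Suc i)"
        by (induction i) (simp_all add: algebra_simps)
      finally show ?thesis .
    qed
    have "norm (Gamma (v + of_int m)) = norm (pochhammer (1 + e) i) * norm (Gamma (1 + e))"
      unfolding i Gamma_plus_of_nat[OF re(1)] by (rule norm_mult)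
    also have "\<dots> \<le> fact (Suc i) * B"
      using p B(2)[OF e] by (intro mult_mono) auto
    also have "fact (Suc i) \<le> (2 ^ N * fact N * fact N) * (2 ^ nat \<bar>m\<bar> * gfact m)"
    proof (cases "m \<ge> 0")
      case True
      have "Suc i \<le> N + nat m" using True \<open>n + m > 0\<close> by (simp add: i_def N_def)
      then have "(fact (Suc i) :: real) \<le> fact (N + nat m)" by (rule fact_mono)
      also have "\<dots> \<le> 2 ^ (N + nat m) * fact N * fact (nat m)" by (rule fact_add_le)
      also have "\<dots> \<le> 2 ^ (N + nat m) * fact N * fact (nat m) * fact N" by simp
      finally show ?thesis using True by (simp add: gfact_def power_add mult_ac)
    next
      case False
      have "Suc i \<le> N" using False \<open>n + m > 0\<close> by (simp add: i_def N_def)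
      then have fN: "(fact (Suc i) :: real) \<le> fact N * 1" by (simp add: fact_mono del: fact_Suc)
      have "nat (- m) \<le> N" using False \<open>n + m > 0\<close> by (simp add: N_def)
      then have "(1::real) \<le> fact N * gfact m"
        using False fact_mono[of "nat (- m)" N, where 'a = real] by (simp add: gfact_def field_simps)
      then have "fact N * (1::real) \<le> fact N * (fact N * gfact m)" by (intro mult_left_mono) auto
      note order.trans[OF fN this]
      also have "\<dots> \<le> (fact N * (fact N * gfact m)) * (2 ^ N * 2 ^ nat \<bar>m\<bar>)"
        using gfact_pos[of m] by (simp add: mult_left_le power_add[symmetric])
      finally show ?thesis by (simp add: mult_ac)
    qed
    finally show "v + of_int m \<notin> \<int>\<^sub>\<le>\<^sub>0 \<and> norm (Gamma (v + of_int m)) \<le> B * (2 ^ N * fact N * fact N) * 2 ^ nat \<bar>m\<bar> * gfact m"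
      using Re_pos_not_nonpos_Int[OF re(2)] B(1) by (simp add: mult_ac)
  qed (use B in auto)
qed

section \<open>The region of convergence\<close>

lemma fact_sum_le:
  fixes f :: "'a \<Rightarrow> nat"
  assumes "finite I"
  shows "fact (\<Sum>i\<in>I. f i) \<le> ((2 ^ card I) ^ (\<Sum>i\<in>I. f i) * (\<Prod>i\<in>I. fact (f i)) :: real)"
  using assms
proof (induction I)
  case (insert x I)
  let ?S = "\<Sum>i\<in>I. f i"
  have "fact (f x + ?S) \<le> (2 ^ (f x + ?S) * fact (f x) * fact ?S :: real)" by (rule fact_add_le)
  also have "\<dots> \<le> 2 ^ (f x + ?S) * fact (f x) * ((2 ^ card I) ^ ?S * (\<Prod>i\<in>I. fact (f i)))"
    by (intro mult_left_mono insert.IH) auto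
  also have "\<dots> \<le> 2 ^ (f x + ?S) * fact (f x) * ((2 ^ card I) ^ (f x + ?S) * (\<Prod>i\<in>I. fact (f i)))"
    by (intro mult_left_mono mult_right_mono power_increasing prod_nonneg) auto
  also have "\<dots> = (2 ^ card (insert x I)) ^ (\<Sum>i\<in>insert x I. f i) * (\<Prod>i\<in>insert x I. fact (f i))"
    using insert.hyps by (simp add: power_mult_distrib)
  finally show ?case using insert.hyps by simp
qed simp

lemma prod_fact_le:
  fixes f :: "'a \<Rightarrow> nat"
  assumes "finite I"
  shows "(\<Prod>i\<in>I. fact (f i)) \<le> (fact (\<Sum>i\<in>I. f i) :: real)"
  using assms
proof (induction I)
  case (insert x I)
  have "real (fact (f x) * fact (\<Sum>i\<in>I. f i)) \<le> real (fact (f x + (\<Sum>i\<in>I. f i)))"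
    by (subst of_nat_le_iff) (intro dvd_imp_le fact_fact_dvd_fact; simp)
  then have *: "fact (f x) * fact (\<Sum>i\<in>I. f i) \<le> (fact (f x + (\<Sum>i\<in>I. f i)) :: real)" by simp
  have "fact (f x) * (\<Prod>i\<in>I. fact (f i)) \<le> (fact (f x) * fact (\<Sum>i\<in>I. f i) :: real)"
    by (intro mult_left_mono insert.IH) auto
  from order.trans[OF this *] show ?case using insert.hyps by simp
qed simp

text \<open>Let P and Q be the sums of the positive and of the negative parts, so that P = Q + L.
  The numerators multiply to at most (Q + L)!, hence to at most 2^(Q+L) Q! L!, and these two
  factorials split over the denominators at geometric cost.\<close>

lemma prod_gfact_le:
  fixes m :: "'a \<Rightarrow> int" and l :: "'b \<Rightarrow> nat"
  assumes fin: "finite I" "finite K" and sum: "(\<Sum>j\<in>I. m j) = (\<Sum>k\<in>K. int (l k))"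
  shows "(\<Prod>j\<in>I. gfact (m j)) / (\<Prod>k\<in>K. fact (l k))
     \<le> (2 ^ (1 + card I + card K)) ^ (nat (\<Sum>j\<in>I. \<bar>m j\<bar>) + (\<Sum>k\<in>K. l k))"
proof -
  define P where "P = (\<Sum>j\<in>I. nat (m j))"
  define Q where "Q = (\<Sum>j\<in>I. nat (- m j))"
  define L where "L = (\<Sum>k\<in>K. l k)"
  have "int P - int Q = (\<Sum>j\<in>I. int (nat (m j)) - int (nat (- m j)))" by (simp add: P_def Q_def sum_subtractf)
  also have "\<dots> = (\<Sum>j\<in>I. m j)" by (intro sum.cong) auto
  finally have "int P - int Q = int L" using sum by (simp add: L_def)
  then have PQ: "P = Q + L" by linarith
  have "int (P + Q) = (\<Sum>j\<in>I. int (nat (m j)) + int (nat (- m j)))" by (simp add: P_def Q_def sum.distrib)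
  also have "\<dots> = (\<Sum>j\<in>I. \<bar>m j\<bar>)" by (intro sum.cong) auto
  finally have abs: "nat (\<Sum>j\<in>I. \<bar>m j\<bar>) = P + Q" by linarith
  have g: "gfact (m j) = fact (nat (m j)) / fact (nat (- m j))" for j by (simp add: gfact_def)
  define qf where "qf = (\<Prod>j\<in>I. fact (nat (- m j)) :: real)"
  define lf where "lf = (\<Prod>k\<in>K. fact (l k) :: real)"
  have pos: "qf > 0" "lf > 0" by (auto simp: qf_def lf_def intro: prod_pos)
  have Qf: "fact Q \<le> (2 ^ card I) ^ Q * qf" unfolding Q_def qf_def by (rule fact_sum_le[OF fin(1)])
  have Lf: "fact L \<le> (2 ^ card K) ^ L * lf" unfolding L_def lf_def by (rule fact_sum_le[OF fin(2)])
  have "(\<Prod>j\<in>I. fact (nat (m j)) :: real) \<le> fact (Q + L)"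
    using prod_fact_le[OF fin(1), of "\<lambda>j. nat (m j)"] by (simp add: P_def[symmetric] PQ)
  also have "\<dots> \<le> 2 ^ (Q + L) * fact Q * fact L" by (rule fact_add_le)
  also have "\<dots> \<le> 2 ^ (Q + L) * ((2 ^ card I) ^ Q * qf) * ((2 ^ card K) ^ L * lf)"
    by (intro mult_mono Qf Lf) (use pos in auto)
  finally have "(\<Prod>j\<in>I. gfact (m j)) / (\<Prod>k\<in>K. fact (l k)) \<le> 2 ^ (Q + L) * (2 ^ card I) ^ Q * (2 ^ card K) ^ L"
    using pos by (simp add: g prod_dividef qf_def[symmetric] lf_def[symmetric] divide_le_eq mult_ac)
  also have "\<dots> \<le> 2 ^ (P + Q + L) * (2 ^ card I) ^ (P + Q + L) * (2 ^ card K) ^ (P + Q + L)"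
    by (intro mult_mono power_increasing) auto
  also have "\<dots> = (2 ^ (1 + card I + card K)) ^ (nat (\<Sum>j\<in>I. \<bar>m j\<bar>) + (\<Sum>k\<in>K. l k))"
    by (simp add: abs L_def power_mult_distrib power_add mult_ac)
  finally show ?thesis .
qed

definition kap :: "('j::finite \<Rightarrow> nat^'n::finite) \<Rightarrow> 'j set \<Rightarrow> nat" where
  "kap a \<sigma> = nat (\<Sum>j\<in>\<sigma>. \<Sum>k\<in>UNIV. \<bar>mu a \<sigma> j k\<bar>)"

lemma sum_abs_mm_le: "nat (\<Sum>j\<in>\<sigma>. \<bar>mm a \<sigma> l j\<bar>) \<le> kap a \<sigma> * (\<Sum>k\<in>-\<sigma>. l k)"
proof -
  have "\<bar>mm a \<sigma> l j\<bar> \<le> (\<Sum>k\<in>UNIV. \<bar>mu a \<sigma> j k\<bar>) * (\<Sum>k\<in>-\<sigma>. int (l k))" for j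
  proof -
    have "\<bar>mm a \<sigma> l j\<bar> \<le> (\<Sum>k\<in>-\<sigma>. \<bar>int (l k) * mu a \<sigma> j k\<bar>)"
      unfolding mm_def by (rule sum_abs)
    also have "\<dots> \<le> (\<Sum>k\<in>-\<sigma>. int (l k) * (\<Sum>k\<in>UNIV. \<bar>mu a \<sigma> j k\<bar>))"
      by (intro sum_mono) (auto simp: abs_mult intro!: mult_left_mono member_le_sum)
    finally show ?thesis by (simp add: sum_distrib_right mult.commute)
  qed
  then have "(\<Sum>j\<in>\<sigma>. \<bar>mm a \<sigma> l j\<bar>) \<le> (\<Sum>j\<in>\<sigma>. (\<Sum>k\<in>UNIV. \<bar>mu a \<sigma> j k\<bar>) * (\<Sum>k\<in>-\<sigma>. int (l k)))"
    by (intro sum_mono)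
  also have "\<dots> = int (kap a \<sigma> * (\<Sum>k\<in>-\<sigma>. l k))"
    by (simp add: kap_def sum_distrib_right sum_nonneg)
  finally show ?thesis by linarith
qed

text \<open>The modulus of z_k z_sigma^(-A_sigma^(-1) A_k), the variable attached to k in the Gamma
  series of sigma.\<close>

definition rho :: "('j::finite \<Rightarrow> nat^'n::finite) \<Rightarrow> 'j set \<Rightarrow> complex^'j \<Rightarrow> 'j \<Rightarrow> real" where
  "rho a \<sigma> z k = norm (z $ k) * (\<Prod>j\<in>\<sigma>. norm (z $ j) powr (- of_int (mu a \<sigma> j k)))"

text \<open>The 8 collects a factor 2 per unit of each shift |m_j| from three sources: the tail
  power of |z| / Re z, the exchange of Re z for |z|, and the Gamma bound. The other base is that of
  \<open>prod_gfact_le\<close>. The exponents arise from bounding the sum of the |m_j| by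
  \<open>kap\<close> times |lambda|.\<close>

definition rho_const :: "('j::finite \<Rightarrow> nat^'n::finite) \<Rightarrow> 'j set \<Rightarrow> real" where
  "rho_const a \<sigma> = 8 ^ kap a \<sigma> * (2 ^ (1 + card \<sigma> + card (- \<sigma>))) ^ (kap a \<sigma> + 1)"

text \<open>The first condition bounds the arguments of the \<open>z\<^sub>j\<close>, so that the powers of \<open>\<bar>z\<^sub>j\<bar> / Re z\<^sub>j\<close> in the
  Cauchy--Saalschuetz bound grow at most geometrically.\<close>

definition conv_region :: "('j::finite \<Rightarrow> nat^'n::finite) \<Rightarrow> 'j set set \<Rightarrow> (complex^'j) set" where
  "conv_region a T = {z. (\<forall>j. norm (z $ j) < 2 * Re (z $ j)) \<and>
      (\<forall>\<sigma>\<in>T. \<forall>k\<in>-\<sigma>. rho_const a \<sigma> * rho a \<sigma> z k < 1 / 2)}"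

text \<open>A majorant free of nu: up to a factor independent of lambda it dominates
  \<open>gamma_bound\<close>, the terms of the Gamma series, and their regularised versions.\<close>

definition hyp_bound :: "('j::finite \<Rightarrow> nat^'n::finite) \<Rightarrow> 'j set \<Rightarrow> complex^'j \<Rightarrow> ('j \<Rightarrow> nat) \<Rightarrow> real" where
  "hyp_bound a \<sigma> z l = (\<Prod>k\<in>-\<sigma>. norm (z $ k) ^ l k / fact (l k)) *
     (\<Prod>j\<in>\<sigma>. 8 ^ nat \<bar>mm a \<sigma> l j\<bar> * gfact (mm a \<sigma> l j) * norm (z $ j) powr (- of_int (mm a \<sigma> l j)))"

lemma conv_region_Re_pos: "z \<in> conv_region a T \<Longrightarrow> 0 < Re (z $ j)"
  unfolding conv_region_def using norm_ge_zero[of "z $ j"] by (smt (verit) mem_Collect_eq)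

lemma hyp_bound_nonneg: "0 \<le> hyp_bound a \<sigma> z l"
  unfolding hyp_bound_def using gfact_pos
  by (intro mult_nonneg_nonneg prod_nonneg) (auto intro!: mult_nonneg_nonneg less_imp_le[OF gfact_pos])

lemma hyp_bound_le:
  fixes a :: "'j::finite \<Rightarrow> nat^'n::finite"
  assumes \<sigma>: "unimodular_simplex a \<sigma>" and z: "\<And>j. z $ j \<noteq> 0"
  shows "hyp_bound a \<sigma> z l \<le> (\<Prod>k\<in>-\<sigma>. (rho_const a \<sigma> * rho a \<sigma> z k) ^ l k)"
proof -
  define L where "L = (\<Sum>k\<in>-\<sigma>. l k)"
  let ?E = "2 ^ (1 + card \<sigma> + card (- \<sigma>)) :: real"
  have zp: "norm (z $ j) > 0" for j using z by simp
  have r: "(\<Prod>k\<in>-\<sigma>. rho a \<sigma> z k ^ l k) = (\<Prod>k\<in>-\<sigma>. norm (z $ k) ^ l k) * (\<Prod>j\<in>\<sigma>. norm (z $ j) powr (- of_int (mm a \<sigma> l j)))"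
  proof -
    have pw: "(norm (z $ j) powr b) ^ i = norm (z $ j) powr (of_nat i * b)" for j b i
      using zp[of j] by (induction i) (simp_all add: powr_add[symmetric] distrib_right)
    have "(\<Prod>k\<in>-\<sigma>. rho a \<sigma> z k ^ l k) = (\<Prod>k\<in>-\<sigma>. norm (z $ k) ^ l k) *
       (\<Prod>k\<in>-\<sigma>. \<Prod>j\<in>\<sigma>. norm (z $ j) powr (- (of_nat (l k) * of_int (mu a \<sigma> j k))))"
      by (simp add: rho_def power_mult_distrib prod.distrib prod_power_distrib pw)
    also have "(\<Prod>k\<in>-\<sigma>. \<Prod>j\<in>\<sigma>. norm (z $ j) powr (- (of_nat (l k) * of_int (mu a \<sigma> j k))))
      = (\<Prod>j\<in>\<sigma>. \<Prod>k\<in>-\<sigma>. norm (z $ j) powr (- (of_nat (l k) * of_int (mu a \<sigma> j k))))"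
      by (rule prod.swap)
    also have "\<dots> = (\<Prod>j\<in>\<sigma>. norm (z $ j) powr (- of_int (mm a \<sigma> l j)))"
      by (intro prod.cong refl) (use z in \<open>simp add: mm_def powr_sum sum_negf[symmetric]\<close>)
    finally show ?thesis .
  qed
  have n8: "(\<Prod>j\<in>\<sigma>. 8 ^ nat \<bar>mm a \<sigma> l j\<bar> :: real) \<le> 8 ^ (kap a \<sigma> * L)"
  proof -
    have "int (\<Sum>j\<in>\<sigma>. nat \<bar>mm a \<sigma> l j\<bar>) = (\<Sum>j\<in>\<sigma>. \<bar>mm a \<sigma> l j\<bar>)" by simp
    then have "nat (\<Sum>j\<in>\<sigma>. \<bar>mm a \<sigma> l j\<bar>) = (\<Sum>j\<in>\<sigma>. nat \<bar>mm a \<sigma> l j\<bar>)" by (metis nat_int)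
    then have "(\<Prod>j\<in>\<sigma>. 8 ^ nat \<bar>mm a \<sigma> l j\<bar> :: real) = 8 ^ nat (\<Sum>j\<in>\<sigma>. \<bar>mm a \<sigma> l j\<bar>)"
      by (simp add: power_sum)
    also have "\<dots> \<le> 8 ^ (kap a \<sigma> * L)"
      using sum_abs_mm_le[of a \<sigma> l] by (intro power_increasing) (auto simp: L_def)
    finally show ?thesis .
  qed
  have gf: "(\<Prod>j\<in>\<sigma>. gfact (mm a \<sigma> l j)) / (\<Prod>k\<in>-\<sigma>. fact (l k)) \<le> ?E ^ ((kap a \<sigma> + 1) * L)"
  proof -
    have "(\<Prod>j\<in>\<sigma>. gfact (mm a \<sigma> l j)) / (\<Prod>k\<in>-\<sigma>. fact (l k)) \<le> ?E ^ (nat (\<Sum>j\<in>\<sigma>. \<bar>mm a \<sigma> l j\<bar>) + L)"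
      unfolding L_def by (rule prod_gfact_le) (auto simp: sum_mm[OF \<sigma>])
    also have "\<dots> \<le> ?E ^ ((kap a \<sigma> + 1) * L)"
      using sum_abs_mm_le[of a \<sigma> l] by (intro power_increasing one_le_power) (auto simp: L_def)
    finally show ?thesis .
  qed
  have "hyp_bound a \<sigma> z l = (\<Prod>j\<in>\<sigma>. 8 ^ nat \<bar>mm a \<sigma> l j\<bar>) * ((\<Prod>j\<in>\<sigma>. gfact (mm a \<sigma> l j)) / (\<Prod>k\<in>-\<sigma>. fact (l k))) * (\<Prod>k\<in>-\<sigma>. rho a \<sigma> z k ^ l k)"
    unfolding hyp_bound_def r by (simp add: prod.distrib prod_dividef mult_ac)
  also have "\<dots> \<le> 8 ^ (kap a \<sigma> * L) * ?E ^ ((kap a \<sigma> + 1) * L) * (\<Prod>k\<in>-\<sigma>. rho a \<sigma> z k ^ l k)"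
    by (intro mult_right_mono mult_mono n8 gf)
       (auto simp: rho_def intro!: prod_nonneg divide_nonneg_nonneg mult_nonneg_nonneg zero_le_power less_imp_le[OF gfact_pos])
  also have "\<dots> = rho_const a \<sigma> ^ L * (\<Prod>k\<in>-\<sigma>. rho a \<sigma> z k ^ l k)"
    unfolding rho_const_def power_mult_distrib by (simp only: power_mult[symmetric] mult.assoc)
  also have "\<dots> = (\<Prod>k\<in>-\<sigma>. (rho_const a \<sigma> * rho a \<sigma> z k) ^ l k)"
    by (simp add: L_def power_sum power_mult_distrib prod.distrib)
  finally show ?thesis .
qed

text \<open>The second condition of \<open>conv_region\<close> turns \<open>hyp_bound_le\<close>
  into the bound (1/2)^|lambda|, a product of geometric series.\<close>

lemma hyp_bound_summable:
  fixes a :: "'j::finite \<Rightarrow> nat^'n::finite"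
  assumes \<sigma>: "unimodular_simplex a \<sigma>" "\<sigma> \<in> T" and z: "z \<in> conv_region a T"
  shows "hyp_bound a \<sigma> z summable_on lambdas \<sigma>"
proof -
  have z0: "z $ j \<noteq> 0" for j using conv_region_Re_pos[OF z, of j] by auto
  have "summable (\<lambda>i. (1/2::real) ^ i)" by (simp add: summable_geometric)
  then have geo: "(\<lambda>i. norm ((1/2::complex) ^ i)) summable_on UNIV"
    by (intro norm_summable_imp_summable_on) (simp add: norm_power)
  have "(\<lambda>l. norm (\<Prod>j\<in>UNIV. (1/2::complex) ^ l j)) summable_on (lambdas \<sigma> :: ('j \<Rightarrow> nat) set)"
    by (rule summable_on_subset_banach[OF summable_on_nat_prod(1)[OF geo]]) simp
  then show ?thesis
  proof (rule summable_on_comparison_test)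
    fix l :: "'j \<Rightarrow> nat" assume l: "l \<in> lambdas \<sigma>"
    have rc: "0 \<le> rho_const a \<sigma> * rho a \<sigma> z k" for k
      by (auto simp: rho_const_def rho_def intro!: mult_nonneg_nonneg prod_nonneg)
    have "hyp_bound a \<sigma> z l \<le> (\<Prod>k\<in>-\<sigma>. (rho_const a \<sigma> * rho a \<sigma> z k) ^ l k)"
      by (rule hyp_bound_le[OF \<sigma>(1) z0])
    also have "\<dots> \<le> (\<Prod>k\<in>-\<sigma>. (1/2) ^ l k)"
      using z \<sigma>(2) rc by (intro prod_mono conjI power_mono) (auto simp: conv_region_def less_imp_le)
    also have "\<dots> = (\<Prod>k\<in>UNIV. (1/2) ^ l k)"
      using l by (intro prod.mono_neutral_left) (auto simp: lambdas_def)
    also have "\<dots> = norm (\<Prod>j\<in>UNIV. (1/2::complex) ^ l j)" by (simp add: norm_power prod_norm[symmetric])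
    finally show "hyp_bound a \<sigma> z l \<le> norm (\<Prod>j\<in>UNIV. (1/2::complex) ^ l j)" .
  qed (rule hyp_bound_nonneg)
qed

text \<open>Continuity of \<open>rho\<close> requires nonzero z_j, so the first condition is treated
  as an open set of its own and the second relative to it.\<close>

lemma open_conv_region:
  fixes a :: "'j::finite \<Rightarrow> nat^'n::finite"
  shows "open (conv_region a T)"
proof -
  define H where "H = {z::complex^'j. \<forall>j. norm (z $ j) < 2 * Re (z $ j)}"
  have "open H"
  proof -
    have "H = (\<Inter>j\<in>UNIV. {z. norm (z $ j) < 2 * Re (z $ j)})" by (auto simp: H_def)
    also have "open \<dots>" by (intro open_INT open_Collect_less continuous_intros ballI) auto
    finally show ?thesis .
  qed
  have nz: "z $ j \<noteq> 0" if "z \<in> H" for z j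
    using that unfolding H_def by (auto dest: spec[of _ j])
  have cont: "continuous_on H (\<lambda>z. rho_const a \<sigma> * rho a \<sigma> z k)" for \<sigma> k
    unfolding rho_def by (intro continuous_intros) (use nz in auto)
  have "open (H \<inter> (\<Inter>\<sigma>\<in>T. \<Inter>k\<in>-\<sigma>. {z\<in>H. rho_const a \<sigma> * rho a \<sigma> z k < 1/2}))"
  proof (intro open_Int open_INT ballI \<open>open H\<close>)
    fix \<sigma> k
    have "{z\<in>H. rho_const a \<sigma> * rho a \<sigma> z k < 1/2} = H \<inter> (\<lambda>z. rho_const a \<sigma> * rho a \<sigma> z k) -` {..<1/2}" by auto
    then show "open {z\<in>H. rho_const a \<sigma> * rho a \<sigma> z k < 1/2}"
      using continuous_open_preimage[OF cont \<open>open H\<close> open_lessThan] by simp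
  qed (auto intro: finite)
  moreover have "H \<inter> (\<Inter>\<sigma>\<in>T. \<Inter>k\<in>-\<sigma>. {z\<in>H. rho_const a \<sigma> * rho a \<sigma> z k < 1/2}) = conv_region a T"
    by (auto simp: conv_region_def H_def)
  ultimately show ?thesis by simp
qed

text \<open>The witness is z_j = exp(-t omega_j) for large t, with the height function omega of the
  regular triangulation.\<close>

lemma conv_region_nonempty:
  fixes a :: "'j::finite \<Rightarrow> nat^'n::finite"
  assumes T: "regular_unimodular_triangulation a T"
  shows "conv_region a T \<noteq> {}"
proof -
  obtain \<omega> where \<omega>: "\<And>\<sigma>. \<sigma> \<in> T \<Longrightarrow> \<exists>r0 r. (\<forall>j\<in>\<sigma>. r0 + r \<bullet> pt a j = \<omega> j) \<and> (\<forall>j. j \<notin> \<sigma> \<longrightarrow> r0 + r \<bullet> pt a j < \<omega> j)"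
    using T unfolding regular_unimodular_triangulation_def by metis
  define z where "z t = (\<chi> j. complex_of_real (exp (- t * \<omega> j)))" for t
  have lim: "\<forall>\<^sub>F t in at_top. rho_const a \<sigma> * rho a \<sigma> (z t) k < 1/2" if \<sigma>: "\<sigma> \<in> T" and k: "k \<in> -\<sigma>" for \<sigma> k
  proof -
    have us: "unimodular_simplex a \<sigma>" by (rule triangulation_simplex[OF T \<sigma>])
    obtain r0 r where r: "\<And>j. j \<in> \<sigma> \<Longrightarrow> r0 + r \<bullet> pt a j = \<omega> j" "\<And>j. j \<notin> \<sigma> \<Longrightarrow> r0 + r \<bullet> pt a j < \<omega> j"
      using \<omega>[OF \<sigma>] by metis
    \<comment> \<open>The height of omega at k above the affine extension of omega from sigma.
      Regularity makes it positive, and at the witness \<open>rho\<close> equals exp(-t g).\<close>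
    define g where "g = \<omega> k - (\<Sum>j\<in>\<sigma>. of_int (mu a \<sigma> j k) * \<omega> j)"
    have "(\<Sum>j\<in>\<sigma>. of_int (mu a \<sigma> j k) * \<omega> j) = (\<Sum>j\<in>\<sigma>. of_int (mu a \<sigma> j k) * (r0 + r \<bullet> pt a j))"
      using r(1) by simp
    also have "\<dots> = r0 * of_int (\<Sum>j\<in>\<sigma>. mu a \<sigma> j k) + (\<Sum>j\<in>\<sigma>. of_int (mu a \<sigma> j k) * (r \<bullet> pt a j))"
      by (simp add: distrib_left sum.distrib sum_distrib_left mult.commute)
    also have "(\<Sum>j\<in>\<sigma>. of_int (mu a \<sigma> j k) * (r \<bullet> pt a j)) = r \<bullet> pt a k"
    proof -
      have "pt a k $ i = (\<Sum>j\<in>\<sigma>. of_int (mu a \<sigma> j k) * pt a j $ i)" for i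
      proof -
        have "int (a k $ i) = (\<Sum>j\<in>\<sigma>. mu a \<sigma> j k * int (a j $ i))"
          using Acol_eq_sum_mu[OF us, of k "Some i"] by (simp add: Acol_def)
        then have "real_of_int (int (a k $ i)) = of_int (\<Sum>j\<in>\<sigma>. mu a \<sigma> j k * int (a j $ i))" by (rule arg_cong)
        then show ?thesis by (simp add: pt_def)
      qed
      then have "pt a k = (\<Sum>j\<in>\<sigma>. of_int (mu a \<sigma> j k) *\<^sub>R pt a j)" by (simp add: vec_eq_iff)
      then show ?thesis by (simp add: inner_sum_right)
    qed
    also have "(\<Sum>j\<in>\<sigma>. mu a \<sigma> j k) = 1" by (rule sum_mu[OF us])
    finally have g: "g > 0" using r(2)[of k] k by (simp add: g_def)
    have "rho a \<sigma> (z t) k = exp (- t * g)" for t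
    proof -
      have "rho a \<sigma> (z t) k = exp (- t * \<omega> k) * (\<Prod>j\<in>\<sigma>. exp (- of_int (mu a \<sigma> j k) * (- t * \<omega> j)))"
        by (simp add: rho_def z_def powr_def)
      also have "\<dots> = exp (- t * \<omega> k + (\<Sum>j\<in>\<sigma>. - of_int (mu a \<sigma> j k) * (- t * \<omega> j)))"
        unfolding exp_add by (simp add: exp_sum)
      also have "- t * \<omega> k + (\<Sum>j\<in>\<sigma>. - of_int (mu a \<sigma> j k) * (- t * \<omega> j)) = - t * g"
        by (simp add: g_def algebra_simps sum_distrib_left sum_negf)
      finally show ?thesis .
    qed
    moreover have "((\<lambda>t. rho_const a \<sigma> * exp (- t * g)) \<longlongrightarrow> rho_const a \<sigma> * 0) at_top"
      by (intro tendsto_mult tendsto_const) (use g in real_asymp)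
    ultimately show ?thesis by (intro order_tendstoD(2)) auto
  qed
  have "\<forall>\<^sub>F t in at_top. \<forall>\<sigma>\<in>T. \<forall>k\<in>-\<sigma>. rho_const a \<sigma> * rho a \<sigma> (z t) k < 1/2"
    by (intro eventually_ball_finite ballI lim) auto
  then obtain t where "\<forall>\<sigma>\<in>T. \<forall>k\<in>-\<sigma>. rho_const a \<sigma> * rho a \<sigma> (z t) k < 1/2"
    using eventually_happens'[OF trivial_limit_at_top_linorder] by blast
  then have "z t \<in> conv_region a T"
    by (simp add: conv_region_def z_def)
  then show ?thesis by auto
qed

section \<open>Majorants for the Gamma series\<close>

lemma prod_le_mult:
  fixes A B C :: "'a \<Rightarrow> real"
  assumes "\<And>j. j \<in> I \<Longrightarrow> 0 \<le> A j" "\<And>j. j \<in> I \<Longrightarrow> A j \<le> C j * B j"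
  shows "prod A I \<le> prod C I * prod B I"
  unfolding prod.distrib[symmetric] using assms by (intro prod_mono) auto

text \<open>Exchanges Re z for |z| in integral powers of either sign, at the cost of a factor 2 per
  unit of the exponent.\<close>

lemma powr_int_half_le:
  fixes x y :: real and m :: int
  assumes "0 < x" "x \<le> y" "y \<le> 2 * x"
  shows "x powr (- of_int m) \<le> 2 ^ nat \<bar>m\<bar> * y powr (- of_int m)"
proof (cases "m \<ge> 0")
  case True
  have "x powr (- of_int m) \<le> (y / 2) powr (- of_int m)"
    by (rule powr_mono2') (use assms True in auto)
  also have "\<dots> = 2 powr of_int m * y powr (- of_int m)"
  proof -
    have "(y / 2) powr (- of_int m) = y powr (- of_int m) / 2 powr (- of_int m)"
      by (rule powr_divide)
    also have "2 powr (- of_int m) = inverse (2 powr real_of_int m)" by (rule powr_minus)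
    finally show ?thesis by (simp only: divide_inverse inverse_inverse_eq mult.commute)
  qed
  also have "2 powr real_of_int m = (2::real) ^ nat \<bar>m\<bar>"
    using powr_realpow[of 2 "nat \<bar>m\<bar>"] True by simp
  finally show ?thesis .
next
  case False
  have "x powr (- of_int m) \<le> 1 * y powr (- of_int m)"
    unfolding mult_1 by (rule powr_mono2) (use assms False in auto)
  also have "\<dots> \<le> 2 ^ nat \<bar>m\<bar> * y powr (- of_int m)"
    by (intro mult_right_mono) auto
  finally show ?thesis .
qed

lemma gamma_bound_summable:
  fixes a :: "'j::finite \<Rightarrow> nat^'n::finite"
  assumes \<sigma>: "unimodular_simplex a \<sigma>" "\<sigma> \<in> T" and z: "z \<in> conv_region a T"
    and gen: "\<And>j. j \<in> \<sigma> \<Longrightarrow> Re (Ainv a \<sigma> nu j) \<notin> \<int>"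
  shows "gamma_bound a \<sigma> nu z summable_on lambdas \<sigma>"
proof -
  define x where "x j = Re (Ainv a \<sigma> nu j)" for j
  have "\<exists>C>0. \<forall>m. \<bar>Gamma (x j + of_int m)\<bar> \<le> C * 2 ^ nat \<bar>m\<bar> * gfact m" if j: "j \<in> \<sigma>" for j
  proof -
    obtain d C where d: "d > 0" "C > 0" "\<And>v m. dist v (complex_of_real (x j)) < d \<Longrightarrow> complex_of_real (x j) + of_int m \<notin> \<int>\<^sub>\<le>\<^sub>0 \<Longrightarrow>
     v + of_int m \<notin> \<int>\<^sub>\<le>\<^sub>0 \<and> norm (Gamma (v + of_int m)) \<le> C * 2 ^ nat \<bar>m\<bar> * gfact m"
      by (rule Gamma_locally_bounded[of "of_real (x j)"]) (rule that)
    have "norm (Gamma (of_real (x j) + of_int m :: complex)) \<le> C * 2 ^ nat \<bar>m\<bar> * gfact m" for m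
    proof -
      have "(of_real (x j) :: complex) + of_int m \<notin> \<int>\<^sub>\<le>\<^sub>0"
      proof
        assume "(of_real (x j) :: complex) + of_int m \<in> \<int>\<^sub>\<le>\<^sub>0"
        then obtain n where "(of_real (x j) :: complex) + of_int m = of_int n" by (auto elim: nonpos_Ints_cases)
        then have "x j = of_int (n - m)" by (auto simp: complex_eq_iff)
        then show False using gen[OF j] by (simp add: x_def)
      qed
      then show ?thesis using d(3)[of "of_real (x j)" m] d(1) by simp
    qed
    moreover have "Gamma (of_real (x j) + of_int m :: complex) = of_real (Gamma (x j + of_int m))" for m
      using Gamma_complex_of_real[of "x j + of_int m"] by simp
    ultimately show ?thesis using d(2) by auto
  qed
  then have "\<forall>j\<in>\<sigma>. \<exists>C. C > 0 \<and> (\<forall>m. \<bar>Gamma (x j + of_int m)\<bar> \<le> C * 2 ^ nat \<bar>m\<bar> * gfact m)" by blast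
  from bchoice[OF this] obtain C where "\<forall>j\<in>\<sigma>. C j > 0 \<and> (\<forall>m. \<bar>Gamma (x j + of_int m)\<bar> \<le> C j * 2 ^ nat \<bar>m\<bar> * gfact m)" ..
  then have C: "\<And>j. j \<in> \<sigma> \<Longrightarrow> C j > 0" "\<And>j m. j \<in> \<sigma> \<Longrightarrow> \<bar>Gamma (x j + of_int m)\<bar> \<le> C j * 2 ^ nat \<bar>m\<bar> * gfact m"
    by blast+
  \<comment> \<open>All factors that do not depend on lambda: the part of the tail index due to nu,
    the power of Re z_j with exponent -x_j, and the Gamma constant.\<close>
  define C' where "C' j = 2 ^ nat \<lceil>\<bar>x j\<bar>\<rceil> * Re (z $ j) powr (- x j) * C j" for j
  have zp: "Re (z $ j) > 0" for j by (rule conv_region_Re_pos[OF z])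
  have z2: "norm (z $ j) \<le> 2 * Re (z $ j)" for j using z by (auto simp: conv_region_def less_imp_le)
  have le: "gamma_bound a \<sigma> nu z l \<le> (\<Prod>j\<in>\<sigma>. C' j) * hyp_bound a \<sigma> z l" for l
  proof -
    have "(\<Prod>j\<in>\<sigma>. (norm (z $ j) / Re (z $ j)) ^ tail_index a \<sigma> nu l j *
        (Re (z $ j) powr (- (Re (Ainv a \<sigma> nu j) + mm a \<sigma> l j)) * \<bar>Gamma (Re (Ainv a \<sigma> nu j) + mm a \<sigma> l j)\<bar>))
      \<le> (\<Prod>j\<in>\<sigma>. C' j) * (\<Prod>j\<in>\<sigma>. 8 ^ nat \<bar>mm a \<sigma> l j\<bar> * gfact (mm a \<sigma> l j) * norm (z $ j) powr (- of_int (mm a \<sigma> l j)))"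
    proof (rule prod_le_mult)
      fix j assume j: "j \<in> \<sigma>"
      let ?m = "mm a \<sigma> l j" and ?z = "z $ j"
      show "0 \<le> (norm ?z / Re ?z) ^ tail_index a \<sigma> nu l j * (Re ?z powr (- (Re (Ainv a \<sigma> nu j) + ?m)) * \<bar>Gamma (Re (Ainv a \<sigma> nu j) + ?m)\<bar>)"
        using zp[of j] by simp
      have ti: "tail_index a \<sigma> nu l j \<le> nat \<lceil>\<bar>x j\<bar>\<rceil> + nat \<bar>?m\<bar>"
      proof -
        have "- (x j + of_int ?m) \<le> \<bar>x j\<bar> + \<bar>real_of_int ?m\<bar>" by linarith
        also have "\<dots> \<le> real (nat \<lceil>\<bar>x j\<bar>\<rceil>) + real (nat \<bar>?m\<bar>)"
          by (intro add_mono real_nat_ceiling_ge) simp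
        finally have "\<lceil>- (x j + of_int ?m)\<rceil> \<le> int (nat \<lceil>\<bar>x j\<bar>\<rceil> + nat \<bar>?m\<bar>)"
          unfolding ceiling_le_iff by (simp only: of_int_of_nat_eq of_nat_add)
        then show ?thesis unfolding tail_index_def x_def nat_le_iff .
      qed
      have "(norm ?z / Re ?z) ^ tail_index a \<sigma> nu l j \<le> 2 ^ tail_index a \<sigma> nu l j"
        using zp[of j] z2[of j] by (intro power_mono) (auto simp: divide_le_eq)
      also have "\<dots> \<le> 2 ^ (nat \<lceil>\<bar>x j\<bar>\<rceil> + nat \<bar>?m\<bar>)" using ti by (intro power_increasing) auto
      finally have 1: "(norm ?z / Re ?z) ^ tail_index a \<sigma> nu l j \<le> 2 ^ nat \<lceil>\<bar>x j\<bar>\<rceil> * 2 ^ nat \<bar>?m\<bar>"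
        by (simp add: power_add)
      have "Re ?z powr (- (x j + ?m)) = Re ?z powr (- x j) * Re ?z powr (- of_int ?m)"
        using powr_add[of "Re ?z" "- x j" "- of_int ?m"] by simp
      also have "\<dots> \<le> Re ?z powr (- x j) * (2 ^ nat \<bar>?m\<bar> * norm ?z powr (- of_int ?m))"
        using zp[of j] z2[of j] complex_Re_le_cmod[of ?z] by (intro mult_left_mono powr_int_half_le) auto
      finally have 2: "Re ?z powr (- (x j + ?m)) \<le> Re ?z powr (- x j) * (2 ^ nat \<bar>?m\<bar> * norm ?z powr (- of_int ?m))" .
      have "(norm ?z / Re ?z) ^ tail_index a \<sigma> nu l j * (Re ?z powr (- (x j + ?m)) * \<bar>Gamma (x j + ?m)\<bar>)
        \<le> (2 ^ nat \<lceil>\<bar>x j\<bar>\<rceil> * 2 ^ nat \<bar>?m\<bar>) * ((Re ?z powr (- x j) * (2 ^ nat \<bar>?m\<bar> * norm ?z powr (- of_int ?m))) * (C j * 2 ^ nat \<bar>?m\<bar> * gfact ?m))"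
        using zp[of j] by (intro mult_mono 1 2 C(2)[OF j]) auto
      also have "\<dots> = C' j * ((2 ^ nat \<bar>?m\<bar> * 2 ^ nat \<bar>?m\<bar> * 2 ^ nat \<bar>?m\<bar>) * gfact ?m * norm ?z powr (- of_int ?m))"
        by (simp add: C'_def mult_ac)
      also have "(2 ^ nat \<bar>?m\<bar> * 2 ^ nat \<bar>?m\<bar> * 2 ^ nat \<bar>?m\<bar> :: real) = 8 ^ nat \<bar>?m\<bar>"
        unfolding power_mult_distrib[symmetric] by simp
      finally show "(norm ?z / Re ?z) ^ tail_index a \<sigma> nu l j * (Re ?z powr (- (Re (Ainv a \<sigma> nu j) + ?m)) * \<bar>Gamma (Re (Ainv a \<sigma> nu j) + ?m)\<bar>)
        \<le> C' j * (8 ^ nat \<bar>?m\<bar> * gfact ?m * norm ?z powr (- of_int ?m))"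
        by (simp add: x_def)
    qed
    then show ?thesis
      unfolding gamma_bound_def hyp_bound_def
      by (subst mult.left_commute) (intro mult_left_mono prod_nonneg; simp)
  qed
  have "(\<lambda>l. (\<Prod>j\<in>\<sigma>. C' j) * hyp_bound a \<sigma> z l) summable_on lambdas \<sigma>"
    by (intro summable_on_cmult_right hyp_bound_summable[OF \<sigma> z])
  then show ?thesis
  proof (rule summable_on_comparison_test)
    show "0 \<le> gamma_bound a \<sigma> nu z l" for l
      unfolding gamma_bound_def
      by (intro mult_nonneg_nonneg prod_nonneg zero_le_power divide_nonneg_nonneg less_imp_le[OF zp]) auto
  qed (rule le)
qed

text \<open>A term of the series with its Gamma factors left open, so that one estimate serves both
  the Gamma values and their regularised versions.\<close>

definition weighted_term :: "('j::finite \<Rightarrow> nat^'n::finite) \<Rightarrow> 'j set \<Rightarrow> complex^'j \<Rightarrow> ('j \<Rightarrow> nat) \<Rightarrow> ('j \<Rightarrow> complex) \<Rightarrow> complex" where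
  "weighted_term a \<sigma> z l g = (\<Prod>j\<in>\<sigma>. g j) / of_nat (\<Prod>k\<in>-\<sigma>. fact (l k)) * (\<Prod>k\<in>-\<sigma>. (z $ k) ^ (l k))
       / (\<Prod>j\<in>\<sigma>. (- (z $ j)) powr of_int (mm a \<sigma> l j))"

lemma gamma_term_eq_weighted:
  fixes a :: "'j::finite \<Rightarrow> nat^'n::finite"
  assumes "unimodular_simplex a \<sigma>"
  shows "gamma_term a \<sigma> nu z l = weighted_term a \<sigma> z l (\<lambda>j. Gamma (Ainv a \<sigma> nu j + of_int (mm a \<sigma> l j)))"
  by (simp add: gamma_term_def weighted_term_def Ainv_Abar_mult[OF assms])

lemma norm_weighted_term_le:
  fixes a :: "'j::finite \<Rightarrow> nat^'n::finite"
  assumes z: "\<And>j. z $ j \<noteq> 0" and C: "\<And>j. j \<in> \<sigma> \<Longrightarrow> 0 \<le> C j"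
    and g: "\<And>j. j \<in> \<sigma> \<Longrightarrow> norm (g j) \<le> C j * 2 ^ nat \<bar>mm a \<sigma> l j\<bar> * gfact (mm a \<sigma> l j)"
  shows "norm (weighted_term a \<sigma> z l g) \<le> (\<Prod>j\<in>\<sigma>. C j) * hyp_bound a \<sigma> z l"
proof -
  have pw: "norm ((- (z $ j)) powr of_int m) = norm (z $ j) powr of_int m" for j m
    using z[of j] by (simp add: complex_powr_of_int norm_power_int powr_real_of_int')
  have eq: "norm (weighted_term a \<sigma> z l g) = (\<Prod>k\<in>-\<sigma>. norm (z $ k) ^ l k / fact (l k)) *
      (\<Prod>j\<in>\<sigma>. norm (g j) * norm (z $ j) powr (- of_int (mm a \<sigma> l j)))"
  proof -
    have "norm (weighted_term a \<sigma> z l g) = (\<Prod>j\<in>\<sigma>. norm (g j)) / real (\<Prod>k\<in>-\<sigma>. fact (l k)) * (\<Prod>k\<in>-\<sigma>. norm (z $ k) ^ (l k))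
       / (\<Prod>j\<in>\<sigma>. norm (z $ j) powr of_int (mm a \<sigma> l j))"
      unfolding weighted_term_def norm_mult norm_divide norm_of_nat prod_norm[symmetric] norm_power pw ..
    moreover have "(\<Prod>j\<in>\<sigma>. inverse (h j)) = inverse (prod h \<sigma>)" for h :: "'j \<Rightarrow> real"
      using prod_inversef[of h \<sigma>] by (simp add: o_def)
    ultimately show ?thesis
      by (simp add: prod.distrib powr_minus divide_inverse prod_inversef[unfolded o_def] mult_ac)
  qed
  have "(\<Prod>j\<in>\<sigma>. norm (g j) * norm (z $ j) powr (- of_int (mm a \<sigma> l j)))
     \<le> (\<Prod>j\<in>\<sigma>. C j) * (\<Prod>j\<in>\<sigma>. 8 ^ nat \<bar>mm a \<sigma> l j\<bar> * gfact (mm a \<sigma> l j) * norm (z $ j) powr (- of_int (mm a \<sigma> l j)))"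
  proof (rule prod_le_mult)
    fix j assume j: "j \<in> \<sigma>"
    have "norm (g j) \<le> C j * 2 ^ nat \<bar>mm a \<sigma> l j\<bar> * gfact (mm a \<sigma> l j)" by (rule g[OF j])
    also have "\<dots> \<le> C j * 8 ^ nat \<bar>mm a \<sigma> l j\<bar> * gfact (mm a \<sigma> l j)"
      using C[OF j] gfact_pos[of "mm a \<sigma> l j"] by (intro mult_right_mono mult_left_mono power_mono) auto
    finally have "norm (g j) * norm (z $ j) powr (- of_int (mm a \<sigma> l j))
       \<le> C j * 8 ^ nat \<bar>mm a \<sigma> l j\<bar> * gfact (mm a \<sigma> l j) * norm (z $ j) powr (- of_int (mm a \<sigma> l j))"
      by (rule mult_right_mono) simp
    then show "norm (g j) * norm (z $ j) powr (- of_int (mm a \<sigma> l j))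
       \<le> C j * (8 ^ nat \<bar>mm a \<sigma> l j\<bar> * gfact (mm a \<sigma> l j) * norm (z $ j) powr (- of_int (mm a \<sigma> l j)))"
      by (simp add: mult_ac)
  qed simp
  then show ?thesis
    unfolding eq hyp_bound_def by (subst mult.left_commute) (intro mult_left_mono prod_nonneg; simp)
qed

lemma continuous_Ainv:
  fixes a :: "'j::finite \<Rightarrow> nat^'n::finite"
  assumes "unimodular_simplex a \<sigma>"
  shows "continuous_on S (\<lambda>nu. Ainv a \<sigma> nu j)"
  unfolding Ainv_eq_icoef[OF assms] by (intro continuous_intros)

text \<open>Only nu itself is assumed to avoid the poles. \<open>Gamma_locally_bounded\<close> turns
  this into one neighbourhood for all lambda that is free of poles and has a common majorant, so the
  Weierstrass test applies.\<close>

lemma gamma_series_local: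
  fixes a :: "'j::finite \<Rightarrow> nat^'n::finite"
  assumes \<sigma>: "unimodular_simplex a \<sigma>" "\<sigma> \<in> T" and z: "z \<in> conv_region a T"
    and gen: "\<And>l j. l \<in> lambdas \<sigma> \<Longrightarrow> j \<in> \<sigma> \<Longrightarrow> Ainv a \<sigma> nu j + of_int (mm a \<sigma> l j) \<notin> \<int>\<^sub>\<le>\<^sub>0"
  shows "(\<lambda>l. norm (gamma_term a \<sigma> nu z l)) summable_on lambdas \<sigma>"
    and "isCont (\<lambda>nu. infsum (gamma_term a \<sigma> nu z) (lambdas \<sigma>)) nu"
proof -
  have z0: "z $ j \<noteq> 0" for j using conv_region_Re_pos[OF z, of j] by auto
  have "\<exists>d C. d > 0 \<and> C > 0 \<and> (\<forall>v m. dist v (Ainv a \<sigma> nu j) < d \<longrightarrow> Ainv a \<sigma> nu j + of_int m \<notin> \<int>\<^sub>\<le>\<^sub>0 \<longrightarrow>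
     v + of_int m \<notin> \<int>\<^sub>\<le>\<^sub>0 \<and> norm (Gamma (v + of_int m)) \<le> C * 2 ^ nat \<bar>m\<bar> * gfact m)" for j
    by (rule Gamma_locally_bounded[of "Ainv a \<sigma> nu j"]) blast
  then obtain d C where dC: "\<And>j. d j > 0" "\<And>j. C j > 0"
    "\<And>j v m. dist v (Ainv a \<sigma> nu j) < d j \<Longrightarrow> Ainv a \<sigma> nu j + of_int m \<notin> \<int>\<^sub>\<le>\<^sub>0 \<Longrightarrow>
     v + of_int m \<notin> \<int>\<^sub>\<le>\<^sub>0 \<and> norm (Gamma (v + of_int m)) \<le> C j * 2 ^ nat \<bar>m\<bar> * gfact m"
    by metis
  have "\<forall>\<^sub>F nu' in nhds nu. \<forall>j\<in>\<sigma>. dist (Ainv a \<sigma> nu' j) (Ainv a \<sigma> nu j) < d j"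
  proof (intro eventually_ball_finite ballI)
    fix j
    have "isCont (\<lambda>nu. Ainv a \<sigma> nu j) nu"
      using continuous_Ainv[OF \<sigma>(1), of UNIV j] by (simp add: continuous_on_eq_continuous_at)
    from tendstoD[OF this[unfolded isCont_def] dC(1)[of j]]
    show "\<forall>\<^sub>F nu' in nhds nu. dist (Ainv a \<sigma> nu' j) (Ainv a \<sigma> nu j) < d j"
      using dC(1)[of j] by (simp add: eventually_nhds_conv_at)
  qed simp
  then obtain e where e: "e > 0" "\<And>nu' j. dist nu' nu < e \<Longrightarrow> j \<in> \<sigma> \<Longrightarrow> dist (Ainv a \<sigma> nu' j) (Ainv a \<sigma> nu j) < d j"
    unfolding eventually_nhds_metric by auto
  have bd: "norm (gamma_term a \<sigma> nu' z l) \<le> (\<Prod>j\<in>\<sigma>. C j) * hyp_bound a \<sigma> z l" if "nu' \<in> ball nu e" "l \<in> lambdas \<sigma>" for nu' l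
    unfolding gamma_term_eq_weighted[OF \<sigma>(1)]
  proof (rule norm_weighted_term_le[OF z0])
    fix j assume j: "j \<in> \<sigma>"
    show "0 \<le> C j" using dC(2)[of j] by simp
    have "dist nu' nu < e" using that(1) by (simp add: dist_commute)
    from dC(3)[OF e(2)[OF this j] gen[OF that(2) j]]
    show "norm (Gamma (Ainv a \<sigma> nu' j + of_int (mm a \<sigma> l j))) \<le> C j * 2 ^ nat \<bar>mm a \<sigma> l j\<bar> * gfact (mm a \<sigma> l j)"
      by (rule conjunct2)
  qed
  have summ: "(\<lambda>l. (\<Prod>j\<in>\<sigma>. C j) * hyp_bound a \<sigma> z l) summable_on lambdas \<sigma>"
    by (intro summable_on_cmult_right hyp_bound_summable[OF \<sigma> z])
  show "(\<lambda>l. norm (gamma_term a \<sigma> nu z l)) summable_on lambdas \<sigma>"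
    by (rule summable_on_comparison_test[OF summ]) (use bd[of nu] e(1) in auto)
  have cont: "continuous_on (ball nu e) (\<lambda>nu'. gamma_term a \<sigma> nu' z l)" if l: "l \<in> lambdas \<sigma>" for l
    unfolding gamma_term_eq_weighted[OF \<sigma>(1)] weighted_term_def
  proof (intro continuous_on_divide continuous_on_mult continuous_on_prod continuous_on_const)
    fix j assume j: "j \<in> \<sigma>"
    show "continuous_on (ball nu e) (\<lambda>nu'. Gamma (Ainv a \<sigma> nu' j + of_int (mm a \<sigma> l j)))"
    proof (rule continuous_on_compose2[OF continuous_on_Gamma[of "- \<int>\<^sub>\<le>\<^sub>0"]])
      show "(\<lambda>nu'. Ainv a \<sigma> nu' j + of_int (mm a \<sigma> l j)) ` ball nu e \<subseteq> - \<int>\<^sub>\<le>\<^sub>0"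
      proof (rule image_subsetI)
        fix nu' assume "nu' \<in> ball nu e"
        then have "dist nu' nu < e" by (simp add: dist_commute)
        from dC(3)[OF e(2)[OF this j] gen[OF l j]]
        show "Ainv a \<sigma> nu' j + of_int (mm a \<sigma> l j) \<in> - \<int>\<^sub>\<le>\<^sub>0" by simp
      qed
    qed (auto intro!: continuous_on_add continuous_Ainv[OF \<sigma>(1)] continuous_on_const)
  qed (use z0 in auto)
  have "uniform_limit (ball nu e) (\<lambda>X nu'. \<Sum>l\<in>X. gamma_term a \<sigma> nu' z l)
     (\<lambda>nu'. infsum (\<lambda>l. gamma_term a \<sigma> nu' z l) (lambdas \<sigma>)) (finite_subsets_at_top (lambdas \<sigma>))"
    by (rule Weierstrass_m_test_general[OF bd summ])
  moreover have "\<forall>\<^sub>F X in finite_subsets_at_top (lambdas \<sigma>). continuous_on (ball nu e) (\<lambda>nu'. \<Sum>l\<in>X. gamma_term a \<sigma> nu' z l)"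
    by (rule eventually_finite_subsets_at_top_weakI) (auto intro!: continuous_on_sum cont)
  ultimately have "continuous_on (ball nu e) (\<lambda>nu'. infsum (\<lambda>l. gamma_term a \<sigma> nu' z l) (lambdas \<sigma>))"
    by (intro uniform_limit_theorem) auto
  then show "isCont (\<lambda>nu. infsum (gamma_term a \<sigma> nu z) (lambdas \<sigma>)) nu"
    using e(1) by (simp add: continuous_on_eq_continuous_at)
qed

section \<open>Analytic continuation in the parameters\<close>

lemma infsum_holomorphic:
  fixes f :: "'i \<Rightarrow> complex \<Rightarrow> complex"
  assumes hol: "\<And>i. i \<in> A \<Longrightarrow> f i holomorphic_on UNIV"
    and bd: "\<And>R. \<exists>M. M summable_on A \<and> (\<forall>i\<in>A. \<forall>w\<in>cball 0 R. norm (f i w) \<le> M i)"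
  shows "(\<lambda>w. infsum (\<lambda>i. f i w) A) holomorphic_on UNIV"
proof -
  have "(\<lambda>w. infsum (\<lambda>i. f i w) A) holomorphic_on ball 0 R" for R
  proof -
    obtain M where M: "M summable_on A" "\<And>i w. i \<in> A \<Longrightarrow> w \<in> cball 0 R \<Longrightarrow> norm (f i w) \<le> M i"
      using bd[of R] by blast
    have ul: "uniform_limit (cball 0 R) (\<lambda>X w. \<Sum>i\<in>X. f i w) (\<lambda>w. infsum (\<lambda>i. f i w) A) (finite_subsets_at_top A)"
      by (rule Weierstrass_m_test_general[OF M(2,1)])
    have hs: "(\<lambda>w. \<Sum>i\<in>X. f i w) holomorphic_on S" if "finite X" "X \<subseteq> A" for X S
      by (intro holomorphic_on_sum) (use hol that in \<open>auto intro: holomorphic_on_subset\<close>)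
    have "\<forall>\<^sub>F X in finite_subsets_at_top A. continuous_on (cball 0 R) (\<lambda>w. \<Sum>i\<in>X. f i w) \<and> (\<lambda>w. \<Sum>i\<in>X. f i w) holomorphic_on ball 0 R"
      by (rule eventually_finite_subsets_at_top_weakI) (auto intro: hs holomorphic_on_imp_continuous_on)
    then show ?thesis
      by (rule holomorphic_uniform_limit[OF _ ul]) auto
  qed
  then have "(\<lambda>w. infsum (\<lambda>i. f i w) A) holomorphic_on (\<Union>n::nat. ball 0 (real n))"
    by (intro holomorphic_on_UN_open) auto
  moreover have "(\<Union>n::nat. ball 0 (real n)) = (UNIV :: complex set)"
    using reals_Archimedean2 by (auto simp: mem_ball_0)
  ultimately show ?thesis by simp
qed

section \<open>Identity theorem for separately holomorphic functions\<close>

definition upd :: "complex^'k \<Rightarrow> 'k \<Rightarrow> complex \<Rightarrow> complex^'k" where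
  "upd p k w = (\<chi> l. if l = k then w else p $ l)"

lemma upd_nth: "upd p k w $ l = (if l = k then w else p $ l)"
  by (simp add: upd_def)

lemma upd_same [simp]: "upd p k (p $ k) = p"
  by (simp add: upd_def vec_eq_iff)

lemma holomorphic_upd_nth: "(\<lambda>w. upd p k w $ l) holomorphic_on S"
  by (cases "l = k") (auto simp: upd_nth intro: holomorphic_intros)

text \<open>The interior Z of the zero set is shown to be closed in U. Around a limit point p, a
  polydisc in U meets Z; zeros spread from a small polydisc inside Z to the whole one by the
  one-variable identity theorem, one coordinate at a time.\<close>

lemma identity_several:
  fixes h :: "complex^'k::finite \<Rightarrow> complex"
  assumes U: "open U" "connected U" and V: "open V" "V \<noteq> {}" "V \<subseteq> U"
    and hol: "\<And>p k. p \<in> U \<Longrightarrow> (\<lambda>w. h (upd p k w)) field_differentiable (at (p $ k))"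
    and zero: "\<And>p. p \<in> V \<Longrightarrow> h p = 0" and p: "p \<in> U"
  shows "h p = 0"
proof -
  define PD where "PD p r = {x::complex^'k. \<forall>k. norm (x $ k - p $ k) < r}" for p r
  have open_PD: "open (PD p r)" for p r
  proof -
    have "PD p r = (\<Inter>k\<in>UNIV. {x. norm (x $ k - p $ k) < r})" by (auto simp: PD_def)
    also have "open \<dots>" by (intro open_INT open_Collect_less continuous_intros ballI) auto
    finally show ?thesis .
  qed
  have PD_sub: "\<exists>r>0. PD p r \<subseteq> S" if S: "open S" "p \<in> S" for S p
  proof -
    obtain e where e: "e > 0" "ball p e \<subseteq> S" by (rule openE[OF S])
    \<comment> \<open>In the Euclidean norm the polydisc of radius d lies in a ball of radius
      \<open>CARD('k)\<close> times d; the added 1 makes this strictly less than e.\<close>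
    define d where "d = e / (real CARD('k) + 1)"
    have n: "real CARD('k) + 1 > 0" by simp
    have d: "d > 0" unfolding d_def using e(1) n by (rule divide_pos_pos)
    have "(real CARD('k) + 1) * d = e" unfolding d_def using n by simp
    then have de: "real CARD('k) * d < e" using d unfolding distrib_right by linarith
    have sub: "PD p d \<subseteq> ball p e"
    proof
      fix x assume x: "x \<in> PD p d"
      have "norm (x - p) \<le> (\<Sum>k\<in>UNIV. norm ((x - p) $ k))"
        unfolding norm_vec_def by (rule L2_set_le_sum) simp
      also have "\<dots> \<le> (\<Sum>k\<in>(UNIV :: 'k set). d)"
      proof (rule sum_mono)
        fix k
        have "norm (x $ k - p $ k) < d" using x unfolding PD_def by blast
        then show "norm ((x - p) $ k) \<le> d" by simp
      qed
      also have "\<dots> = real CARD('k) * d" by simp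
      also note de
      finally show "x \<in> ball p e" by (simp add: dist_norm norm_minus_commute)
    qed
    show ?thesis by (rule exI[of _ d]) (rule conjI[OF d order.trans[OF sub e(2)]])
  qed
  have PD_self: "p \<in> PD p r" if "r > 0" for p r using that by (simp add: PD_def)
  define Z where "Z = interior {p\<in>U. h p = 0}"
  have ZU: "Z \<subseteq> U" unfolding Z_def using interior_subset by blast
  have Zh: "h p = 0" if "p \<in> Z" for p using that interior_subset unfolding Z_def by blast
  have oZ: "open Z" by (simp add: Z_def)
  have VZ: "V \<subseteq> Z" unfolding Z_def using V zero by (intro interior_maximal) auto
  have cl: "p \<in> Z" if pU: "p \<in> U" and pc: "p \<in> closure Z" for p
  proof -
    obtain r where r: "r > 0" "PD p r \<subseteq> U" using PD_sub[OF U(1) pU] by blast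
    have "PD p r \<inter> closure Z \<noteq> {}" using pc PD_self[OF r(1), of p] by blast
    then have "PD p r \<inter> Z \<noteq> {}" unfolding open_Int_closure_eq_empty[OF open_PD] .
    then obtain q where q: "q \<in> Z" "q \<in> PD p r" by blast
    have "open (Z \<inter> PD p r)" using oZ open_PD by auto
    then obtain s where s: "s > 0" "PD q s \<subseteq> Z \<inter> PD p r" using PD_sub q by blast
    \<comment> \<open>Coordinates in I range over the disc of radius r about p, the others over the
      small disc about q. The empty I gives the polydisc inside Z, the full I the polydisc about p,
      and each inserted coordinate is one continuation.\<close>
    define B where "B I = {x. \<forall>k. (k \<in> I \<longrightarrow> norm (x $ k - p $ k) < r) \<and> (k \<notin> I \<longrightarrow> norm (x $ k - q $ k) < s)}" for I
    have sub1: "norm (w - p $ k) < r" if "norm (w - q $ k) < s" for w k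
    proof -
      have "upd q k w \<in> PD q s" using that s(1) by (simp add: PD_def upd_nth)
      then have "upd q k w \<in> PD p r" using s(2) by blast
      then have "norm (upd q k w $ k - p $ k) < r" unfolding PD_def by blast
      then show ?thesis by (simp add: upd_nth)
    qed
    have BU: "B I \<subseteq> U" for I
    proof
      fix x assume "x \<in> B I"
      then have "x \<in> PD p r" unfolding B_def PD_def using sub1 by blast
      then show "x \<in> U" using r(2) by blast
    qed
    have "h x = 0" if "x \<in> B I" for x I
      using finite[of I] that
    proof (induction I arbitrary: x rule: finite_induct)
      case empty
      then have "x \<in> PD q s" by (simp add: B_def PD_def)
      then show ?case using s(2) Zh by blast
    next
      case (insert k I)
      let ?g = "\<lambda>w. h (upd x k w)"
      have big: "upd x k w \<in> B (insert k I)" if "w \<in> ball (p $ k) r" for w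
      proof -
        have w: "norm (w - p $ k) < r" using that by (simp add: dist_norm norm_minus_commute)
        have "(l \<in> insert k I \<longrightarrow> norm (upd x k w $ l - p $ l) < r) \<and> (l \<notin> insert k I \<longrightarrow> norm (upd x k w $ l - q $ l) < s)" for l
          using insert.prems w unfolding B_def by (cases "l = k") (simp_all add: upd_nth)
        then show ?thesis unfolding B_def by blast
      qed
      have small: "upd x k w \<in> B I" if "w \<in> ball (q $ k) s" for w
      proof -
        have w: "norm (w - q $ k) < s" using that by (simp add: dist_norm norm_minus_commute)
        have "(l \<in> I \<longrightarrow> norm (upd x k w $ l - p $ l) < r) \<and> (l \<notin> I \<longrightarrow> norm (upd x k w $ l - q $ l) < s)" for l
          using insert.prems insert.hyps w unfolding B_def by (cases "l = k") (simp_all add: upd_nth)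
        then show ?thesis unfolding B_def by blast
      qed
      have gh: "?g holomorphic_on ball (p $ k) r"
      proof (unfold holomorphic_on_def, intro ballI)
        fix w assume w: "w \<in> ball (p $ k) r"
        have "upd x k w \<in> U" using big[OF w] BU by blast
        from hol[OF this, of k] have "(\<lambda>w'. h (upd (upd x k w) k w')) field_differentiable (at w)"
          by (simp add: upd_nth)
        moreover have "upd (upd x k w) k w' = upd x k w'" for w' by (simp add: upd_def vec_eq_iff)
        ultimately show "?g field_differentiable (at w within ball (p $ k) r)"
          by (simp add: field_differentiable_at_within)
      qed
      have xk: "x $ k \<in> ball (p $ k) r"
      proof -
        have "norm (x $ k - p $ k) < r" using insert.prems unfolding B_def by blast
        then show ?thesis by (simp add: dist_norm norm_minus_commute)
      qed
      have "?g (x $ k) = 0"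
      proof (rule analytic_continuation_open[of "ball (q $ k) s" "ball (p $ k) r" ?g "\<lambda>_. 0"])
        show "ball (q $ k) s \<subseteq> ball (p $ k) r"
        proof
          fix w assume "w \<in> ball (q $ k) s"
          then have "norm (w - q $ k) < s" by (simp add: dist_norm norm_minus_commute)
          from sub1[OF this] show "w \<in> ball (p $ k) r" by (simp add: dist_norm norm_minus_commute)
        qed
        show "h (upd x k w) = 0" if "w \<in> ball (q $ k) s" for w
          by (rule insert.IH[OF small[OF that]])
      qed (use s(1) gh xk in auto)
      then show ?case by simp
    qed
    then have "h x = 0" if "x \<in> PD p r" for x
    proof -
      have "x \<in> B UNIV" using that unfolding B_def PD_def by blast
      then show ?thesis by (rule \<open>\<And>x I. x \<in> B I \<Longrightarrow> h x = 0\<close>)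
    qed
    then have "PD p r \<subseteq> {p\<in>U. h p = 0}" using r(2) by auto
    then have "PD p r \<subseteq> Z" unfolding Z_def by (rule interior_maximal[OF _ open_PD])
    then show ?thesis using PD_self[OF r(1)] by auto
  qed
  have "Z = U"
  proof -
    have "openin (top_of_set U) Z" using oZ ZU by (simp add: openin_open_eq U(1))
    moreover have "closedin (top_of_set U) Z"
    proof -
      have eq: "U \<inter> closure Z = Z" using cl ZU closure_subset[of Z] by blast
      have "closedin (top_of_set U) (U \<inter> closure Z)" by (rule closedin_closed_Int) simp
      then show ?thesis unfolding eq .
    qed
    ultimately have "Z = {} \<or> Z = U" using U(2) by (simp add: connected_clopen)
    then show ?thesis using VZ V(2) by auto
  qed
  then show ?thesis using p Zh by auto
qed

section \<open>Parameters at which integral linear forms take nonintegral values\<close>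

lemma generic_point:
  fixes c :: "'k::finite \<Rightarrow> int" and V :: "(complex^'k) set"
  assumes V: "open V" "V \<noteq> {}" and c: "c k \<noteq> 0"
  shows "open {nu\<in>V. Re (\<Sum>r\<in>UNIV. of_int (c r) * nu $ r) \<notin> \<int>}"
    and "{nu\<in>V. Re (\<Sum>r\<in>UNIV. of_int (c r) * nu $ r) \<notin> \<int>} \<noteq> {}"
proof -
  define \<phi> where "\<phi> nu = Re (\<Sum>r\<in>UNIV. of_int (c r) * nu $ r)" for nu :: "complex^'k"
  have cont: "continuous_on S \<phi>" for S unfolding \<phi>_def by (intro continuous_intros)
  have "open (- \<int> :: real set)" by (simp add: open_Compl closed_Ints)
  then have "open (\<phi> -` (- \<int>) \<inter> V)" using cont V(1) by (metis continuous_on_open_vimage)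
  moreover have "\<phi> -` (- \<int>) \<inter> V = {nu\<in>V. \<phi> nu \<notin> \<int>}" by auto
  ultimately show "open {nu\<in>V. Re (\<Sum>r\<in>UNIV. of_int (c r) * nu $ r) \<notin> \<int>}" by (simp add: \<phi>_def)
  obtain nu where nu: "nu \<in> V" using V(2) by auto
  have "\<exists>nu\<in>V. \<phi> nu \<notin> \<int>"
  proof (cases "\<phi> nu \<in> \<int>")
    case True
    obtain e where e: "e > 0" "ball nu e \<subseteq> V" using V(1) nu open_contains_ball by blast
    \<comment> \<open>|c_k| t is positive and at most 1/2, so adding it to an integer gives a
      non-integer, while t < e keeps the new point in V.\<close>
    define t where "t = min (e / 2) (1 / (2 * \<bar>of_int (c k)\<bar>))"
    have t: "t > 0" "t < e" "\<bar>of_int (c k)\<bar> * t \<le> 1 / 2"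
    proof -
      show "t > 0" using e c by (simp add: t_def)
      show "t < e" using e by (simp add: t_def min_def)
      have "\<bar>real_of_int (c k)\<bar> * t \<le> \<bar>of_int (c k)\<bar> * (1 / (2 * \<bar>of_int (c k)\<bar>))"
        by (intro mult_left_mono) (auto simp: t_def)
      then show "\<bar>of_int (c k)\<bar> * t \<le> 1 / 2" using c by simp
    qed
    define nu' where "nu' = nu + axis k (of_real t)"
    have "norm (axis k (complex_of_real t)) = norm (complex_of_real t)"
      unfolding norm_vec_def L2_set_def by (simp add: axis_def if_distrib[of norm] if_distrib[of "\<lambda>x. x\<^sup>2"] cong: if_cong)
    then have "dist nu nu' = t" using t(1) by (simp add: nu'_def dist_norm)
    then have "nu' \<in> V" using e t by auto
    moreover have "\<phi> nu' = \<phi> nu + of_int (c k) * t"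
    proof -
      have "\<phi> nu' = \<phi> nu + \<phi> (axis k (of_real t))" by (simp add: \<phi>_def nu'_def distrib_left sum.distrib)
      also have "\<phi> (axis k (of_real t)) = of_int (c k) * t"
        unfolding \<phi>_def by (simp add: axis_def if_distrib cong: if_cong)
      finally show ?thesis .
    qed
    moreover have "of_int (c k) * t \<notin> \<int>"
    proof
      assume "of_int (c k) * t \<in> \<int>"
      then obtain n where n: "of_int (c k) * t = real_of_int n" by (auto elim: Ints_cases)
      have "\<bar>real_of_int n\<bar> \<le> 1 / 2" using t n by (metis abs_mult abs_of_pos)
      then have "n = 0" by linarith
      then show False using n c t(1) by simp
    qed
    then have "\<phi> nu + of_int (c k) * t \<notin> \<int>" using True by (metis Ints_diff add_diff_cancel_left')
    ultimately show ?thesis by (intro bexI[of _ nu']) simp_all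
  qed (use nu in auto)
  then show "{nu\<in>V. Re (\<Sum>r\<in>UNIV. of_int (c r) * nu $ r) \<notin> \<int>} \<noteq> {}" by (auto simp: \<phi>_def)
qed

lemma generic_open:
  fixes C :: "('k::finite \<Rightarrow> int) set" and V :: "(complex^'k) set"
  assumes "finite C" "\<And>c. c \<in> C \<Longrightarrow> \<exists>k. c k \<noteq> 0" and V: "open V" "V \<noteq> {}"
  obtains V' where "open V'" "V' \<noteq> {}" "V' \<subseteq> V" "\<And>nu c. nu \<in> V' \<Longrightarrow> c \<in> C \<Longrightarrow> Re (\<Sum>r\<in>UNIV. of_int (c r) * nu $ r) \<notin> \<int>"
proof -
  have "\<exists>V'. open V' \<and> V' \<noteq> {} \<and> V' \<subseteq> V \<and> (\<forall>nu\<in>V'. \<forall>c\<in>C. Re (\<Sum>r\<in>UNIV. of_int (c r) * nu $ r) \<notin> \<int>)"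
    using assms(1,2)
  proof (induction C rule: finite_induct)
    case empty
    then show ?case using V by (intro exI[of _ V]) auto
  next
    case (insert c C)
    then obtain V' where V': "open V'" "V' \<noteq> {}" "V' \<subseteq> V" "\<forall>nu\<in>V'. \<forall>c\<in>C. Re (\<Sum>r\<in>UNIV. of_int (c r) * nu $ r) \<notin> \<int>"
      by auto
    obtain k where "c k \<noteq> 0" using insert.prems by auto
    from generic_point[OF V'(1,2), of c k] this
    show ?case
      by (intro exI[of _ "{nu\<in>V'. Re (\<Sum>r\<in>UNIV. of_int (c r) * nu $ r) \<notin> \<int>}"]) (use V' in auto)
  qed
  then show ?thesis using that by blast
qed

text \<open>By the reflection formula this is a term of the Gamma series multiplied by the product of the
  \<open>sin (\<pi> v\<^sub>j)\<close>; it has no poles.\<close>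

definition reg_term :: "('j::finite \<Rightarrow> nat^'n::finite) \<Rightarrow> 'j set \<Rightarrow> complex^('n option) \<Rightarrow> complex^'j \<Rightarrow> ('j \<Rightarrow> nat) \<Rightarrow> complex" where
  "reg_term a \<sigma> nu z l = weighted_term a \<sigma> z l (\<lambda>j. of_real pi * (-1) ^ nat \<bar>mm a \<sigma> l j\<bar> *
     rGamma (1 - Ainv a \<sigma> nu j - of_int (mm a \<sigma> l j)))"

text \<open>The reflection formula at v + m; the shift by m changes the sine only by the sign
  (-1)^m. The right-hand side is entire in v.\<close>

lemma sin_mult_Gamma:
  fixes v :: complex
  assumes "v \<notin> \<int>"
  shows "sin (of_real pi * v) * Gamma (v + of_int m) = of_real pi * (-1) ^ nat \<bar>m\<bar> * rGamma (1 - v - of_int m)"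
proof -
  have c: "cos (of_int m * complex_of_real pi) = (-1) ^ nat \<bar>m\<bar>"
  proof -
    have "cos (of_int m * pi) = (-1) ^ nat \<bar>m\<bar>"
    proof (cases "m \<ge> 0")
      case True
      then have "real_of_int m = real (nat \<bar>m\<bar>)" by simp
      then show ?thesis by (simp only: cos_npi)
    next
      case False
      then have "real_of_int m = - real (nat \<bar>m\<bar>)" by simp
      then show ?thesis by (simp only: minus_mult_left[symmetric] cos_minus cos_npi)
    qed
    then have "complex_of_real (cos (of_int m * pi)) = of_real ((-1) ^ nat \<bar>m\<bar>)" by simp
    then show ?thesis by (simp add: cos_of_real[symmetric])
  qed
  have s: "sin (of_int m * complex_of_real pi) = 0"
    using sin_eq_0 by auto
  have sin: "sin (of_real pi * (v + of_int m)) = sin (of_real pi * v) * (-1) ^ nat \<bar>m\<bar>"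
    by (simp add: distrib_left sin_add mult.commute[of "of_real pi" "of_int m"] c s)
  have ni: "v + of_int m \<notin> \<int>" using assms by (metis Ints_diff Ints_of_int add_diff_cancel_right')
  then have nz: "rGamma (v + of_int m) \<noteq> 0" by (auto simp: rGamma_eq_zero_iff)
  define rG where "rG = rGamma (v + of_int m)"
  define rG' where "rG' = rGamma (1 - v - of_int m)"
  define e where "e = (-1 :: complex) ^ nat \<bar>m\<bar>"
  have R: "rG * rG' = sin (of_real pi * v) * e / of_real pi"
    using rGamma_reflection_complex[of "v + of_int m"] unfolding sin
    by (simp only: rG_def rG'_def e_def diff_diff_eq)
  have ee: "e * e = 1" by (simp add: e_def flip: power_mult_distrib)
  have "of_real pi * e * rG' * rG = of_real pi * e * (rG * rG')" by (simp only: mult_ac)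
  also have "\<dots> = sin (of_real pi * v) * (e * e)" unfolding R by simp
  finally have "of_real pi * e * rG' * rG = sin (of_real pi * v)" by (simp only: ee mult_1_right)
  then have "sin (of_real pi * v) * inverse rG = of_real pi * e * rG'"
    using nz by (simp add: rG_def[symmetric] field_simps)
  then show ?thesis by (simp only: Gamma_def rG_def rG'_def e_def)
qed

lemma weighted_term_mult: "(\<Prod>j\<in>\<sigma>. f j) * weighted_term a \<sigma> z l g = weighted_term a \<sigma> z l (\<lambda>j. f j * g j)"
  by (simp add: weighted_term_def prod.distrib mult_ac)

lemma reg_term_eq:
  fixes a :: "'j::finite \<Rightarrow> nat^'n::finite"
  assumes \<sigma>: "unimodular_simplex a \<sigma>" and ni: "\<And>j. j \<in> \<sigma> \<Longrightarrow> Ainv a \<sigma> nu j \<notin> \<int>"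
  shows "(\<Prod>j\<in>\<sigma>. sin (of_real pi * Ainv a \<sigma> nu j)) * gamma_term a \<sigma> nu z l = reg_term a \<sigma> nu z l"
proof -
  have "(\<Prod>j\<in>\<sigma>. sin (of_real pi * Ainv a \<sigma> nu j) * Gamma (Ainv a \<sigma> nu j + of_int (mm a \<sigma> l j)))
     = (\<Prod>j\<in>\<sigma>. of_real pi * (-1) ^ nat \<bar>mm a \<sigma> l j\<bar> * rGamma (1 - Ainv a \<sigma> nu j - of_int (mm a \<sigma> l j)))"
    by (intro prod.cong refl sin_mult_Gamma ni)
  then show ?thesis
    unfolding gamma_term_eq_weighted[OF \<sigma>] weighted_term_mult reg_term_def by (simp add: weighted_term_def)
qed

lemma holomorphic_Ainv_upd:
  fixes a :: "'j::finite \<Rightarrow> nat^'n::finite"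
  assumes "unimodular_simplex a \<sigma>"
  shows "(\<lambda>w. Ainv a \<sigma> (upd p k w) j) holomorphic_on S"
  unfolding Ainv_eq_icoef[OF assms] by (intro holomorphic_intros holomorphic_upd_nth)

text \<open>The reciprocal Gamma function is entire, and \<open>norm_rGamma_le\<close> is uniform on
  discs of v, so the series converges locally uniformly in each variable.\<close>

lemma reg_series_holomorphic:
  fixes a :: "'j::finite \<Rightarrow> nat^'n::finite"
  assumes \<sigma>: "unimodular_simplex a \<sigma>" "\<sigma> \<in> T" and z: "z \<in> conv_region a T"
  shows "(\<lambda>w. infsum (reg_term a \<sigma> (upd p k w) z) (lambdas \<sigma>)) holomorphic_on UNIV"
proof (rule infsum_holomorphic)
  have z0: "z $ j \<noteq> 0" for j using conv_region_Re_pos[OF z, of j] by auto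
  show "(\<lambda>w. reg_term a \<sigma> (upd p k w) z l) holomorphic_on UNIV" for l
    unfolding reg_term_def weighted_term_def
    by (intro holomorphic_on_divide holomorphic_on_mult holomorphic_on_prod holomorphic_on_const
        holomorphic_rGamma' holomorphic_on_diff holomorphic_Ainv_upd[OF \<sigma>(1)]) (use z0 in auto)
  fix R :: real
  have "bounded ((\<lambda>w. Ainv a \<sigma> (upd p k w) j) ` cball (0::complex) R)" for j
    by (intro compact_imp_bounded compact_continuous_image holomorphic_on_imp_continuous_on
        holomorphic_Ainv_upd[OF \<sigma>(1)]) auto
  then have "bounded (\<Union>j\<in>UNIV. (\<lambda>w. Ainv a \<sigma> (upd p k w) j) ` cball 0 R)" by (intro bounded_UN) auto
  then obtain B where B: "\<And>j w. w \<in> cball (0::complex) R \<Longrightarrow> norm (Ainv a \<sigma> (upd p k w) j) \<le> B"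
    unfolding bounded_iff by fast
  obtain N :: nat where N: "B \<le> real N" using real_arch_simple by blast
  obtain C where C: "C > 0" "\<And>v m. norm v \<le> real N \<Longrightarrow> norm (rGamma (1 - v - of_int m :: complex)) \<le> C * 2 ^ nat \<bar>m\<bar> * gfact m"
    by (rule norm_rGamma_le[of N]) (rule that)
  show "\<exists>M. M summable_on lambdas \<sigma> \<and> (\<forall>l\<in>lambdas \<sigma>. \<forall>w\<in>cball (0::complex) R. norm (reg_term a \<sigma> (upd p k w) z l) \<le> M l)"
  proof (intro exI conjI ballI)
    show "(\<lambda>l. (\<Prod>j\<in>\<sigma>. pi * C) * hyp_bound a \<sigma> z l) summable_on lambdas \<sigma>"
      by (intro summable_on_cmult_right hyp_bound_summable[OF \<sigma> z])
    fix l and w :: complex assume w: "w \<in> cball 0 R"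
    show "norm (reg_term a \<sigma> (upd p k w) z l) \<le> (\<Prod>j\<in>\<sigma>. pi * C) * hyp_bound a \<sigma> z l"
      unfolding reg_term_def
    proof (rule norm_weighted_term_le[OF z0])
      fix j
      have "norm (rGamma (1 - Ainv a \<sigma> (upd p k w) j - of_int (mm a \<sigma> l j))) \<le> C * 2 ^ nat \<bar>mm a \<sigma> l j\<bar> * gfact (mm a \<sigma> l j)"
        by (rule C(2)) (use B[OF w, of j] N in linarith)
      then have "pi * norm (rGamma (1 - Ainv a \<sigma> (upd p k w) j - of_int (mm a \<sigma> l j))) \<le> pi * (C * 2 ^ nat \<bar>mm a \<sigma> l j\<bar> * gfact (mm a \<sigma> l j))"
        by (intro mult_left_mono) auto
      then show "norm (of_real pi * (-1) ^ nat \<bar>mm a \<sigma> l j\<bar> * rGamma (1 - Ainv a \<sigma> (upd p k w) j - of_int (mm a \<sigma> l j)))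
        \<le> pi * C * 2 ^ nat \<bar>mm a \<sigma> l j\<bar> * gfact (mm a \<sigma> l j)"
        by (simp add: norm_mult norm_power mult.assoc)
    qed (use C(1) in auto)
  qed
qed

section \<open>Convergence of the Euler--Mellin integral\<close>

text \<open>By translation invariance the integral I of g would satisfy exp(\<delta>) I \<le> I,
  although I > 0.\<close>

lemma not_integrable_growth:
  fixes g :: "'a::euclidean_space \<Rightarrow> real"
  assumes int: "integrable lborel g" and pos: "\<And>w. g w > 0" and \<delta>: "\<delta> > 0"
    and growth: "\<And>w. g (\<xi> + w) \<ge> exp \<delta> * g w"
  shows False
proof -
  have m: "g \<in> borel_measurable borel" using int by simp
  have i: "integrable lborel (\<lambda>w. g (\<xi> + w))"
    using int lborel_distr_plus[of \<xi>] integrable_distr_eq[of "(+) \<xi>" lborel borel g] m by simp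
  have eq: "(\<integral>w. g (\<xi> + w) \<partial>lborel) = (\<integral>w. g w \<partial>lborel)"
    using lborel_distr_plus[of \<xi>] integral_distr[of "(+) \<xi>" lborel borel g] m by simp
  have "exp \<delta> * (\<integral>w. g w \<partial>lborel) \<le> (\<integral>w. g (\<xi> + w) \<partial>lborel)"
    unfolding integral_mult_right_zero[symmetric] by (intro integral_mono integrable_mult_right int i growth)
  then have le: "exp \<delta> * (\<integral>w. g w \<partial>lborel) \<le> (\<integral>w. g w \<partial>lborel)" unfolding eq .
  have "(\<integral>w. g w \<partial>lborel) \<ge> 0" using pos by (intro Bochner_Integration.integral_nonneg) (simp add: less_imp_le)
  moreover have "(\<integral>w. g w \<partial>lborel) \<noteq> 0"
  proof
    assume "(\<integral>w. g w \<partial>lborel) = 0"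
    then have "AE w in lborel. g w = 0"
      using integral_nonneg_eq_0_iff_AE[OF int] pos by (auto simp: less_imp_le)
    then have "AE w in (lborel :: 'a measure). False"
      by eventually_elim (use pos in \<open>metis less_irrefl\<close>)
    then have "emeasure (lborel :: 'a measure) UNIV = 0" by (simp add: AE_iff_measurable[OF _ refl])
    then show False by (simp add: emeasure_lborel_UNIV)
  qed
  ultimately have "(\<integral>w. g w \<partial>lborel) > 0" by linarith
  moreover have "exp \<delta> > 1" using \<delta> by simp
  ultimately have "1 * (\<integral>w. g w \<partial>lborel) < exp \<delta> * (\<integral>w. g w \<partial>lborel)" by (intro mult_strict_right_mono)
  then show False using le by simp
qed

definition monexp :: "('j \<Rightarrow> nat^'n::finite) \<Rightarrow> 'j \<Rightarrow> real^'n \<Rightarrow> real" where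
  "monexp a j w = exp (pt a j \<bullet> w)"

text \<open>The Euler--Mellin integrand after x = exp w; the Jacobian raises each exponent nu_i - 1
  to nu_i.\<close>

definition log_integrand :: "('j::finite \<Rightarrow> nat^'n::finite) \<Rightarrow> complex^('n option) \<Rightarrow> complex^'j \<Rightarrow> real^'n \<Rightarrow> complex" where
  "log_integrand a nu z w = exp (\<Sum>i\<in>UNIV. nu $ Some i * of_real (w $ i)) *
     (\<Sum>j\<in>UNIV. z $ j * of_real (monexp a j w)) powr (- (nu $ None))"

lemma Gpoly_vexp: "Gpoly a z (vexp w) = (\<Sum>j\<in>UNIV. z $ j * of_real (monexp a j w))"
proof -
  have "(\<Prod>i\<in>UNIV. complex_of_real (exp (w $ i)) ^ (a j $ i)) = of_real (monexp a j w)" for j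
  proof -
    have "(\<Prod>i\<in>UNIV. exp (w $ i) ^ (a j $ i)) = monexp a j w"
      by (simp add: monexp_def inner_vec_def pt_def exp_sum exp_of_nat_mult)
    from arg_cong[OF this, of complex_of_real] show ?thesis by (simp only: of_real_prod of_real_power)
  qed
  then show ?thesis by (simp add: Gpoly_def)
qed

lemma EM_integrand_vexp: "(\<Prod>i\<in>UNIV. exp (w $ i)) *\<^sub>R EM_integrand a nu z (vexp w) = log_integrand a nu z w"
proof -
  have "of_real (\<Prod>i\<in>UNIV. exp (w $ i)) * (\<Prod>i\<in>UNIV. complex_of_real (exp (w $ i)) powr (nu $ Some i - 1))
     = exp (\<Sum>i\<in>UNIV. nu $ Some i * of_real (w $ i))"
    unfolding of_real_prod prod.distrib[symmetric] exp_sum[OF finite]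
    by (intro prod.cong refl) (simp add: cexp_ln_powr left_diff_distrib exp_diff exp_of_real)
  then show ?thesis
    by (simp add: EM_integrand_def log_integrand_def Gpoly_vexp scaleR_conv_of_real mult.assoc[symmetric])
qed

lemma EM_integrand_measurable [measurable]: "EM_integrand a nu z \<in> borel_measurable borel"
  unfolding EM_integrand_def Gpoly_def by measurable

lemma
  shows EM_conv_iff: "nu \<in> EM_conv a z \<longleftrightarrow> integrable lborel (log_integrand a nu z)"
    and J_int_eq: "J_int a nu z = Gamma (nu $ None) * (\<integral>w. log_integrand a nu z w \<partial>lborel)"
  using integrable_vexp_substitution[OF EM_integrand_measurable, of a nu z]
    integral_vexp_substitution[OF EM_integrand_measurable, of a nu z]
  by (simp_all add: EM_conv_def J_int_def posorth_def EM_integrand_vexp)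

text \<open>These estimates yield necessary conditions for convergence. The imaginary part of nu_0
  affects the norm only by a factor exp(Im nu_0 Im Ln G), bounded below because |Im Ln G| is at most
  pi.\<close>

lemma
  fixes a :: "'j::finite \<Rightarrow> nat^'n::finite"
  assumes zpos: "\<And>j. 0 < Re (z $ j)"
  defines "G \<equiv> \<lambda>w. (\<Sum>j\<in>UNIV. z $ j * of_real (monexp a j w))"
  shows Re_G_ge: "Re (G w) \<ge> Re (z $ j) * monexp a j w" and Re_G_pos: "Re (G w) > 0"
    and norm_G_le: "norm (G w) \<le> (\<Sum>j\<in>UNIV. norm (z $ j) * monexp a j w)"
    and norm_log_integrand_ge: "norm (log_integrand a nu z w) \<ge> exp (- (\<bar>Im (nu $ None)\<bar> * pi)) *
        (exp ((\<chi> i. Re (nu $ Some i)) \<bullet> w) * norm (G w) powr (- Re (nu $ None)))"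
proof -
  have mp: "monexp a j w > 0" for j by (simp add: monexp_def)
  have *: "Re (G w) \<ge> Re (z $ j) * monexp a j w" for j
  proof -
    have "Re (z $ j) * monexp a j w \<le> (\<Sum>j\<in>UNIV. Re (z $ j) * monexp a j w)"
      by (rule member_le_sum) (auto intro!: mult_nonneg_nonneg less_imp_le[OF zpos] less_imp_le[OF mp])
    then show ?thesis by (simp add: G_def)
  qed
  show "Re (G w) \<ge> Re (z $ j) * monexp a j w" by (rule *)
  show pos: "Re (G w) > 0" using *[of j] mult_pos_pos[OF zpos[of j] mp[of j]] by linarith
  have "norm (G w) \<le> (\<Sum>j\<in>UNIV. norm (z $ j * of_real (monexp a j w)))" unfolding G_def by (rule norm_sum)
  also have "\<dots> = (\<Sum>j\<in>UNIV. norm (z $ j) * monexp a j w)" by (simp add: norm_mult abs_of_pos[OF mp])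
  finally show "norm (G w) \<le> (\<Sum>j\<in>UNIV. norm (z $ j) * monexp a j w)" .
  have G0: "G w \<noteq> 0" using pos by auto
  have "norm (G w powr (- (nu $ None))) = exp (- Re (nu $ None) * ln (norm (G w)) + Im (nu $ None) * Im (Ln (G w)))"
    using G0 by (simp add: powr_def norm_exp)
  also have "\<dots> \<ge> exp (- (\<bar>Im (nu $ None)\<bar> * pi) + - Re (nu $ None) * ln (norm (G w)))"
  proof -
    have "\<bar>Im (nu $ None) * Im (Ln (G w))\<bar> \<le> \<bar>Im (nu $ None)\<bar> * pi"
      unfolding abs_mult using Im_Ln_le_pi[OF G0] mpi_less_Im_Ln[OF G0] by (intro mult_left_mono) auto
    then show ?thesis unfolding exp_le_cancel_iff by linarith
  qed
  also have "exp (- (\<bar>Im (nu $ None)\<bar> * pi) + - Re (nu $ None) * ln (norm (G w))) = exp (- (\<bar>Im (nu $ None)\<bar> * pi)) * norm (G w) powr (- Re (nu $ None))"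
    unfolding exp_add using G0 by (simp add: powr_def)
  finally have n: "norm (G w powr (- (nu $ None))) \<ge> exp (- (\<bar>Im (nu $ None)\<bar> * pi)) * norm (G w) powr (- Re (nu $ None))" .
  have e: "norm (exp (\<Sum>i\<in>UNIV. nu $ Some i * complex_of_real (w $ i))) = exp ((\<chi> i. Re (nu $ Some i)) \<bullet> w)"
    by (simp add: norm_exp inner_vec_def)
  have "exp (- (\<bar>Im (nu $ None)\<bar> * pi)) * (exp ((\<chi> i. Re (nu $ Some i)) \<bullet> w) * norm (G w) powr (- Re (nu $ None)))
     = exp ((\<chi> i. Re (nu $ Some i)) \<bullet> w) * (exp (- (\<bar>Im (nu $ None)\<bar> * pi)) * norm (G w) powr (- Re (nu $ None)))"
    by (simp only: mult_ac)
  also have "\<dots> \<le> exp ((\<chi> i. Re (nu $ Some i)) \<bullet> w) * norm (G w powr (- (nu $ None)))"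
    by (intro mult_left_mono n) simp
  finally show "norm (log_integrand a nu z w) \<ge> exp (- (\<bar>Im (nu $ None)\<bar> * pi)) *
        (exp ((\<chi> i. Re (nu $ Some i)) \<bullet> w) * norm (G w) powr (- Re (nu $ None)))"
    using norm_mult[of "exp (\<Sum>i\<in>UNIV. nu $ Some i * complex_of_real (w $ i))" "G w powr (- (nu $ None))"]
    unfolding e log_integrand_def G_def by (simp only:)
qed

lemma integrable_of_norm_ge:
  fixes g :: "'a::euclidean_space \<Rightarrow> real" and f :: "'a \<Rightarrow> complex"
  assumes "integrable lborel f" "g \<in> borel_measurable borel" "K > 0" "\<And>w. 0 \<le> g w" "\<And>w. norm (f w) \<ge> K * g w"
  shows "integrable lborel g"
proof (rule Bochner_Integration.integrable_bound)
  show "integrable lborel (\<lambda>w. norm (f w) / K)" using assms(1) by (intro integrable_divide integrable_norm)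
  show "AE w in lborel. norm (g w) \<le> norm (norm (f w) / K)"
  proof (rule AE_I2)
    fix w have "g w \<le> norm (f w) / K" using assms(3) assms(5)[of w] by (simp add: le_divide_eq mult.commute)
    then show "norm (g w) \<le> norm (norm (f w) / K)" using assms(3,4) by simp
  qed
qed (use assms(2) in simp)

text \<open>If Re nu_0 were negative, bounding |G| below by the single monomial j would give the
  integrable minorant exp(m . w) with m = Re nu - Re nu_0 a_j. The hypothesis \<open>i\<close> makes
  m nonzero, so this minorant grows under translation by m.\<close>

lemma EM_conv_imp_pos:
  fixes a :: "'j::finite \<Rightarrow> nat^'n::finite"
  assumes zpos: "\<And>j. 0 < Re (z $ j)" and conv: "nu \<in> EM_conv a z"
    and nz: "Re (nu $ None) \<noteq> 0" and i: "Re (nu $ Some i) - Re (nu $ None) * real (a j $ i) \<noteq> 0"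
  shows "Re (nu $ None) > 0"
proof (rule ccontr)
  assume "\<not> ?thesis"
  then have neg: "Re (nu $ None) < 0" using nz by simp
  define m where "m = (\<chi> i. Re (nu $ Some i)) - Re (nu $ None) *\<^sub>R pt a j"
  define g where "g w = exp (m \<bullet> w)" for w
  have "m $ i \<noteq> 0" using i by (simp add: m_def pt_def)
  then have "m \<noteq> 0" by auto
  then have mm: "m \<bullet> m > 0" by simp
  have "integrable lborel g"
  proof (rule integrable_of_norm_ge)
    show "integrable lborel (log_integrand a nu z)" using conv by (simp add: EM_conv_iff)
    show "g \<in> borel_measurable borel" unfolding g_def by measurable
    let ?K = "exp (- (\<bar>Im (nu $ None)\<bar> * pi)) * Re (z $ j) powr (- Re (nu $ None))"
    show "?K > 0" using zpos[of j] by simp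
    show "0 \<le> g w" for w by (simp add: g_def)
    fix w
    let ?G = "\<Sum>j\<in>UNIV. z $ j * complex_of_real (monexp a j w)"
    have mp: "monexp a j w > 0" by (simp add: monexp_def)
    have "Re (z $ j) * monexp a j w \<le> norm ?G"
      using Re_G_ge[where a = a and j = j and w = w, OF zpos] complex_Re_le_cmod[of ?G] by linarith
    then have "(Re (z $ j) * monexp a j w) powr (- Re (nu $ None)) \<le> norm ?G powr (- Re (nu $ None))"
      using neg zpos[of j] mp by (intro powr_mono2) auto
    moreover have "(Re (z $ j) * monexp a j w) powr (- Re (nu $ None)) = Re (z $ j) powr (- Re (nu $ None)) * exp (- Re (nu $ None) * (pt a j \<bullet> w))"
    proof -
      have "(Re (z $ j) * monexp a j w) powr (- Re (nu $ None)) = Re (z $ j) powr (- Re (nu $ None)) * monexp a j w powr (- Re (nu $ None))"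
        by (rule powr_mult)
      also have "monexp a j w powr (- Re (nu $ None)) = exp (- Re (nu $ None) * (pt a j \<bullet> w))"
        by (simp add: powr_def monexp_def)
      finally show ?thesis .
    qed
    ultimately have "exp ((\<chi> i. Re (nu $ Some i)) \<bullet> w) * (Re (z $ j) powr (- Re (nu $ None)) * exp (- Re (nu $ None) * (pt a j \<bullet> w)))
       \<le> exp ((\<chi> i. Re (nu $ Some i)) \<bullet> w) * norm ?G powr (- Re (nu $ None))"
      by (intro mult_left_mono) auto
    moreover have g: "g w = exp ((\<chi> i. Re (nu $ Some i)) \<bullet> w) * exp (- Re (nu $ None) * (pt a j \<bullet> w))"
      unfolding exp_add[symmetric] by (simp add: g_def m_def inner_diff_left)
    ultimately have "Re (z $ j) powr (- Re (nu $ None)) * g w \<le> exp ((\<chi> i. Re (nu $ Some i)) \<bullet> w) * norm ?G powr (- Re (nu $ None))"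
      unfolding g by (simp only: mult.left_commute)
    then have "exp (- (\<bar>Im (nu $ None)\<bar> * pi)) * (Re (z $ j) powr (- Re (nu $ None)) * g w)
       \<le> exp (- (\<bar>Im (nu $ None)\<bar> * pi)) * (exp ((\<chi> i. Re (nu $ Some i)) \<bullet> w) * norm ?G powr (- Re (nu $ None)))"
      by (intro mult_left_mono) auto
    also have "\<dots> \<le> norm (log_integrand a nu z w)" by (rule norm_log_integrand_ge[OF zpos])
    finally show "norm (log_integrand a nu z w) \<ge> ?K * g w" by (simp only: mult.assoc)
  qed
  then show False
    by (rule not_integrable_growth[of g "m \<bullet> m" m]) (use mm in \<open>simp_all add: g_def inner_add_right exp_add\<close>)
qed

text \<open>Otherwise a hyperplane with normal \<xi> separates the point p strictly from the
  polytope, and a positive minorant of the integrand grows under translation by -\<xi>.\<close>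

lemma EM_conv_imp_hull:
  fixes a :: "'j::finite \<Rightarrow> nat^'n::finite"
  assumes zpos: "\<And>j. 0 < Re (z $ j)" and conv: "nu \<in> EM_conv a z" and pos: "Re (nu $ None) > 0"
  shows "(\<chi> i. Re (nu $ Some i) / Re (nu $ None)) \<in> convex hull (range (pt a))"
proof (rule ccontr)
  let ?s = "Re (nu $ None)"
  define p where "p = (\<chi> i. Re (nu $ Some i) / ?s)"
  assume "\<not> ?thesis"
  then have np: "p \<notin> convex hull (range (pt a))" by (simp add: p_def)
  have "closed (convex hull (range (pt a)))"
    by (intro compact_imp_closed finite_imp_compact_convex_hull) simp
  then obtain \<xi> b where \<xi>: "\<xi> \<bullet> p < b" "\<And>x. x \<in> convex hull (range (pt a)) \<Longrightarrow> \<xi> \<bullet> x > b"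
    using separating_hyperplane_closed_point[OF convex_convex_hull _ np] by metis
  have \<xi>j: "b \<le> pt a j \<bullet> \<xi>" for j using \<xi>(2)[of "pt a j"] by (simp add: hull_inc inner_commute)
  define S where "S w = (\<Sum>j\<in>UNIV. norm (z $ j) * monexp a j w)" for w
  define g where "g w = exp ((?s *\<^sub>R p) \<bullet> w) * S w powr (- ?s)" for w
  have sp: "?s *\<^sub>R p = (\<chi> i. Re (nu $ Some i))" using pos by (simp add: p_def vec_eq_iff)
  have mp: "monexp a j w > 0" for j w by (simp add: monexp_def)
  have zp: "norm (z $ j) > 0" for j using zpos[of j] by auto
  have S: "S w > 0" for w unfolding S_def by (intro sum_pos mult_pos_pos zp mp) auto
  have g_int: "integrable lborel g"
  proof (rule integrable_of_norm_ge)
    show "integrable lborel (log_integrand a nu z)" using conv by (simp add: EM_conv_iff)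
    show "g \<in> borel_measurable borel" unfolding g_def S_def monexp_def by measurable
    show "exp (- (\<bar>Im (nu $ None)\<bar> * pi)) > 0" by simp
    show "0 \<le> g w" for w by (simp add: g_def)
    fix w
    let ?G = "\<Sum>j\<in>UNIV. z $ j * complex_of_real (monexp a j w)"
    have "norm ?G > 0" using Re_G_pos[where a = a and w = w, OF zpos] complex_Re_le_cmod[of ?G] by linarith
    moreover have "norm ?G \<le> S w" unfolding S_def by (rule norm_G_le[OF zpos])
    ultimately have "S w powr (- ?s) \<le> norm ?G powr (- ?s)" using pos by (intro powr_mono2') auto
    then have "exp (- (\<bar>Im (nu $ None)\<bar> * pi)) * g w \<le> exp (- (\<bar>Im (nu $ None)\<bar> * pi)) *
        (exp ((\<chi> i. Re (nu $ Some i)) \<bullet> w) * norm ?G powr (- ?s))"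
      unfolding g_def sp by (intro mult_left_mono) auto
    also have "\<dots> \<le> norm (log_integrand a nu z w)" by (rule norm_log_integrand_ge[OF zpos])
    finally show "norm (log_integrand a nu z w) \<ge> exp (- (\<bar>Im (nu $ None)\<bar> * pi)) * g w" .
  qed
  \<comment> \<open>Translation by -\<xi> multiplies the exponential factor by exp(-s \<xi> . p) and
    S by at most exp(-b), hence S^(-s) by at least exp(s b), where s = Re nu_0.\<close>
  define \<delta> where "\<delta> = ?s * (b - \<xi> \<bullet> p)"
  have \<delta>: "\<delta> > 0" using pos \<xi>(1) by (simp add: \<delta>_def)
  have growth: "g (- \<xi> + w) \<ge> exp \<delta> * g w" for w
  proof -
    have "S (- \<xi> + w) \<le> exp (- b) * S w"
      unfolding S_def sum_distrib_left
    proof (rule sum_mono)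
      fix j
      have "monexp a j (- \<xi> + w) = exp (- (pt a j \<bullet> \<xi>)) * monexp a j w"
        by (simp add: monexp_def inner_add_right inner_diff_right flip: exp_add)
      also have "\<dots> \<le> exp (- b) * monexp a j w" using \<xi>j[of j] mp[of j w] by (intro mult_right_mono) auto
      finally have "norm (z $ j) * monexp a j (- \<xi> + w) \<le> norm (z $ j) * (exp (- b) * monexp a j w)" by (rule mult_left_mono) simp
      then show "norm (z $ j) * monexp a j (- \<xi> + w) \<le> exp (- b) * (norm (z $ j) * monexp a j w)" by (simp only: mult_ac)
    qed
    then have "(exp (- b) * S w) powr (- ?s) \<le> S (- \<xi> + w) powr (- ?s)" using pos S by (intro powr_mono2') auto
    moreover have "(exp (- b) * S w) powr (- ?s) = exp (b * ?s) * S w powr (- ?s)"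
    proof -
      have "(exp (- b) * S w) powr (- ?s) = exp (- b) powr (- ?s) * S w powr (- ?s)"
        by (rule powr_mult)
      also have "exp (- b) powr (- ?s) = exp (b * ?s)" by (simp add: powr_def mult.commute)
      finally show ?thesis .
    qed
    ultimately have "exp ((?s *\<^sub>R p) \<bullet> (- \<xi> + w)) * (exp (b * ?s) * S w powr (- ?s)) \<le> g (- \<xi> + w)"
      unfolding g_def by (intro mult_left_mono) auto
    moreover have "exp ((?s *\<^sub>R p) \<bullet> (- \<xi> + w)) * (exp (b * ?s) * S w powr (- ?s)) = exp \<delta> * g w"
    proof -
      have "exp ((?s *\<^sub>R p) \<bullet> (- \<xi> + w)) * exp (b * ?s) = exp \<delta> * exp ((?s *\<^sub>R p) \<bullet> w)"
        unfolding exp_add[symmetric] by (simp add: \<delta>_def inner_diff_right inner_commute algebra_simps)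
      then show ?thesis by (simp add: g_def mult.assoc[symmetric])
    qed
    ultimately show ?thesis by simp
  qed
  have "g w > 0" for w using S[of w] by (simp add: g_def)
  then show False by (rule not_integrable_growth[OF g_int _ \<delta> growth])
qed

lemma hull_conecomb:
  fixes a :: "'j::finite \<Rightarrow> nat^'n::finite"
  assumes inj: "inj a" and pos: "Re (nu $ None) > 0"
    and p: "(\<chi> i. Re (nu $ Some i) / Re (nu $ None)) \<in> convex hull (range (pt a))"
  obtains c where "\<And>j. 0 \<le> c j" "(\<chi> r. Re (nu $ r)) = conecomb a c"
proof -
  let ?s = "Re (nu $ None)"
  obtain u where u: "\<And>j. 0 \<le> u j" "\<And>j. j \<notin> UNIV \<Longrightarrow> u j = 0" "sum u UNIV = 1"
    "(\<chi> i. Re (nu $ Some i) / ?s) = (\<Sum>j\<in>UNIV. u j *\<^sub>R pt a j)"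
    by (rule hull_image_coeffs[OF inj p]) (rule that)
  show ?thesis
  proof (rule that[of "\<lambda>j. ?s * u j"])
    show "0 \<le> ?s * u j" for j using pos u(1)[of j] by simp
    show "(\<chi> r. Re (nu $ r)) = conecomb a (\<lambda>j. ?s * u j)"
      unfolding vec_eq_iff
    proof
      fix r show "(\<chi> r. Re (nu $ r)) $ r = conecomb a (\<lambda>j. ?s * u j) $ r"
      proof (cases r)
        case None
        then show ?thesis using u(3) by (simp add: conecomb_def Acol_def sum_distrib_left[symmetric])
      next
        case (Some i)
        have "Re (nu $ Some i) / ?s = (\<Sum>j\<in>UNIV. u j *\<^sub>R pt a j) $ i" unfolding u(4)[symmetric] by simp
        also have "\<dots> = (\<Sum>j\<in>UNIV. u j * real (a j $ i))" by (simp add: pt_def)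
        finally have "Re (nu $ Some i) = ?s * (\<Sum>j\<in>UNIV. u j * real (a j $ i))" using pos by (simp add: field_simps)
        then show ?thesis using Some by (simp add: conecomb_def Acol_def sum_distrib_left mult.assoc)
      qed
    qed
  qed
qed

section \<open>Separating the first variable of the integral over R^(n+1)\<close>

definition join :: "real \<times> (real^'n) \<Rightarrow> real^('n option)" where
  "join = (\<lambda>(s, x). \<chi> r. case r of None \<Rightarrow> s | Some i \<Rightarrow> x $ i)"

lemma distr_join: "distr (lborel \<Otimes>\<^sub>M lborel) borel (join :: real \<times> (real^'n::finite) \<Rightarrow> _) = lborel"
  unfolding lborel_prod
proof (rule lborel_distr_Basis_bij)
  show "linear (join :: real \<times> (real^'n) \<Rightarrow> _)"
    by (rule linearI) (auto simp: join_def vec_eq_iff split: option.splits)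
  have j0: "join (1, 0 :: real^'n) = axis None 1"
    by (auto simp: join_def vec_eq_iff axis_def split: option.splits)
  have j1: "join (0, axis i 1 :: real^'n) = axis (Some i) 1" for i
    by (auto simp: join_def vec_eq_iff axis_def split: option.splits)
  have B: "(Basis :: (real \<times> (real^'n)) set) = insert (1, 0) ((\<lambda>i. (0, axis i 1)) ` UNIV)"
    by (auto simp: Basis_prod_def Basis_vec_def)
  have B': "(Basis :: (real^('n option)) set) = insert (axis None 1) ((\<lambda>i. axis (Some i) 1) ` UNIV)"
    by (auto simp: Basis_vec_def UNIV_option_conv)
  have "join ` (Basis :: (real \<times> (real^'n)) set) = Basis"
    unfolding B B' by (simp add: j0 j1 image_image)
  moreover have "inj (join :: real \<times> (real^'n) \<Rightarrow> _)"
  proof (rule injI, clarify)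
    fix s t and x y :: "real^'n" assume eq: "join (s, x) = join (t, y)"
    have "s = t" using arg_cong[OF eq, of "\<lambda>v. v $ None"] by (simp add: join_def)
    moreover have "x $ i = y $ i" for i using arg_cong[OF eq, of "\<lambda>v. v $ Some i"] by (simp add: join_def)
    ultimately show "s = t \<and> x = y" by (simp add: vec_eq_iff)
  qed
  ultimately show "bij_betw join (Basis :: (real \<times> (real^'n)) set) Basis"
    by (auto simp: bij_betw_def intro: inj_on_subset)
qed

text \<open>Integrating first over the coordinate \<open>None\<close> gives a Gamma integral with
  complex parameter G(x), whose real part is positive; this produces both Gamma(nu_0) and the power
  of G.\<close>

lemma J_int_eq_EM_exp:
  fixes a :: "'j::finite \<Rightarrow> nat^'n::finite"
  assumes zpos: "\<And>j. 0 < Re (z $ j)" and pos: "Re (nu $ None) > 0" and int: "integrable lborel (EM_exp a nu z)"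
  shows "J_int a nu z = (\<integral>w. EM_exp a nu z w \<partial>lborel)"
proof -
  have m: "EM_exp a nu z \<in> borel_measurable borel" using int by simp
  have "linear (join :: real \<times> (real^'n) \<Rightarrow> _)"
    by (rule linearI) (auto simp: join_def vec_eq_iff split: option.splits)
  then have "(join :: real \<times> (real^'n) \<Rightarrow> _) \<in> borel_measurable borel"
    by (intro borel_measurable_continuous_onI linear_continuous_on) (simp add: linear_conv_bounded_linear)
  then have mj: "(join :: real \<times> (real^'n) \<Rightarrow> _) \<in> lborel \<Otimes>\<^sub>M lborel \<rightarrow>\<^sub>M borel"
    unfolding lborel_prod by simp
  have "integrable (distr (lborel \<Otimes>\<^sub>M lborel) borel (join :: real \<times> (real^'n) \<Rightarrow> _)) (EM_exp a nu z)"
    unfolding distr_join by (rule int)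
  then have I: "integrable (lborel \<Otimes>\<^sub>M lborel) (\<lambda>p. EM_exp a nu z (join p))"
    by (subst (asm) integrable_distr_eq[OF mj m])
  have "(\<integral>w. EM_exp a nu z w \<partial>lborel) = integral\<^sup>L (distr (lborel \<Otimes>\<^sub>M lborel) borel (join :: real \<times> (real^'n) \<Rightarrow> _)) (EM_exp a nu z)"
    unfolding distr_join ..
  also have "\<dots> = (\<integral>p. EM_exp a nu z (join p) \<partial>(lborel \<Otimes>\<^sub>M lborel))"
    by (rule integral_distr[OF mj m])
  also have "\<dots> = (\<integral>x. (\<integral>s. EM_exp a nu z (join (s, x)) \<partial>lborel) \<partial>lborel)"
    using lborel_pair.integral_snd[of "\<lambda>s x. EM_exp a nu z (join (s, x))"] I by (simp add: case_prod_unfold)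
  also have "(\<lambda>x. \<integral>s. EM_exp a nu z (join (s, x)) \<partial>lborel) = (\<lambda>x. Gamma (nu $ None) * log_integrand a nu z x)"
  proof
    fix x :: "real^'n"
    let ?G = "\<Sum>j\<in>UNIV. z $ j * complex_of_real (monexp a j x)"
    have d: "dotA a j (join (s, x)) = s + pt a j \<bullet> x" for j s
      by (simp add: dotA_def join_def Acol_def UNIV_option_conv sum.reindex inner_vec_def pt_def)
    have n: "(\<Sum>r\<in>UNIV. nu $ r * complex_of_real (join (s, x) $ r)) = nu $ None * of_real s + (\<Sum>i\<in>UNIV. nu $ Some i * of_real (x $ i))" for s
      by (simp add: join_def UNIV_option_conv sum.reindex)
    have e: "EM_exp a nu z (join (s, x)) = exp (\<Sum>i\<in>UNIV. nu $ Some i * of_real (x $ i)) *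
        (exp (nu $ None * of_real s) * exp (- ?G * of_real (exp s)))" for s
      unfolding EM_exp_def n d exp_add
      by (simp add: monexp_def sum_distrib_right sum_distrib_left mult_ac)
    have "Re ?G > 0" by (rule Re_G_pos[OF zpos])
    then show "(\<integral>s. EM_exp a nu z (join (s, x)) \<partial>lborel) = Gamma (nu $ None) * log_integrand a nu z x"
      unfolding e integral_mult_right_zero by (subst integral_exp_Gamma_complex[OF pos]) (simp_all add: log_integrand_def mult_ac)
  qed
  finally show ?thesis by (simp add: J_int_eq)
qed

section \<open>The main theorem\<close>

definition gamma_series :: "('j::finite \<Rightarrow> nat^'n::finite) \<Rightarrow> 'j set set \<Rightarrow> complex^('n option) \<Rightarrow> complex^'j \<Rightarrow> complex" where
  "gamma_series a T nu z = (\<Sum>\<sigma>\<in>T. gamma_prefactor a \<sigma> nu z * infsum (gamma_term a \<sigma> nu z) (lambdas \<sigma>))"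

definition sin_prod :: "('j::finite \<Rightarrow> nat^'n::finite) \<Rightarrow> 'j set set \<Rightarrow> complex^('n option) \<Rightarrow> complex" where
  "sin_prod a T nu = (\<Prod>\<sigma>\<in>T. \<Prod>j\<in>\<sigma>. sin (of_real pi * Ainv a \<sigma> nu j))"

text \<open>The Gamma series times \<open>sin_prod\<close>, with the poles cancelled: the sines of
  sigma itself are absorbed into \<open>reg_term\<close>, those of the other simplices remain as a
  factor.\<close>

definition reg_series :: "('j::finite \<Rightarrow> nat^'n::finite) \<Rightarrow> 'j set set \<Rightarrow> complex^('n option) \<Rightarrow> complex^'j \<Rightarrow> complex" where
  "reg_series a T nu z = (\<Sum>\<sigma>\<in>T. sin_prod a (T - {\<sigma>}) nu * gamma_prefactor a \<sigma> nu z * infsum (reg_term a \<sigma> nu z) (lambdas \<sigma>))"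

lemma sin_prod_mult_gamma_series:
  fixes a :: "'j::finite \<Rightarrow> nat^'n::finite"
  assumes T: "regular_unimodular_triangulation a T"
    and ni: "\<And>\<sigma> j. \<sigma> \<in> T \<Longrightarrow> j \<in> \<sigma> \<Longrightarrow> Ainv a \<sigma> nu j \<notin> \<int>"
  shows "sin_prod a T nu * gamma_series a T nu z = reg_series a T nu z"
  unfolding gamma_series_def reg_series_def sum_distrib_left
proof (intro sum.cong refl)
  fix \<sigma> assume \<sigma>: "\<sigma> \<in> T"
  have D: "sin_prod a T nu = (\<Prod>j\<in>\<sigma>. sin (of_real pi * Ainv a \<sigma> nu j)) * sin_prod a (T - {\<sigma>}) nu"
    unfolding sin_prod_def using \<sigma> by (subst prod.remove[of T \<sigma>]) auto
  have "(\<Prod>j\<in>\<sigma>. sin (of_real pi * Ainv a \<sigma> nu j)) * infsum (gamma_term a \<sigma> nu z) (lambdas \<sigma>) = infsum (reg_term a \<sigma> nu z) (lambdas \<sigma>)"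
    unfolding infsum_cmult_right'[symmetric]
    by (intro infsum_cong reg_term_eq[OF triangulation_simplex[OF T \<sigma>] ni[OF \<sigma>]])
  note R = this
  show "sin_prod a T nu * (gamma_prefactor a \<sigma> nu z * infsum (gamma_term a \<sigma> nu z) (lambdas \<sigma>))
     = sin_prod a (T - {\<sigma>}) nu * gamma_prefactor a \<sigma> nu z * infsum (reg_term a \<sigma> nu z) (lambdas \<sigma>)"
    unfolding D R[symmetric] by (simp only: mult_ac)
qed

lemma sin_prod_nonzero:
  fixes a :: "'j::finite \<Rightarrow> nat^'n::finite"
  assumes ni: "\<And>\<sigma> j. \<sigma> \<in> T \<Longrightarrow> j \<in> \<sigma> \<Longrightarrow> Ainv a \<sigma> nu j \<notin> \<int>"
  shows "sin_prod a T nu \<noteq> 0"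
proof -
  have "sin (of_real pi * v) \<noteq> 0" if "v \<notin> \<int>" for v :: complex
  proof
    assume "sin (of_real pi * v) = 0"
    then obtain n :: int where "of_real pi * v = of_real (n * pi)" unfolding sin_eq_0 by blast
    then have "v = of_int n" by simp
    then show False using that by simp
  qed
  then show ?thesis unfolding sin_prod_def using ni by simp
qed

lemma holomorphic_sin_prod:
  fixes a :: "'j::finite \<Rightarrow> nat^'n::finite"
  assumes T: "regular_unimodular_triangulation a T" "T' \<subseteq> T"
  shows "(\<lambda>w. sin_prod a T' (upd p k w)) holomorphic_on S"
  unfolding sin_prod_def
proof (intro holomorphic_on_prod holomorphic_on_sin' holomorphic_on_mult holomorphic_on_const)
  fix \<sigma> j assume "\<sigma> \<in> T'"
  then show "(\<lambda>w. Ainv a \<sigma> (upd p k w) j) holomorphic_on S"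
    using T by (intro holomorphic_Ainv_upd triangulation_simplex[OF T(1)]) auto
qed

lemma holomorphic_reg_series:
  fixes a :: "'j::finite \<Rightarrow> nat^'n::finite"
  assumes T: "regular_unimodular_triangulation a T" and z: "z \<in> conv_region a T"
  shows "(\<lambda>w. reg_series a T (upd p k w) z) holomorphic_on UNIV"
  unfolding reg_series_def
proof (intro holomorphic_on_sum holomorphic_on_mult holomorphic_sin_prod[OF T])
  fix \<sigma> assume \<sigma>: "\<sigma> \<in> T"
  note us = triangulation_simplex[OF T \<sigma>]
  have z0: "z $ j \<noteq> 0" for j using conv_region_Re_pos[OF z, of j] by auto
  have "gamma_prefactor a \<sigma> nu z = (\<Prod>j\<in>\<sigma>. exp (- Ainv a \<sigma> nu j * Ln (z $ j)))" for nu
    unfolding gamma_prefactor_def by (intro prod.cong refl) (simp add: powr_def z0)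
  then show "(\<lambda>w. gamma_prefactor a \<sigma> (upd p k w) z) holomorphic_on UNIV"
    by (simp only:) (intro holomorphic_on_prod holomorphic_on_exp' holomorphic_on_mult holomorphic_on_minus holomorphic_on_const holomorphic_Ainv_upd[OF us])
  show "(\<lambda>w. infsum (reg_term a \<sigma> (upd p k w) z) (lambdas \<sigma>)) holomorphic_on UNIV"
    by (rule reg_series_holomorphic[OF us \<sigma> z])
qed auto

text \<open>The hypotheses \<open>nz\<close> are genericity conditions that let
  \<open>EM_conv_imp_pos\<close> derive Re nu_0 > 0 from convergence; the cone condition on Re nu
  follows in turn from convergence.\<close>

lemma J_int_eq_gamma_series:
  fixes a :: "'j::finite \<Rightarrow> nat^'n::finite"
  assumes inj: "inj a" and T: "regular_unimodular_triangulation a T" and z: "z \<in> conv_region a T"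
    and conv: "nu \<in> EM_conv a z"
    and gen: "\<And>\<sigma> j. \<sigma> \<in> T \<Longrightarrow> j \<in> \<sigma> \<Longrightarrow> Re (Ainv a \<sigma> nu j) \<notin> \<int>"
    and nz: "Re (nu $ None) \<noteq> 0" "Re (nu $ Some i) - Re (nu $ None) * real (a j $ i) \<noteq> 0"
  shows "J_int a nu z = gamma_series a T nu z"
proof -
  note zpos = conv_region_Re_pos[OF z]
  have pos: "Re (nu $ None) > 0" by (rule EM_conv_imp_pos[OF zpos conv nz])
  obtain c where c: "\<And>j. 0 \<le> c j" "(\<chi> r. Re (nu $ r)) = conecomb a c"
    by (rule hull_conecomb[OF inj pos EM_conv_imp_hull[OF zpos conv pos]]) (rule that)
  note summ = gamma_bound_summable[OF triangulation_simplex[OF T] _ z gen]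
  have E: "integrable lborel (EM_exp a nu z)" "(\<integral>w. EM_exp a nu z w \<partial>lborel) = gamma_series a T nu z"
    unfolding gamma_series_def
    by (rule EM_exp_integral[OF inj T zpos gen c(2,1) pos summ]; assumption)+
  then show ?thesis using J_int_eq_EM_exp[OF zpos pos E(1)] by simp
qed

text \<open>All conditions follow from nonintegrality of the real parts of finitely many nonzero
  integral linear forms, which \<open>generic_open\<close> arranges simultaneously.\<close>

lemma generic_for_triangulation:
  fixes a :: "'j::finite \<Rightarrow> nat^'n::finite"
  assumes T: "regular_unimodular_triangulation a T" and V: "open V" "V \<noteq> {}"
  obtains V' i j where "open V'" "V' \<noteq> {}" "V' \<subseteq> V"
    "\<And>nu \<sigma> j. nu \<in> V' \<Longrightarrow> \<sigma> \<in> T \<Longrightarrow> j \<in> \<sigma> \<Longrightarrow> Re (Ainv a \<sigma> nu j) \<notin> \<int>"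
    "\<And>nu. nu \<in> V' \<Longrightarrow> Re (nu $ None) \<noteq> 0"
    "\<And>nu. nu \<in> V' \<Longrightarrow> Re (nu $ Some i) - Re (nu $ None) * real (a j $ i) \<noteq> 0"
proof -
  obtain i :: 'n where True by blast
  obtain j :: 'j where True by blast
  \<comment> \<open>The forms nu_0 and nu_i - nu_0 (a_j)_i: nonintegrality of their real parts
    implies the two nonvanishing conditions.\<close>
  define c0 :: "'n option \<Rightarrow> int" where "c0 = (\<lambda>r. if r = None then 1 else 0)"
  define c1 :: "'n option \<Rightarrow> int" where "c1 = (\<lambda>r. if r = Some i then 1 else if r = None then - int (a j $ i) else 0)"
  define C where "C = insert c0 (insert c1 ((\<lambda>(\<sigma>, j). icoef a \<sigma> j) ` Sigma T id))"
  have fin: "finite C" unfolding C_def by (intro finite.insertI finite_imageI) simp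
  have nz: "\<exists>k. c k \<noteq> 0" if c: "c \<in> C" for c
  proof -
    have "c = c0 \<or> c = c1 \<or> c \<in> (\<lambda>(\<sigma>, j). icoef a \<sigma> j) ` Sigma T id"
      using c unfolding C_def by simp
    then consider "c = c0" | "c = c1" | \<sigma> j where "\<sigma> \<in> T" "j \<in> \<sigma>" "c = icoef a \<sigma> j"
      by (elim disjE imageE SigmaE) simp_all
    then show ?thesis
    proof cases
      case 1 then show ?thesis by (auto simp: c0_def)
    next
      case 2 then show ?thesis by (intro exI[of _ "Some i"]) (simp add: c1_def)
    next
      case (3 \<sigma> j)
      \<comment> \<open>Row j of the inverse pairs to 1 with column j, so it is not the zero
        form.\<close>
      then have "(\<Sum>r\<in>UNIV. icoef a \<sigma> j r * Acol a j $ r) = 1"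
        using icoef_Acol[OF triangulation_simplex[OF T 3(1)] 3(2,2)] by simp
      moreover have "(\<Sum>r\<in>UNIV. icoef a \<sigma> j r * Acol a j $ r) = 0" if "\<forall>r. icoef a \<sigma> j r = 0"
        using that by simp
      ultimately have "\<not> (\<forall>r. icoef a \<sigma> j r = 0)" by (metis zero_neq_one)
      then show ?thesis using 3(3) by blast
    qed
  qed
  obtain V' where V': "open V'" "V' \<noteq> {}" "V' \<subseteq> V"
    "\<And>nu c. nu \<in> V' \<Longrightarrow> c \<in> C \<Longrightarrow> Re (\<Sum>r\<in>UNIV. of_int (c r) * nu $ r) \<notin> \<int>"
    by (rule generic_open[OF fin nz V], assumption, rule that)
  show ?thesis
  proof (rule that[OF V'(1-3)])
    fix nu assume nu: "nu \<in> V'"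
    show "Re (Ainv a \<sigma> nu j) \<notin> \<int>" if "\<sigma> \<in> T" "j \<in> \<sigma>" for \<sigma> j
    proof -
      have "icoef a \<sigma> j \<in> C"
        unfolding C_def using that by (intro insertI2 image_eqI[of _ _ "(\<sigma>, j)"]) simp_all
      from V'(4)[OF nu this] show ?thesis unfolding Ainv_eq_icoef[OF triangulation_simplex[OF T that(1)]] .
    qed
    have "c0 \<in> C" by (simp add: C_def)
    from V'(4)[OF nu this] have ni0: "Re (\<Sum>r\<in>UNIV. of_int (c0 r) * nu $ r) \<notin> \<int>" .
    have "(\<Sum>r\<in>UNIV. of_int (c0 r) * nu $ r) = (\<Sum>r\<in>UNIV. if r = None then nu $ r else 0)"
      by (intro sum.cong refl) (simp add: c0_def)
    with ni0 have "Re (nu $ None) \<notin> \<int>" by simp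
    then show "Re (nu $ None) \<noteq> 0" by (metis Ints_0)
    have "c1 \<in> C" by (simp add: C_def)
    from V'(4)[OF nu this] have ni: "Re (\<Sum>r\<in>UNIV. of_int (c1 r) * nu $ r) \<notin> \<int>" .
    have "(\<Sum>r\<in>UNIV. of_int (c1 r) * nu $ r) = of_int (c1 None) * nu $ None + (\<Sum>k\<in>UNIV. of_int (c1 (Some k)) * nu $ Some k)"
      by (simp add: UNIV_option_conv sum.reindex)
    also have "(\<Sum>k\<in>UNIV. of_int (c1 (Some k)) * nu $ Some k) = (\<Sum>k\<in>UNIV. if k = i then nu $ Some k else 0)"
      by (intro sum.cong refl) (simp add: c1_def)
    also have "\<dots> = nu $ Some i" by simp
    finally have "Re (\<Sum>r\<in>UNIV. of_int (c1 r) * nu $ r) = Re (nu $ Some i) - Re (nu $ None) * real (a j $ i)"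
      by (simp add: c1_def)
    with ni have "Re (nu $ Some i) - Re (nu $ None) * real (a j $ i) \<notin> \<int>" by simp
    then show "Re (nu $ Some i) - Re (nu $ None) * real (a j $ i) \<noteq> 0" by (metis Ints_0)
  qed
qed

text \<open>The identity theorem yields the formula multiplied by \<open>sin_prod\<close> on all of
  U. As \<open>sin_prod\<close> may vanish at nu, a discrepancy there is carried by continuity to a
  nearby generic point, where the factor can be divided out.\<close>

lemma continuation_eq_gamma_series:
  fixes a :: "'j::finite \<Rightarrow> nat^'n::finite"
  assumes inj: "inj a" and T: "regular_unimodular_triangulation a T" and z: "z \<in> conv_region a T"
    and gen: "\<And>\<sigma> l j. \<sigma> \<in> T \<Longrightarrow> l \<in> lambdas \<sigma> \<Longrightarrow> j \<in> \<sigma> \<Longrightarrow> Ainv a \<sigma> nu j + of_int (mm a \<sigma> l j) \<notin> \<int>\<^sub>\<le>\<^sub>0"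
    and J: "J_continuation a z U V F" and nu: "nu \<in> U"
  shows "F nu = gamma_series a T nu z"
proof (rule ccontr)
  assume ne: "F nu \<noteq> gamma_series a T nu z"
  have U: "open U" "connected U" "continuous_on U F"
    and F: "\<And>p k. p \<in> U \<Longrightarrow> (\<lambda>w. F (upd p k w)) field_differentiable (at (p $ k))"
    and V: "open V" "V \<noteq> {}" "V \<subseteq> U" "V \<subseteq> EM_conv a z" and FV: "\<And>nu. nu \<in> V \<Longrightarrow> F nu = J_int a nu z"
    using J unfolding J_continuation_def holo_several_def upd_def by blast+
  have z0: "z $ j \<noteq> 0" for j using conv_region_Re_pos[OF z, of j] by auto
  have notint: "Ainv a \<sigma> nu j \<notin> \<int>" if "Re (Ainv a \<sigma> nu j) \<notin> \<int>" for nu \<sigma> j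
    using that by (auto elim!: Ints_cases)
  obtain V' i j where V': "open V'" "V' \<noteq> {}" "V' \<subseteq> V"
    "\<And>nu \<sigma> j. nu \<in> V' \<Longrightarrow> \<sigma> \<in> T \<Longrightarrow> j \<in> \<sigma> \<Longrightarrow> Re (Ainv a \<sigma> nu j) \<notin> \<int>"
    "\<And>nu. nu \<in> V' \<Longrightarrow> Re (nu $ None) \<noteq> 0"
    "\<And>nu. nu \<in> V' \<Longrightarrow> Re (nu $ Some i) - Re (nu $ None) * real (a j $ i) \<noteq> 0"
    by (rule generic_for_triangulation[OF T V(1,2)]) (rule that)
  have eqU: "sin_prod a T p * F p - reg_series a T p z = 0" if "p \<in> U" for p
  proof (rule identity_several[of U V' "\<lambda>p. sin_prod a T p * F p - reg_series a T p z"])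
    show "V' \<subseteq> U" using V'(3) V(3) by blast
    show "sin_prod a T p * F p - reg_series a T p z = 0" if p: "p \<in> V'" for p
    proof -
      have "p \<in> V" using V'(3) p by blast
      then have "F p = gamma_series a T p z"
        using FV J_int_eq_gamma_series[OF inj T z _ V'(4)[OF p] V'(5)[OF p] V'(6)[OF p]] V(4) by auto
      then show ?thesis
        using sin_prod_mult_gamma_series[OF T notint[OF V'(4)[OF p]], of z] by simp
    qed
    show "(\<lambda>w. sin_prod a T (upd p k w) * F (upd p k w) - reg_series a T (upd p k w) z) field_differentiable at (p $ k)"
      if "p \<in> U" for p k
    proof -
      have "(\<lambda>w. sin_prod a T (upd p k w)) field_differentiable at (p $ k)"
        using holomorphic_sin_prod[OF T order.refl, of p k UNIV] by (simp add: holomorphic_on_def)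
      moreover have "(\<lambda>w. reg_series a T (upd p k w) z) field_differentiable at (p $ k)"
        using holomorphic_reg_series[OF T z, of p k] by (simp add: holomorphic_on_def)
      ultimately show ?thesis
        by (intro field_differentiable_diff field_differentiable_mult F that)
    qed
  qed (use U V' that in auto)
  \<comment> \<open>Continuity of the Gamma series at nu needs only that nu avoids its poles, so it
    covers integral coordinates of A_sigma^(-1) nu.\<close>
  have "isCont F nu" using U(1,3) nu by (simp add: continuous_on_eq_continuous_at)
  moreover have "isCont (\<lambda>nu. gamma_series a T nu z) nu"
    unfolding gamma_series_def
  proof (intro continuous_sum continuous_mult)
    fix \<sigma> assume \<sigma>: "\<sigma> \<in> T"
    note us = triangulation_simplex[OF T \<sigma>]
    show "isCont (\<lambda>nu. infsum (gamma_term a \<sigma> nu z) (lambdas \<sigma>)) nu"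
      by (rule gamma_series_local(2)[OF us \<sigma> z gen[OF \<sigma>]])
    have "continuous_on UNIV (\<lambda>nu. gamma_prefactor a \<sigma> nu z)"
      unfolding gamma_prefactor_def powr_def using z0
      by (auto intro!: continuous_on_prod continuous_on_exp continuous_on_mult continuous_on_minus continuous_on_const continuous_Ainv[OF us])
    then show "isCont (\<lambda>nu. gamma_prefactor a \<sigma> nu z) nu" by (simp add: continuous_on_eq_continuous_at)
  qed
  ultimately have "isCont (\<lambda>nu. F nu - gamma_series a T nu z) nu" by (rule continuous_diff)
  then have "\<forall>\<^sub>F p in nhds nu. F p - gamma_series a T p z \<noteq> 0"
    using ne tendsto_imp_eventually_ne[of "\<lambda>nu. F nu - gamma_series a T nu z" _ "at nu" 0]
    by (simp add: isCont_def eventually_nhds_conv_at)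
  then obtain N where N: "open N" "nu \<in> N" "\<And>p. p \<in> N \<Longrightarrow> F p \<noteq> gamma_series a T p z"
    unfolding eventually_nhds by auto
  have "open (N \<inter> U)" "N \<inter> U \<noteq> {}" using N U nu by auto
  then obtain N' i j where N': "open N'" "N' \<noteq> {}" "N' \<subseteq> N \<inter> U"
    "\<And>nu \<sigma> j. nu \<in> N' \<Longrightarrow> \<sigma> \<in> T \<Longrightarrow> j \<in> \<sigma> \<Longrightarrow> Re (Ainv a \<sigma> nu j) \<notin> \<int>"
    by (rule generic_for_triangulation[OF T]) (rule that)
  then obtain p where p: "p \<in> N'" "p \<in> N" "p \<in> U" by blast
  have "sin_prod a T p * F p = sin_prod a T p * gamma_series a T p z"
    using eqU[OF p(3)] sin_prod_mult_gamma_series[OF T notint[OF N'(4)[OF p(1)]], of z] by simp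
  then show False
    using N(3)[OF p(2)] sin_prod_nonzero[of T a p, OF notint[OF N'(4)[OF p(1)]]] by simp
qed

theorem mainTheorem5:
  fixes a :: "'j::finite \<Rightarrow> nat^'n::finite"
    and T :: "'j set set"
    and nu :: "complex^('n option)"
  assumes distinct: "inj a"
    and N_ge: "CARD('j) \<ge> CARD('n) + 1"
    and triang: "regular_unimodular_triangulation a T"
    and no_pole: "\<forall>z::complex^'j. (\<forall>j. 0 < Re (z $ j)) \<longrightarrow>
                    (\<exists>U V F. J_continuation a z U V F \<and> nu \<in> U)"
    and generic: "\<forall>\<sigma>\<in>T. \<forall>l\<in>lambdas \<sigma>. \<forall>j\<in>\<sigma>.
                    Ainv a \<sigma> nu j + Ainv a \<sigma> (Abar_mult a \<sigma> l) j \<notin> \<int>\<^sub>\<le>\<^sub>0"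
  shows "\<exists>W :: (complex^'j) set. open W \<and> W \<noteq> {} \<and>
           (\<forall>z\<in>W. (\<forall>j. 0 < Re (z $ j)) \<and>
              (\<forall>\<sigma>\<in>T. (\<lambda>l. norm (gamma_term a \<sigma> nu z l)) summable_on lambdas \<sigma>) \<and>
              (\<forall>U V F. J_continuation a z U V F \<and> nu \<in> U \<longrightarrow>
                 F nu = (\<Sum>\<sigma>\<in>T. gamma_prefactor a \<sigma> nu z *
                                  infsum (gamma_term a \<sigma> nu z) (lambdas \<sigma>))))"
proof -
  have gen: "Ainv a \<sigma> nu j + of_int (mm a \<sigma> l j) \<notin> \<int>\<^sub>\<le>\<^sub>0" if "\<sigma> \<in> T" "l \<in> lambdas \<sigma>" "j \<in> \<sigma>" for \<sigma> l j
    using generic that Ainv_Abar_mult[OF triangulation_simplex[OF triang that(1)], of l j] by metis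
  show ?thesis
  proof (intro exI[of _ "conv_region a T"] conjI ballI allI impI)
    show "open (conv_region a T)" by (rule open_conv_region)
    show "conv_region a T \<noteq> {}" by (rule conv_region_nonempty[OF triang])
    fix z assume z: "z \<in> conv_region a T"
    show "0 < Re (z $ j)" for j by (rule conv_region_Re_pos[OF z])
    show "(\<lambda>l. norm (gamma_term a \<sigma> nu z l)) summable_on lambdas \<sigma>" if "\<sigma> \<in> T" for \<sigma>
      by (rule gamma_series_local(1)[OF triangulation_simplex[OF triang that] that z gen[OF that]])
    fix U V F assume "J_continuation a z U V F \<and> nu \<in> U"
    then show "F nu = (\<Sum>\<sigma>\<in>T. gamma_prefactor a \<sigma> nu z * infsum (gamma_term a \<sigma> nu z) (lambdas \<sigma>))"
      using continuation_eq_gamma_series[OF distinct triang z gen] unfolding gamma_series_def by blast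
  qed
qed

end
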